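(* (1) Let $G=(V,E)$ be a finite graph with coupling constants $J\in(0,\infty)^E$, and write $p^\dagger(J)_e=1-e^{-4J_e}$. Then for every $p\in[0,1]^E$ with $p<p^\dagger(J)$ pointwise (i.e. $p_e<p^\dagger(J)_e$ for every $e$), the measure $\mathcal E_{J,p}$ satisfies the weak$^\dagger$ FKG inequality, and for any coupling constants $J_2\ge J_1\ge J$ (pointwise), $\mathcal E_{J_1,p}\preccurlyeq^\dagger\mathcal E_{J_2,p}$. (2) There is a finite graph $G=(V,E)$ such that, for every $J\in(0,\infty)^E$ and every $p\in[0,1]^E$ with $p\ge p^\dagger(J)$ pointwise, the measure $\mathcal E_{J,p}$ does not satisfy the weak$^\dagger$ FKG inequality; moreover, there is $J'\ge J$ such that $\mathcal E_{J,p}\preccurlyeq^\dagger\mathcal E_{J',p}$ does not hold.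
   Context: For a finite graph $G=(V,E)$ and coupling constants $J\in(0,\infty)^E$, the (free) Ising model is the probability measure on $\{\pm1\}^V$ with $\mathbb P_J(\sigma)\propto \exp\big(2\sum_{e\in E}J_e\xi(\sigma)_e\big)$, where $\xi(\sigma)\in\{0,1\}^E$, $\xi(\sigma)_{xy}=\mathbf 1_{\sigma(x)=\sigma(y)}$ for each edge $(xy)$. The Ising energy field $\mathcal E_J$ is the law of $\xi(\sigma)$ for $\sigma\sim\mathbb P_J$. Configurations in $\{0,1\}^E$ are identified with subsets of $E$. For probability measures $\mu,\nu$ on $\{0,1\}^E$, $\mu\cap\nu$ (resp. $\mu\cup\nu$) is the law of $\omega\cap\omega'$ (resp. $\omega\cup\omega'$) with $\omega\sim\mu,\omega'\sim\nu$ independent; $\mathrm{Ber}_p$ is the product Bernoulli measure; $\mathcal E_{J,p}=\mathcal E_J\cap\mathrm{Ber}_p$. $\preccurlyeq$ is stochastic domination ($\mu(A)\le\nu(A)$ for all increasing events $A$). Weak$^\dagger$ domination: $\mu\preccurlyeq^\dagger\nu$ means that there exist $a\in(0,1]^E$ and $b\in[0,1)^E$ such that $\mu\cap\mathrm{Ber}_a\preccurlyeq\nu\cap\mathrm{Ber}_a$ and $\mu\cup\mathrm{Ber}_b\preccurlyeq\nu\cup\mathrm{Ber}_b$. A measure $\rho$ satisfies FKG if $\rho(fg)\ge\rho(f)\rho(g)$ for all increasing $f,g:\{0,1\}^E\to\mathbb R$. Weak$^\dagger$ FKG: $\mu$ satisfies it if there exist $a\in(0,1]^E$ and $b\in[0,1)^E$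 such that $\mu\cap\mathrm{Ber}_a$ and $\mu\cup\mathrm{Ber}_b$ both satisfy FKG. *)

theory Defs
  imports "HOL-Probability.Probability" "HOL-Probability.Product_PMF"
begin

text \<open>
  Graphs are finite and simple; an edge is the two-element set of its endpoints.  Edge-indexed
  families such as coupling constants are functions on all of \<open>'v set\<close>, of which only the values
  on \<open>E\<close> matter.  A configuration in \<open>{0,1}\<^sup>E\<close> is a subset of \<open>E\<close>, and a probability measure on
  \<open>{0,1}\<^sup>E\<close> is a pmf on edge sets that is supported on \<open>Pow E\<close>.
\<close>

definition finite_graph :: "'v set \<Rightarrow> 'v set set \<Rightarrow> bool" where
  "finite_graph V E \<longleftrightarrow> finite V \<and> (\<forall>e\<in>E. \<exists>x\<in>V. \<exists>y\<in>V. x \<noteq> y \<and> e = {x, y})"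

lemma finite_graph_finite_edges:
  assumes "finite_graph V E" shows "finite E"
proof (rule finite_subset)
  show "E \<subseteq> Pow V" using assms by (fastforce simp: finite_graph_def)
  show "finite (Pow V)" using assms by (simp add: finite_graph_def)
qed

definition spins :: "'v set \<Rightarrow> ('v \<Rightarrow> int) set" where
  "spins V = V \<rightarrow>\<^sub>E {-1, 1}"

definition xi :: "'v set set \<Rightarrow> ('v \<Rightarrow> int) \<Rightarrow> 'v set set" where
  "xi E \<sigma> = {e \<in> E. \<forall>x\<in>e. \<forall>y\<in>e. \<sigma> x = \<sigma> y}"

definition ising_weight :: "'v set set \<Rightarrow> ('v set \<Rightarrow> real) \<Rightarrow> ('v \<Rightarrow> int) \<Rightarrow> real" where
  "ising_weight E J \<sigma> = exp (2 * (\<Sum>e\<in>E. J e * of_bool (e \<in> xi E \<sigma>)))"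

definition ising :: "'v set \<Rightarrow> 'v set set \<Rightarrow> ('v set \<Rightarrow> real) \<Rightarrow> ('v \<Rightarrow> int) pmf" where
  "ising V E J = embed_pmf (\<lambda>\<sigma>. if \<sigma> \<in> spins V
     then ising_weight E J \<sigma> / (\<Sum>\<tau>\<in>spins V. ising_weight E J \<tau>) else 0)"

lemma finite_spins: "finite V \<Longrightarrow> finite (spins V)"
  by (simp add: spins_def finite_PiE)

lemma spins_nonempty: "spins V \<noteq> {}"
  by (simp add: spins_def PiE_eq_empty_iff)

lemma pmf_ising:
  assumes "finite V"
  shows "pmf (ising V E J) \<sigma> = (if \<sigma> \<in> spins V
     then ising_weight E J \<sigma> / (\<Sum>\<tau>\<in>spins V. ising_weight E J \<tau>) else 0)"
proof -
  let ?Z = "\<Sum>\<tau>\<in>spins V. ising_weight E J \<tau>"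
  let ?f = "\<lambda>\<sigma>. if \<sigma> \<in> spins V then ising_weight E J \<sigma> / ?Z else 0"
  note fin = finite_spins[OF assms]
  have Z: "?Z > 0"
    by (rule sum_pos[OF fin spins_nonempty]) (simp add: ising_weight_def)
  have nonneg: "0 \<le> ?f \<tau>" for \<tau>
    using Z by (simp add: ising_weight_def)
  have "(\<integral>\<^sup>+ \<tau>. ennreal (?f \<tau>) \<partial>count_space UNIV) = (\<Sum>\<tau>\<in>spins V. ennreal (?f \<tau>))"
    by (rule nn_integral_count_space'[OF fin]) auto
  also have "\<dots> = ennreal (\<Sum>\<tau>\<in>spins V. ?f \<tau>)"
    by (intro sum_ennreal nonneg)
  also have "(\<Sum>\<tau>\<in>spins V. ?f \<tau>) = 1"
    using Z by (simp add: sum_divide_distrib[symmetric])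
  finally show ?thesis
    unfolding ising_def by (subst pmf_embed_pmf) (use nonneg in simp_all)
qed

definition energy_field :: "'v set \<Rightarrow> 'v set set \<Rightarrow> ('v set \<Rightarrow> real) \<Rightarrow> 'v set set pmf" where
  "energy_field V E J = map_pmf (xi E) (ising V E J)"

definition inter_pmf :: "'e set pmf \<Rightarrow> 'e set pmf \<Rightarrow> 'e set pmf" where
  "inter_pmf \<mu> \<nu> = map_pmf (\<lambda>(\<omega>, \<omega>'). \<omega> \<inter> \<omega>') (pair_pmf \<mu> \<nu>)"

definition union_pmf :: "'e set pmf \<Rightarrow> 'e set pmf \<Rightarrow> 'e set pmf" where
  "union_pmf \<mu> \<nu> = map_pmf (\<lambda>(\<omega>, \<omega>'). \<omega> \<union> \<omega>') (pair_pmf \<mu> \<nu>)"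

definition Ber :: "'e set \<Rightarrow> ('e \<Rightarrow> real) \<Rightarrow> 'e set pmf" where
  "Ber E p = map_pmf (\<lambda>h. {e \<in> E. h e}) (Pi_pmf E False (\<lambda>e. bernoulli_pmf (p e)))"

definition energy_field_perc ::
    "'v set \<Rightarrow> 'v set set \<Rightarrow> ('v set \<Rightarrow> real) \<Rightarrow> ('v set \<Rightarrow> real) \<Rightarrow> 'v set set pmf" where
  "energy_field_perc V E J p = inter_pmf (energy_field V E J) (Ber E p)"

definition increasing_event :: "'e set \<Rightarrow> 'e set set \<Rightarrow> bool" where
  "increasing_event E A \<longleftrightarrow>
     A \<subseteq> Pow E \<and> (\<forall>\<omega>\<in>A. \<forall>\<omega>'\<in>Pow E. \<omega> \<subseteq> \<omega>' \<longrightarrow> \<omega>' \<in> A)"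

definition stoch_dom :: "'e set \<Rightarrow> 'e set pmf \<Rightarrow> 'e set pmf \<Rightarrow> bool" where
  "stoch_dom E \<mu> \<nu> \<longleftrightarrow>
     (\<forall>A. increasing_event E A \<longrightarrow> measure_pmf.prob \<mu> A \<le> measure_pmf.prob \<nu> A)"

definition weak_dagger_dom :: "'e set \<Rightarrow> 'e set pmf \<Rightarrow> 'e set pmf \<Rightarrow> bool" where
  "weak_dagger_dom E \<mu> \<nu> \<longleftrightarrow>
     (\<exists>a \<in> E \<rightarrow> {0<..1}. \<exists>b \<in> E \<rightarrow> {0..<1}.
        stoch_dom E (inter_pmf \<mu> (Ber E a)) (inter_pmf \<nu> (Ber E a)) \<and>
        stoch_dom E (union_pmf \<mu> (Ber E b)) (union_pmf \<nu> (Ber E b)))"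

definition FKG :: "'e set \<Rightarrow> 'e set pmf \<Rightarrow> bool" where
  "FKG E \<rho> \<longleftrightarrow>
     (\<forall>f g :: 'e set \<Rightarrow> real. mono_on (Pow E) f \<longrightarrow> mono_on (Pow E) g \<longrightarrow>
        measure_pmf.expectation \<rho> (\<lambda>\<omega>. f \<omega> * g \<omega>)
          \<ge> measure_pmf.expectation \<rho> f * measure_pmf.expectation \<rho> g)"

definition weak_dagger_FKG :: "'e set \<Rightarrow> 'e set pmf \<Rightarrow> bool" where
  "weak_dagger_FKG E \<mu> \<longleftrightarrow>
     (\<exists>a \<in> E \<rightarrow> {0<..1}. \<exists>b \<in> E \<rightarrow> {0..<1}.
        FKG E (inter_pmf \<mu> (Ber E a)) \<and> FKG E (union_pmf \<mu> (Ber E b)))"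

definition p_dagger :: "('e \<Rightarrow> real) \<Rightarrow> 'e \<Rightarrow> real" where
  "p_dagger J e = 1 - exp (- 4 * J e)"

end

theory Submission
  imports Defs
begin

text \<open>
  Let \<open>\<eta>\<close> be the open or the closed edges of the percolated energy field.  Intersecting \<open>\<eta>\<close> with a
  Bernoulli set of small density \<open>\<epsilon>\<close> makes the probabilities \<open>Z S\<close> of \<open>S \<subseteq> \<eta>\<close> decisive, because
  overlapping sets \<open>S\<close>, \<open>T\<close> gain a power of \<open>\<epsilon>\<close>: positive association follows from
  \<open>Z S * Z T < Z (S \<union> T)\<close> for disjoint nonempty \<open>S\<close>, \<open>T\<close>, and domination from strict monotonicity of
  \<open>Z\<close> in the coupling.  Both are Ginibre inequalities for Ising partition functions.  Closing edges
  lowers the coupling \<open>J e\<close> to \<open>J e + ln (1 - p e) / 2\<close>, and duplicating the spins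
  shows that \<open>-J e\<close> is the threshold, that is, \<open>p e < p_dagger J e\<close>.  The inequalities are strict inside
  a class of edges linked by minimal cuts, and different classes are independent, so each is
  treated separately.

  On the four-cycle with \<open>p \<ge> p_dagger J\<close>, the sign of the correlation between the closure of a set of
  edges and that of a further edge depends on the parity of the set, which rules out association
  for every density of the Bernoulli set.
\<close>

section \<open>Random subsets of a finite set\<close>

text \<open>Thinning leaves errors that are smaller than the main terms only by a factor \<epsilon>,
  so an equality \<open>Z S * Z T = Z (S \<union> T)\<close> would leave no room for them. Equality
  does occur when \<open>S\<close> and \<open>T\<close> lie in different blocks of the graph; this
  is why the edges are grouped and each group receives its own density. The constant 4 in
  \<open>p_dagger\<close> comes from the duplication. Where the two copies agree their couplings
  add, and as \<open>S\<close> and \<open>T\<close> are disjoint, an edge contributes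
  \<open>J e\<close> once and at worst \<open>J e + ln (1 - p e) / 2\<close> the other time. The sum
  is positive exactly when \<open>1 - p e > exp (- 4 * J e)\<close>. For open edges the
  corresponding condition holds for every \<open>p\<close>, so the threshold is felt only by closed
  edges, that is, by the union half of the weak dagger notions. A sign \<open>\<gamma>\<close>
  distinguishes open edges (1) from closed ones (-1). A correlation between two sets of edges
  carries its square, the response to a change of coupling carries \<open>\<gamma>\<close> itself:
  closed edges are positively associated too, but become rarer as the coupling grows.\<close>

lemma finite_set_pmf_Pow: "set_pmf \<mu> \<subseteq> Pow D \<Longrightarrow> finite D \<Longrightarrow> finite (set_pmf \<mu>)"
  by (meson finite_Pow_iff finite_subset)

lemma expectation_pair_pmf:
  fixes f :: "'a \<Rightarrow> 'b \<Rightarrow> real"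
  assumes "finite (set_pmf \<mu>)" "finite (set_pmf \<nu>)"
  shows "measure_pmf.expectation (pair_pmf \<mu> \<nu>) (\<lambda>(x, y). f x y)
    = measure_pmf.expectation \<mu> (\<lambda>x. measure_pmf.expectation \<nu> (f x))"
  unfolding pair_pmf_def using assms
  by (simp add: pmf_expectation_bind[where A = "set_pmf \<mu>"] pmf_expectation_bind[where A = "set_pmf \<nu>"]
      integral_measure_pmf[where A = "set_pmf \<mu>"] integral_measure_pmf[where A = "set_pmf \<nu>"])

lemma prob_pair_pmf:
  assumes "finite (set_pmf \<mu>)" "finite (set_pmf \<nu>)"
  shows "measure_pmf.prob (pair_pmf \<mu> \<nu>) {z. P (fst z) (snd z)}
    = measure_pmf.expectation \<mu> (\<lambda>x. measure_pmf.prob \<nu> {y. P x y})"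
proof -
  have "(\<lambda>(x, y). indicator {y. P x y} y :: real) = indicator {z. P (fst z) (snd z)}"
    by (auto simp: fun_eq_iff indicator_def)
  then have "measure_pmf.prob (pair_pmf \<mu> \<nu>) {z. P (fst z) (snd z)}
    = measure_pmf.expectation (pair_pmf \<mu> \<nu>) (\<lambda>(x, y). indicator {y. P x y} y)"
    by simp
  also have "\<dots> = measure_pmf.expectation \<mu> (\<lambda>x. measure_pmf.prob \<nu> {y. P x y})"
    by (subst expectation_pair_pmf[OF assms]) simp
  finally show ?thesis .
qed

lemma prob_pair_pmf_conj:
  assumes "finite (set_pmf \<mu>)" "finite (set_pmf \<nu>)"
  shows "measure_pmf.prob (pair_pmf \<mu> \<nu>) {z. P (fst z) \<and> Q (snd z)}
    = measure_pmf.prob \<mu> {x. P x} * measure_pmf.prob \<nu> {y. Q y}"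
proof -
  have "measure_pmf.prob \<nu> {y. P x \<and> Q y} = indicator {x. P x} x * measure_pmf.prob \<nu> {y. Q y}" for x
    by (simp add: indicator_def)
  then show ?thesis
    by (simp add: prob_pair_pmf[OF assms, where P = "\<lambda>x y. P x \<and> Q y"])
qed

lemma prob_cong_support:
  assumes "\<And>\<omega>. \<omega> \<in> set_pmf \<mu> \<Longrightarrow> \<omega> \<in> A \<longleftrightarrow> \<omega> \<in> B"
  shows "measure_pmf.prob \<mu> A = measure_pmf.prob \<mu> B"
  by (rule measure_pmf.finite_measure_eq_AE) (auto simp: AE_measure_pmf_iff assms)

lemma expectation_cong_support:
  assumes "\<And>\<omega>. \<omega> \<in> set_pmf \<mu> \<Longrightarrow> f \<omega> = g \<omega>"
  shows "measure_pmf.expectation \<mu> f = measure_pmf.expectation \<mu> g"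
  by (rule integral_cong_AE) (auto simp: AE_measure_pmf_iff assms)

lemma expectation_mono_support:
  fixes f g :: "'a \<Rightarrow> real"
  assumes "finite (set_pmf \<mu>)" "\<And>\<omega>. \<omega> \<in> set_pmf \<mu> \<Longrightarrow> f \<omega> \<le> g \<omega>"
  shows "measure_pmf.expectation \<mu> f \<le> measure_pmf.expectation \<mu> g"
  by (rule integral_mono_AE) (auto simp: AE_measure_pmf_iff assms integrable_measure_pmf_finite)

text \<open>Inclusion-exclusion from the top: once the masses of all strictly larger sets agree, the
  superset probabilities leave only the mass of \<open>S\<close> itself to compare. Superset events
  are the convenient ones because thinning multiplies their probabilities by a product over
  \<open>S\<close>.\<close>

lemma pmf_eqI_prob_superset:
  assumes D: "finite D" and \<mu>: "set_pmf \<mu> \<subseteq> Pow D" and \<nu>: "set_pmf \<nu> \<subseteq> Pow D"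
    and eq: "\<And>S. S \<subseteq> D \<Longrightarrow> measure_pmf.prob \<mu> {\<omega>. S \<subseteq> \<omega>} = measure_pmf.prob \<nu> {\<omega>. S \<subseteq> \<omega>}"
  shows "\<mu> = \<nu>"
proof (rule pmf_eqI)
  have *: "measure_pmf.prob \<rho> {\<omega>. S \<subseteq> \<omega>} = pmf \<rho> S + (\<Sum>\<omega> | S \<subset> \<omega> \<and> \<omega> \<subseteq> D. pmf \<rho> \<omega>)"
    if "set_pmf \<rho> \<subseteq> Pow D" "S \<subseteq> D" for \<rho> S
  proof -
    have "measure_pmf.prob \<rho> {\<omega>. S \<subseteq> \<omega>} = measure_pmf.prob \<rho> (insert S {\<omega>. S \<subset> \<omega> \<and> \<omega> \<subseteq> D})"
      by (rule prob_cong_support) (use that in auto)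
    then show ?thesis
      using D by (simp add: measure_measure_pmf_finite)
  qed
  fix S
  show "pmf \<mu> S = pmf \<nu> S"
  proof (cases "S \<subseteq> D")
    case True
    then show ?thesis
    proof (induction "card (D - S)" arbitrary: S rule: less_induct)
      case less
      have "(\<Sum>\<omega> | S \<subset> \<omega> \<and> \<omega> \<subseteq> D. pmf \<mu> \<omega>) = (\<Sum>\<omega> | S \<subset> \<omega> \<and> \<omega> \<subseteq> D. pmf \<nu> \<omega>)"
        by (intro sum.cong refl less(1)) (use D in \<open>auto intro!: psubset_card_mono\<close>)
      then show ?case
        using *[OF \<mu> less(2)] *[OF \<nu> less(2)] eq[OF less(2)] by simp
    qed
  next
    case False
    then show ?thesis
      using \<mu> \<nu> by (metis Pow_iff pmf_eq_0_set_pmf subsetD)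
  qed
qed

section \<open>Bernoulli sets, intersections and unions\<close>

lemma set_pmf_Ber: "finite D \<Longrightarrow> set_pmf (Ber D a) \<subseteq> Pow D"
  by (auto simp: Ber_def)

lemma finite_set_pmf_Ber: "finite D \<Longrightarrow> finite (set_pmf (Ber D a))"
  using finite_set_pmf_Pow set_pmf_Ber by blast

lemma Ber_cong: "(\<And>e. e \<in> D \<Longrightarrow> a e = b e) \<Longrightarrow> Ber D a = Ber D b"
  unfolding Ber_def by (intro arg_cong2[where f = map_pmf] Pi_pmf_cong refl) simp

lemma prob_Ber_Pi:
  assumes "finite D"
  shows "measure_pmf.prob (Ber D a) {\<omega>. \<forall>e\<in>D. (e \<in> \<omega>) \<in> B e}
    = (\<Prod>e\<in>D. measure_pmf.prob (bernoulli_pmf (a e)) (B e))"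
proof -
  have "(\<lambda>h. {e \<in> D. h e}) -` {\<omega>. \<forall>e\<in>D. (e \<in> \<omega>) \<in> B e} = Pi D B"
    by auto
  then show ?thesis
    using assms by (simp add: Ber_def measure_Pi_pmf_Pi)
qed

lemma prob_bernoulli_True: "0 \<le> q \<Longrightarrow> q \<le> 1 \<Longrightarrow> measure_pmf.prob (bernoulli_pmf q) {True} = q"
  by (simp add: measure_pmf_single)

lemma prob_bernoulli_False: "0 \<le> q \<Longrightarrow> q \<le> 1 \<Longrightarrow> measure_pmf.prob (bernoulli_pmf q) {False} = 1 - q"
  by (simp add: measure_pmf_single)

lemma prob_Ber_superset:
  assumes D: "finite D" and S: "S \<subseteq> D" and a: "a \<in> D \<rightarrow> {0..1}"
  shows "measure_pmf.prob (Ber D a) {\<omega>. S \<subseteq> \<omega>} = (\<Prod>e\<in>S. a e)"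
proof -
  have "{\<omega>. S \<subseteq> \<omega>} = {\<omega>. \<forall>e\<in>D. (e \<in> \<omega>) \<in> (if e \<in> S then {True} else UNIV)}"
    using S by auto
  then have "measure_pmf.prob (Ber D a) {\<omega>. S \<subseteq> \<omega>}
    = (\<Prod>e\<in>D. if e \<in> S then a e else 1)"
    using a by (simp only: prob_Ber_Pi[OF D])
      (intro prod.cong refl, use a in \<open>auto simp: prob_bernoulli_True Pi_iff\<close>)
  also have "\<dots> = (\<Prod>e\<in>S. a e)"
    using D S by (simp add: prod.If_cases Int_absorb1)
  finally show ?thesis .
qed

lemma prob_Ber_disjoint:
  assumes D: "finite D" and S: "S \<subseteq> D" and a: "a \<in> D \<rightarrow> {0..1}"
  shows "measure_pmf.prob (Ber D a) {\<omega>. S \<inter> \<omega> = {}} = (\<Prod>e\<in>S. 1 - a e)"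
proof -
  have "{\<omega>. S \<inter> \<omega> = {}} = {\<omega>. \<forall>e\<in>D. (e \<in> \<omega>) \<in> (if e \<in> S then {False} else UNIV)}"
    using S by auto
  then have "measure_pmf.prob (Ber D a) {\<omega>. S \<inter> \<omega> = {}}
    = (\<Prod>e\<in>D. if e \<in> S then 1 - a e else 1)"
    using a by (simp only: prob_Ber_Pi[OF D])
      (intro prod.cong refl, use a in \<open>auto simp: prob_bernoulli_False Pi_iff\<close>)
  also have "\<dots> = (\<Prod>e\<in>S. 1 - a e)"
    using D S by (simp add: prod.If_cases Int_absorb1)
  finally show ?thesis .
qed

lemma pmf_Ber:
  assumes D: "finite D" and S: "S \<subseteq> D" and a: "a \<in> D \<rightarrow> {0..1}"
  shows "pmf (Ber D a) S = (\<Prod>e\<in>S. a e) * (\<Prod>e\<in>D - S. 1 - a e)"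
proof -
  have "pmf (Ber D a) S = measure_pmf.prob (Ber D a) {S}"
    by (simp add: measure_pmf_single)
  also have "\<dots> = measure_pmf.prob (Ber D a) {\<omega>. \<forall>e\<in>D. (e \<in> \<omega>) \<in> {e \<in> S}}"
    by (rule prob_cong_support) (use set_pmf_Ber[OF D, of a] S in auto)
  also have "\<dots> = (\<Prod>e\<in>D. if e \<in> S then a e else 1 - a e)"
    unfolding prob_Ber_Pi[OF D]
    by (intro prod.cong refl) (use a in \<open>auto simp: prob_bernoulli_True prob_bernoulli_False Pi_iff\<close>)
  also have "\<dots> = (\<Prod>e\<in>S. a e) * (\<Prod>e\<in>D - S. 1 - a e)"
    using D S by (simp add: prod.If_cases Int_absorb1 Diff_eq)
  finally show ?thesis .
qed

lemma set_pmf_inter: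
  "finite D \<Longrightarrow> set_pmf (inter_pmf \<mu> (Ber D a)) \<subseteq> Pow D"
  unfolding inter_pmf_def by (auto dest!: subsetD[OF set_pmf_Ber])

lemma set_pmf_union:
  "set_pmf \<mu> \<subseteq> Pow D \<Longrightarrow> set_pmf \<nu> \<subseteq> Pow D \<Longrightarrow> set_pmf (union_pmf \<mu> \<nu>) \<subseteq> Pow D"
  unfolding union_pmf_def by (auto dest!: subsetD)

lemma union_pmf_commute: "union_pmf \<mu> \<nu> = union_pmf \<nu> \<mu>"
  unfolding union_pmf_def by (subst pair_commute_pmf) (simp add: map_pmf_comp case_prod_unfold Un_commute)

lemma prob_inter_superset:
  assumes D: "finite D" and \<mu>: "finite (set_pmf \<mu>)" and a: "a \<in> D \<rightarrow> {0..1}" and S: "S \<subseteq> D"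
  shows "measure_pmf.prob (inter_pmf \<mu> (Ber D a)) {\<omega>. S \<subseteq> \<omega>}
    = measure_pmf.prob \<mu> {\<omega>. S \<subseteq> \<omega>} * (\<Prod>e\<in>S. a e)"
proof -
  have "(\<lambda>(\<omega>, \<omega>'). \<omega> \<inter> \<omega>') -` {\<omega>. S \<subseteq> \<omega>} = {z. S \<subseteq> fst z \<and> S \<subseteq> snd z}"
    by auto
  then show ?thesis
    using prob_pair_pmf_conj[OF \<mu> finite_set_pmf_Ber[OF D, of a], of "\<lambda>\<omega>. S \<subseteq> \<omega>" "\<lambda>\<omega>. S \<subseteq> \<omega>"]
    by (simp add: inter_pmf_def prob_Ber_superset[OF D S a])
qed

text \<open>Superset probabilities determine the law and factor on both sides. So the thinned set is
  distributed as the union of independent copies of its two parts.\<close>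

lemma inter_pmf_Ber_Un:
  assumes fin: "finite D1" "finite D2" and disj: "D1 \<inter> D2 = {}" and \<mu>: "finite (set_pmf \<mu>)"
    and a: "a \<in> D1 \<union> D2 \<rightarrow> {0..1}"
    and indep: "\<And>S1 S2. S1 \<subseteq> D1 \<Longrightarrow> S2 \<subseteq> D2 \<Longrightarrow> measure_pmf.prob \<mu> {\<omega>. S1 \<union> S2 \<subseteq> \<omega>}
      = measure_pmf.prob \<mu> {\<omega>. S1 \<subseteq> \<omega>} * measure_pmf.prob \<mu> {\<omega>. S2 \<subseteq> \<omega>}"
  shows "inter_pmf \<mu> (Ber (D1 \<union> D2) a) = union_pmf (inter_pmf \<mu> (Ber D1 a)) (inter_pmf \<mu> (Ber D2 a))"
proof (rule pmf_eqI_prob_superset)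
  let ?\<mu>1 = "inter_pmf \<mu> (Ber D1 a)" and ?\<mu>2 = "inter_pmf \<mu> (Ber D2 a)"
  have s1: "set_pmf ?\<mu>1 \<subseteq> Pow D1" and s2: "set_pmf ?\<mu>2 \<subseteq> Pow D2"
    using fin set_pmf_inter by blast+
  show "set_pmf (union_pmf ?\<mu>1 ?\<mu>2) \<subseteq> Pow (D1 \<union> D2)"
    using s1 s2 by (intro set_pmf_union) auto
  show "set_pmf (inter_pmf \<mu> (Ber (D1 \<union> D2) a)) \<subseteq> Pow (D1 \<union> D2)"
    using fin by (intro set_pmf_inter) auto
  fix S assume S: "S \<subseteq> D1 \<union> D2"
  let ?S1 = "S \<inter> D1" and ?S2 = "S \<inter> D2"
  have a': "a \<in> D1 \<rightarrow> {0..1}" "a \<in> D2 \<rightarrow> {0..1}"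
    using a by auto
  have SS: "S = ?S1 \<union> ?S2"
    using S by auto
  have "measure_pmf.prob (union_pmf ?\<mu>1 ?\<mu>2) {\<omega>. S \<subseteq> \<omega>}
    = measure_pmf.prob (pair_pmf ?\<mu>1 ?\<mu>2) {z. ?S1 \<subseteq> fst z \<and> ?S2 \<subseteq> snd z}"
    unfolding union_pmf_def measure_map_pmf
  proof (rule prob_cong_support)
    fix z assume "z \<in> set_pmf (pair_pmf ?\<mu>1 ?\<mu>2)"
    then have "fst z \<in> set_pmf ?\<mu>1" "snd z \<in> set_pmf ?\<mu>2"
      by auto
    then have "fst z \<subseteq> D1" "snd z \<subseteq> D2"
      using s1 s2 by blast+
    then have "S \<subseteq> fst z \<union> snd z \<longleftrightarrow> ?S1 \<subseteq> fst z \<and> ?S2 \<subseteq> snd z"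
      using disj S by blast
    then show "z \<in> (\<lambda>(\<omega>, \<omega>'). \<omega> \<union> \<omega>') -` {\<omega>. S \<subseteq> \<omega>} \<longleftrightarrow> z \<in> {z. ?S1 \<subseteq> fst z \<and> ?S2 \<subseteq> snd z}"
      by (auto simp: split_beta)
  qed
  also have "\<dots> = measure_pmf.prob ?\<mu>1 {\<omega>. ?S1 \<subseteq> \<omega>} * measure_pmf.prob ?\<mu>2 {\<omega>. ?S2 \<subseteq> \<omega>}"
    by (rule prob_pair_pmf_conj) (use s1 s2 fin finite_set_pmf_Pow in blast)+
  also have "\<dots> = measure_pmf.prob \<mu> {\<omega>. ?S1 \<union> ?S2 \<subseteq> \<omega>} * ((\<Prod>e\<in>?S1. a e) * (\<Prod>e\<in>?S2. a e))"
    by (subst indep) (auto simp: prob_inter_superset fin \<mu> a')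
  also have "(\<Prod>e\<in>?S1. a e) * (\<Prod>e\<in>?S2. a e) = (\<Prod>e\<in>?S1 \<union> ?S2. a e)"
    using fin disj by (intro prod.union_disjoint[symmetric]) auto
  also have "measure_pmf.prob \<mu> {\<omega>. ?S1 \<union> ?S2 \<subseteq> \<omega>} * \<dots>
    = measure_pmf.prob (inter_pmf \<mu> (Ber (D1 \<union> D2) a)) {\<omega>. S \<subseteq> \<omega>}"
    unfolding SS[symmetric] using fin by (intro prob_inter_superset[symmetric] \<mu> a S) auto
  finally show "measure_pmf.prob (inter_pmf \<mu> (Ber (D1 \<union> D2) a)) {\<omega>. S \<subseteq> \<omega>}
    = measure_pmf.prob (union_pmf ?\<mu>1 ?\<mu>2) {\<omega>. S \<subseteq> \<omega>}" ..
qed (use fin in auto)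

section \<open>Positive association and domination\<close>

lemma FKG_subset:
  assumes "FKG D \<rho>" "D \<subseteq> E" shows "FKG E \<rho>"
proof -
  have "mono_on (Pow D) f" if "mono_on (Pow E) f" for f :: "_ \<Rightarrow> real"
    by (rule mono_on_subset[OF that]) (use assms in auto)
  then show ?thesis
    using assms unfolding FKG_def by blast
qed

text \<open>Conditioning on the first set: association of \<open>\<nu>\<close> handles the inner
  expectation of the product, and the two inner expectations are again increasing, so association of
  \<open>\<mu>\<close> handles the outer one.\<close>

lemma FKG_union:
  assumes E: "finite E" and \<mu>: "set_pmf \<mu> \<subseteq> Pow E" "FKG E \<mu>" and \<nu>: "set_pmf \<nu> \<subseteq> Pow E" "FKG E \<nu>"
  shows "FKG E (union_pmf \<mu> \<nu>)"
  unfolding FKG_def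
proof (intro allI impI)
  fix f g :: "'a set \<Rightarrow> real"
  assume f: "mono_on (Pow E) f" and g: "mono_on (Pow E) g"
  note fin = finite_set_pmf_Pow[OF \<mu>(1) E] finite_set_pmf_Pow[OF \<nu>(1) E]
  have U: "measure_pmf.expectation (union_pmf \<mu> \<nu>) h
      = measure_pmf.expectation \<mu> (\<lambda>\<omega>. measure_pmf.expectation \<nu> (\<lambda>\<omega>'. h (\<omega> \<union> \<omega>')))"
    for h :: "'a set \<Rightarrow> real"
    using expectation_pair_pmf[OF fin, of "\<lambda>\<omega> \<omega>'. h (\<omega> \<union> \<omega>')"]
    by (simp add: union_pmf_def case_prod_beta')
  have inner: "mono_on (Pow E) (\<lambda>\<omega>'. h (\<omega> \<union> \<omega>'))"
    and outer: "mono_on (Pow E) (\<lambda>\<omega>. measure_pmf.expectation \<nu> (\<lambda>\<omega>'. h (\<omega> \<union> \<omega>')))"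
    if h: "mono_on (Pow E) h" and "\<omega> \<subseteq> E" for h :: "'a set \<Rightarrow> real" and \<omega>
  proof -
    show "mono_on (Pow E) (\<lambda>\<omega>'. h (\<omega> \<union> \<omega>'))"
      by (intro mono_onI mono_onD[OF h]) (use that in auto)
    show "mono_on (Pow E) (\<lambda>\<omega>. measure_pmf.expectation \<nu> (\<lambda>\<omega>'. h (\<omega> \<union> \<omega>')))"
      by (intro mono_onI expectation_mono_support[OF fin(2)] mono_onD[OF h]) (use \<nu>(1) in auto)
  qed
  let ?F = "\<lambda>h \<omega>. measure_pmf.expectation \<nu> (\<lambda>\<omega>'. h (\<omega> \<union> \<omega>'))"
  have "measure_pmf.expectation \<mu> (?F f) * measure_pmf.expectation \<mu> (?F g)
      \<le> measure_pmf.expectation \<mu> (\<lambda>\<omega>. ?F f \<omega> * ?F g \<omega>)"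
    using \<mu>(2) outer[OF f] outer[OF g] unfolding FKG_def by blast
  also have "\<dots> \<le> measure_pmf.expectation \<mu> (?F (\<lambda>\<omega>. f \<omega> * g \<omega>))"
  proof (intro expectation_mono_support fin)
    fix \<omega> assume "\<omega> \<in> set_pmf \<mu>"
    then have "\<omega> \<subseteq> E" using \<mu>(1) by auto
    then show "?F f \<omega> * ?F g \<omega> \<le> ?F (\<lambda>\<omega>. f \<omega> * g \<omega>) \<omega>"
      using \<nu>(2) inner[OF f] inner[OF g] unfolding FKG_def by blast
  qed
  finally show "measure_pmf.expectation (union_pmf \<mu> \<nu>) f * measure_pmf.expectation (union_pmf \<mu> \<nu>) g
      \<le> measure_pmf.expectation (union_pmf \<mu> \<nu>) (\<lambda>\<omega>. f \<omega> * g \<omega>)"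
    by (simp only: U)
qed

lemma stoch_dom_refl: "stoch_dom E \<mu> \<mu>"
  by (simp add: stoch_dom_def)

lemma stoch_dom_trans: "stoch_dom E \<mu> \<nu> \<Longrightarrow> stoch_dom E \<nu> \<rho> \<Longrightarrow> stoch_dom E \<mu> \<rho>"
  unfolding stoch_dom_def by (blast intro: order_trans)

lemma stoch_dom_subset:
  assumes D: "stoch_dom D \<mu> \<nu>" "D \<subseteq> E" and "set_pmf \<mu> \<subseteq> Pow D" "set_pmf \<nu> \<subseteq> Pow D"
  shows "stoch_dom E \<mu> \<nu>"
  unfolding stoch_dom_def
proof (intro allI impI)
  fix A assume "increasing_event E A"
  then have "increasing_event D (A \<inter> Pow D)"
    using D(2) by (auto simp: increasing_event_def)
  moreover have "measure_pmf.prob \<mu> A = measure_pmf.prob \<mu> (A \<inter> Pow D)"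
    "measure_pmf.prob \<nu> A = measure_pmf.prob \<nu> (A \<inter> Pow D)"
    by (rule prob_cong_support, use assms in auto)+
  ultimately show "measure_pmf.prob \<mu> A \<le> measure_pmf.prob \<nu> A"
    using D(1) by (simp add: stoch_dom_def)
qed

lemma stoch_dom_union_right:
  assumes E: "finite E" and \<mu>: "set_pmf \<mu> \<subseteq> Pow E"
    and \<nu>: "set_pmf \<nu>1 \<subseteq> Pow E" "set_pmf \<nu>2 \<subseteq> Pow E" and dom: "stoch_dom E \<nu>1 \<nu>2"
  shows "stoch_dom E (union_pmf \<mu> \<nu>1) (union_pmf \<mu> \<nu>2)"
  unfolding stoch_dom_def
proof (intro allI impI)
  fix A assume A: "increasing_event E A"
  note fin = finite_set_pmf_Pow[OF _ E]
  have U: "measure_pmf.prob (union_pmf \<mu> \<nu>) A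
      = measure_pmf.expectation \<mu> (\<lambda>\<omega>. measure_pmf.prob \<nu> {\<omega>'. \<omega> \<union> \<omega>' \<in> A})"
    if "set_pmf \<nu> \<subseteq> Pow E" for \<nu>
  proof -
    have eq: "(\<lambda>(\<omega>, \<omega>'). \<omega> \<union> \<omega>') -` A = {z. fst z \<union> snd z \<in> A}"
      by (simp add: vimage_def case_prod_unfold)
    show ?thesis
      unfolding union_pmf_def measure_map_pmf eq
      by (rule prob_pair_pmf[OF fin[OF \<mu>] fin[OF that], where P = "\<lambda>\<omega> \<omega>'. \<omega> \<union> \<omega>' \<in> A"])
  qed
  show "measure_pmf.prob (union_pmf \<mu> \<nu>1) A \<le> measure_pmf.prob (union_pmf \<mu> \<nu>2) A"
    unfolding U[OF \<nu>(1)] U[OF \<nu>(2)]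
  proof (intro expectation_mono_support fin \<mu>)
    fix \<omega> assume "\<omega> \<in> set_pmf \<mu>"
    then have \<omega>: "\<omega> \<subseteq> E" using \<mu> by auto
    let ?A = "{\<omega>' \<in> Pow E. \<omega> \<union> \<omega>' \<in> A}"
    have "\<omega> \<union> \<omega>'' \<in> A" if "\<omega> \<union> \<omega>' \<in> A" "\<omega>' \<subseteq> \<omega>''" "\<omega>'' \<subseteq> E" for \<omega>' \<omega>''
    proof -
      have "\<omega> \<union> \<omega>'' \<in> Pow E" "\<omega> \<union> \<omega>' \<subseteq> \<omega> \<union> \<omega>''"
        using \<omega> that by auto
      then show ?thesis
        using A that(1) by (simp add: increasing_event_def)
    qed
    then have "increasing_event E ?A"
      by (auto simp: increasing_event_def)
    moreover have "measure_pmf.prob \<nu> {\<omega>'. \<omega> \<union> \<omega>' \<in> A} = measure_pmf.prob \<nu> ?A"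
      if "set_pmf \<nu> \<subseteq> Pow E" for \<nu>
      by (rule prob_cong_support) (use that in auto)
    ultimately show "measure_pmf.prob \<nu>1 {\<omega>'. \<omega> \<union> \<omega>' \<in> A} \<le> measure_pmf.prob \<nu>2 {\<omega>'. \<omega> \<union> \<omega>' \<in> A}"
      using dom \<nu> by (simp add: stoch_dom_def)
  qed
qed

lemma stoch_dom_union:
  assumes "finite E" and "set_pmf \<mu>1 \<subseteq> Pow E" "set_pmf \<mu>2 \<subseteq> Pow E" "stoch_dom E \<mu>1 \<mu>2"
    and "set_pmf \<nu>1 \<subseteq> Pow E" "set_pmf \<nu>2 \<subseteq> Pow E" "stoch_dom E \<nu>1 \<nu>2"
  shows "stoch_dom E (union_pmf \<mu>1 \<nu>1) (union_pmf \<mu>2 \<nu>2)"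
proof (rule stoch_dom_trans)
  show "stoch_dom E (union_pmf \<mu>1 \<nu>1) (union_pmf \<mu>1 \<nu>2)"
    using assms by (intro stoch_dom_union_right)
  show "stoch_dom E (union_pmf \<mu>1 \<nu>2) (union_pmf \<mu>2 \<nu>2)"
    unfolding union_pmf_commute[of _ \<nu>2] using assms by (intro stoch_dom_union_right)
qed

text \<open>Layer-cake decomposition, by induction on the number of values: cutting \<open>f\<close>
  at its second largest value \<open>m'\<close> removes a multiple of the indicator of the top level
  set, which is an increasing event.\<close>

lemma mono_on_Pow_induct [consumes 2, case_names cong const add]:
  fixes f :: "'a set \<Rightarrow> real"
  assumes E: "finite E" and f: "mono_on (Pow E) f"
    and cong: "\<And>f g. (\<And>\<omega>. \<omega> \<subseteq> E \<Longrightarrow> f \<omega> = g \<omega>) \<Longrightarrow> P f \<Longrightarrow> P g"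
    and const: "\<And>c. P (\<lambda>_. c)"
    and add: "\<And>f c A. P f \<Longrightarrow> 0 \<le> c \<Longrightarrow> increasing_event E A \<Longrightarrow> P (\<lambda>\<omega>. f \<omega> + c * indicator A \<omega>)"
  shows "P f"
  using f
proof (induction "card (f ` Pow E)" arbitrary: f rule: less_induct)
  case less
  let ?I = "f ` Pow E"
  have fin: "finite ?I" and ne: "?I \<noteq> {}"
    using E by auto
  define m where "m = Max ?I"
  have m: "m \<in> ?I" "\<And>\<omega>. \<omega> \<subseteq> E \<Longrightarrow> f \<omega> \<le> m"
    using fin ne unfolding m_def by (auto intro: Max_in[OF _ ne, simplified])
  show ?case
  proof (cases "?I = {m}")
    case True
    then have "f \<omega> = m" if "\<omega> \<subseteq> E" for \<omega>
      using that by blast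
    then show ?thesis
      using cong[of "\<lambda>_. m" f] const by simp
  next
    case False
    define m' where "m' = Max (?I - {m})"
    have ne': "?I - {m} \<noteq> {}"
      using False m(1) by blast
    have m'1: "m' \<in> ?I - {m}"
      unfolding m'_def by (rule Max_in) (use fin ne' in auto)
    have m'2: "f \<omega> \<le> m'" if "\<omega> \<subseteq> E" "f \<omega> \<noteq> m" for \<omega>
      unfolding m'_def by (rule Max_ge) (use fin that in auto)
    have lt: "m' < m"
    proof -
      obtain \<omega> where "\<omega> \<subseteq> E" "m' = f \<omega>" "m' \<noteq> m"
        using m'1 by auto
      then show ?thesis
        using m(2)[of \<omega>] by simp
    qed
    let ?g = "\<lambda>\<omega>. min (f \<omega>) m'" and ?A = "{\<omega> \<in> Pow E. f \<omega> = m}"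
    have g: "?g ` Pow E \<subseteq> ?I - {m}"
    proof (safe)
      fix \<omega> assume "\<omega> \<subseteq> E"
      then show "min (f \<omega>) m' \<in> ?I"
        using m'1 by (auto simp: min_def)
    next
      show "m = min (f \<omega>) m' \<Longrightarrow> False" for \<omega>
        using lt by simp
    qed
    have "card (?g ` Pow E) \<le> card (?I - {m})"
      using fin g by (intro card_mono) auto
    also have "\<dots> < card ?I"
      using fin m(1) by (intro psubset_card_mono) auto
    finally have "P ?g"
      by (intro less(1)) (auto intro!: mono_onI min.mono mono_onD[OF less(2)])
    moreover have "f \<omega>' = m" if "f \<omega> = m" "\<omega> \<subseteq> \<omega>'" "\<omega>' \<subseteq> E" for \<omega> \<omega>'
    proof -
      have "f \<omega> \<le> f \<omega>'"
        by (rule mono_onD[OF less(2)]) (use that in auto)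
      then show ?thesis
        using m(2)[of \<omega>'] that by simp
    qed
    then have "increasing_event E ?A"
      by (auto simp: increasing_event_def)
    ultimately have "P (\<lambda>\<omega>. ?g \<omega> + (m - m') * indicator ?A \<omega>)"
      using lt by (intro add) auto
    moreover have "?g \<omega> + (m - m') * indicator ?A \<omega> = f \<omega>" if "\<omega> \<subseteq> E" for \<omega>
      using that lt m'2[of \<omega>] by (auto simp: indicator_def min_def)
    ultimately show ?thesis
      by (rule cong[rotated])
  qed
qed

text \<open>Both sides of the inequality are bilinear in \<open>f\<close> and \<open>g\<close>, with
  equality for constants, so the layer-cake decomposition reduces it to indicators, one function at
  a time.\<close>

lemma FKG_eventI:
  assumes E: "finite E" and \<rho>: "set_pmf \<rho> \<subseteq> Pow E"
    and events: "\<And>A B. increasing_event E A \<Longrightarrow> increasing_event E B \<Longrightarrow>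
      measure_pmf.prob \<rho> A * measure_pmf.prob \<rho> B \<le> measure_pmf.prob \<rho> (A \<inter> B)"
  shows "FKG E \<rho>"
  unfolding FKG_def
proof (intro allI impI)
  fix f g :: "'a set \<Rightarrow> real"
  assume f: "mono_on (Pow E) f" and g: "mono_on (Pow E) g"
  let ?E = "measure_pmf.expectation \<rho> :: ('a set \<Rightarrow> real) \<Rightarrow> real"
  note fin = finite_set_pmf_Pow[OF \<rho> E]
  note int = integrable_measure_pmf_finite[OF fin]
  have lin: "?E (\<lambda>\<omega>. h \<omega> + c * k \<omega>) = ?E h + c * ?E k" for h k c
    using Bochner_Integration.integral_add[OF int[of h] int[of "\<lambda>\<omega>. c * k \<omega>"]] by simp
  have ind: "?E f * ?E (indicator A) \<le> ?E (\<lambda>\<omega>. f \<omega> * indicator A \<omega>)"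
    if A: "increasing_event E A" for A
    using E f
  proof (induction rule: mono_on_Pow_induct)
    case (cong f g)
    have "?E f = ?E g" "?E (\<lambda>\<omega>. f \<omega> * indicator A \<omega>) = ?E (\<lambda>\<omega>. g \<omega> * indicator A \<omega>)"
      using \<rho> cong(1) by (auto intro!: expectation_cong_support)
    then show ?case using cong(2) by simp
  next
    case (const c)
    show ?case by simp
  next
    case (add f c B)
    have eq: "(\<lambda>\<omega>. (f \<omega> + c * indicator B \<omega>) * indicator A \<omega>)
      = (\<lambda>\<omega>. f \<omega> * indicator A \<omega> + c * indicator (B \<inter> A) \<omega>)"
      by (auto simp: indicator_def fun_eq_iff)
    show ?case
      unfolding eq lin using add(1) mult_left_mono[OF events[OF add(3) A] add(2)]
      by (simp add: algebra_simps)
  qed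
  show "?E f * ?E g \<le> ?E (\<lambda>\<omega>. f \<omega> * g \<omega>)"
    using E g
  proof (induction rule: mono_on_Pow_induct)
    case (cong g h)
    have "?E g = ?E h" "?E (\<lambda>\<omega>. f \<omega> * g \<omega>) = ?E (\<lambda>\<omega>. f \<omega> * h \<omega>)"
      using \<rho> cong(1) by (auto intro!: expectation_cong_support)
    then show ?case using cong(2) by simp
  next
    case (const c)
    show ?case by simp
  next
    case (add g c B)
    have eq: "(\<lambda>\<omega>. f \<omega> * (g \<omega> + c * indicator B \<omega>))
      = (\<lambda>\<omega>. f \<omega> * g \<omega> + c * (f \<omega> * indicator B \<omega>))"
      by (auto simp: algebra_simps)
    show ?case
      unfolding eq lin using add(1) mult_left_mono[OF ind[OF add(3)] add(2)]
      by (simp add: algebra_simps)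
  qed
qed

text \<open>The increasing events of a one-point set form a chain, so \<open>A \<inter> B\<close> is
  \<open>A\<close> or \<open>B\<close>.\<close>

lemma FKG_singleton:
  assumes "set_pmf \<rho> \<subseteq> Pow {e}" shows "FKG {e} \<rho>"
proof (rule FKG_eventI)
  fix A B assume AB: "increasing_event {e} A" "increasing_event {e} B"
  have top: "X \<subseteq> C" if "increasing_event {e} C" "{} \<in> C" "increasing_event {e} X" for C X
  proof
    fix x assume "x \<in> X"
    then have "x \<in> Pow {e}"
      using that(3) by (auto simp: increasing_event_def)
    then show "x \<in> C"
      using that(1,2) by (simp add: increasing_event_def)
  qed
  have bot: "C = {} \<or> C = {{e}}" if "increasing_event {e} C" "{} \<notin> C" for C
  proof -
    have "C \<subseteq> {{}, {e}}"
      using that(1) unfolding increasing_event_def by (simp add: Pow_insert insert_commute)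
    then show ?thesis
      using that(2) by blast
  qed
  have "A \<subseteq> B \<or> B \<subseteq> A"
    using AB top[of A B] top[of B A] bot[of A] bot[of B] by blast
  then show "measure_pmf.prob \<rho> A * measure_pmf.prob \<rho> B \<le> measure_pmf.prob \<rho> (A \<inter> B)"
    by (auto simp: Int_absorb1 Int_absorb2 mult_left_le mult_left_le_one_le)
qed (use assms in auto)

section \<open>Complementation\<close>

definition compl_pmf :: "'e set \<Rightarrow> 'e set pmf \<Rightarrow> 'e set pmf" where
  "compl_pmf E \<mu> = map_pmf (\<lambda>\<omega>. E - \<omega>) \<mu>"

lemma set_pmf_compl: "set_pmf (compl_pmf E \<mu>) \<subseteq> Pow E"
  by (auto simp: compl_pmf_def)

lemma compl_pmf_compl:
  assumes "set_pmf \<mu> \<subseteq> Pow E" shows "compl_pmf E (compl_pmf E \<mu>) = \<mu>"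
proof -
  have "compl_pmf E (compl_pmf E \<mu>) = map_pmf (\<lambda>\<omega>. \<omega>) \<mu>"
    unfolding compl_pmf_def map_pmf_comp by (rule map_pmf_cong) (use assms in auto)
  then show ?thesis by simp
qed

text \<open>Complementation makes increasing functions decreasing; negating both of them restores
  monotonicity and changes neither side of the inequality.\<close>

lemma FKG_compl:
  assumes "FKG E \<mu>" shows "FKG E (compl_pmf E \<mu>)"
  unfolding FKG_def
proof (intro allI impI)
  fix f g :: "'a set \<Rightarrow> real"
  assume "mono_on (Pow E) f" "mono_on (Pow E) g"
  then have "mono_on (Pow E) (\<lambda>\<omega>. - f (E - \<omega>))" "mono_on (Pow E) (\<lambda>\<omega>. - g (E - \<omega>))"
    by (auto intro!: mono_onI elim!: mono_onD)
  from assms[unfolded FKG_def, rule_format, OF this]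
  show "measure_pmf.expectation (compl_pmf E \<mu>) f * measure_pmf.expectation (compl_pmf E \<mu>) g
      \<le> measure_pmf.expectation (compl_pmf E \<mu>) (\<lambda>\<omega>. f \<omega> * g \<omega>)"
    by (simp add: compl_pmf_def)
qed

lemma stoch_dom_compl:
  assumes \<mu>: "set_pmf \<mu> \<subseteq> Pow E" and \<nu>: "set_pmf \<nu> \<subseteq> Pow E" and dom: "stoch_dom E \<mu> \<nu>"
  shows "stoch_dom E (compl_pmf E \<nu>) (compl_pmf E \<mu>)"
  unfolding stoch_dom_def
proof (intro allI impI)
  fix A assume A: "increasing_event E A"
  let ?B = "{\<omega> \<in> Pow E. E - \<omega> \<notin> A}"
  have "E - \<omega>' \<notin> A" if "E - \<omega> \<notin> A" "\<omega> \<subseteq> \<omega>'" for \<omega> \<omega>'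
  proof
    assume "E - \<omega>' \<in> A"
    moreover have "E - \<omega> \<in> Pow E" "E - \<omega>' \<subseteq> E - \<omega>"
      using that(2) by auto
    ultimately show False
      using A that(1) by (simp add: increasing_event_def)
  qed
  then have "increasing_event E ?B"
    by (auto simp: increasing_event_def)
  then have "measure_pmf.prob \<mu> ?B \<le> measure_pmf.prob \<nu> ?B"
    using dom by (simp add: stoch_dom_def)
  moreover have "measure_pmf.prob (compl_pmf E \<rho>) A = 1 - measure_pmf.prob \<rho> ?B"
    if "set_pmf \<rho> \<subseteq> Pow E" for \<rho>
  proof -
    have "measure_pmf.prob (compl_pmf E \<rho>) A = measure_pmf.prob \<rho> (UNIV - ?B)"
      unfolding compl_pmf_def measure_map_pmf
      by (rule prob_cong_support) (use that in auto)
    then show ?thesis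
      using measure_pmf.prob_compl[of ?B \<rho>] by simp
  qed
  ultimately show "measure_pmf.prob (compl_pmf E \<nu>) A \<le> measure_pmf.prob (compl_pmf E \<mu>) A"
    using \<mu> \<nu> by simp
qed

lemma compl_pmf_Ber:
  assumes E: "finite E" and b: "b \<in> E \<rightarrow> {0..1}"
  shows "compl_pmf E (Ber E b) = Ber E (\<lambda>e. 1 - b e)"
proof (rule pmf_eqI_prob_superset[OF E set_pmf_compl set_pmf_Ber[OF E]])
  fix S assume S: "S \<subseteq> E"
  then have "(\<lambda>\<omega>. E - \<omega>) -` {\<omega>. S \<subseteq> \<omega>} = {\<omega>. S \<inter> \<omega> = {}}"
    by auto
  then show "measure_pmf.prob (compl_pmf E (Ber E b)) {\<omega>. S \<subseteq> \<omega>}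
      = measure_pmf.prob (Ber E (\<lambda>e. 1 - b e)) {\<omega>. S \<subseteq> \<omega>}"
    using b by (subst prob_Ber_superset[OF E S])
      (auto simp: compl_pmf_def prob_Ber_disjoint[OF E S b])
qed

text \<open>De Morgan. Through it every union with a Bernoulli set becomes a thinning of the
  complement, and only thinnings need analysis.\<close>

lemma compl_pmf_union_Ber:
  assumes E: "finite E" and b: "b \<in> E \<rightarrow> {0..1}"
  shows "compl_pmf E (union_pmf \<mu> (Ber E b)) = inter_pmf (compl_pmf E \<mu>) (Ber E (\<lambda>e. 1 - b e))"
  unfolding compl_pmf_Ber[OF E b, symmetric]
  unfolding compl_pmf_def union_pmf_def inter_pmf_def map_pair[symmetric] map_pmf_comp
  by (rule map_pmf_cong) (simp_all add: case_prod_unfold Diff_Un)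

section \<open>Thinning with small retention probability\<close>

lemma pmf_inter_Ber_upper:
  assumes D: "finite D" and \<mu>: "finite (set_pmf \<mu>)" and \<epsilon>: "0 \<le> \<epsilon>" "\<epsilon> \<le> 1" and S: "S \<subseteq> D"
  shows "pmf (inter_pmf \<mu> (Ber D (\<lambda>_. \<epsilon>))) S \<le> \<epsilon> ^ card S * measure_pmf.prob \<mu> {\<omega>. S \<subseteq> \<omega>}"
proof -
  have "pmf (inter_pmf \<mu> (Ber D (\<lambda>_. \<epsilon>))) S
      \<le> measure_pmf.prob (inter_pmf \<mu> (Ber D (\<lambda>_. \<epsilon>))) {\<omega>. S \<subseteq> \<omega>}"
    unfolding measure_pmf_single[symmetric] by (rule measure_pmf.finite_measure_mono) auto
  then show ?thesis
    using \<epsilon> by (simp add: prob_inter_superset[OF D \<mu> _ S] mult.commute)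
qed

text \<open>One way to obtain \<open>S\<close> is that the Bernoulli set equals \<open>S\<close> and
  \<open>S \<subseteq> \<omega>\<close>. Together with the upper bound, the mass of \<open>S\<close>
  is \<open>\<epsilon> ^ card S\<close> times its superset probability up to a factor tending to 1;
  the exponent \<open>card D\<close> makes that factor uniform in \<open>S\<close>.\<close>

lemma pmf_inter_Ber_lower:
  assumes D: "finite D" and \<mu>: "finite (set_pmf \<mu>)" and \<epsilon>: "0 \<le> \<epsilon>" "\<epsilon> \<le> 1" and S: "S \<subseteq> D"
  shows "(1 - \<epsilon>) ^ card D * (\<epsilon> ^ card S * measure_pmf.prob \<mu> {\<omega>. S \<subseteq> \<omega>})
    \<le> pmf (inter_pmf \<mu> (Ber D (\<lambda>_. \<epsilon>))) S"
proof -
  let ?B = "Ber D (\<lambda>_. \<epsilon>)"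
  have "(1 - \<epsilon>) ^ card D \<le> (1 - \<epsilon>) ^ card (D - S)"
    using \<epsilon> D by (intro power_decreasing card_mono) auto
  then have "(1 - \<epsilon>) ^ card D * (\<epsilon> ^ card S * measure_pmf.prob \<mu> {\<omega>. S \<subseteq> \<omega>})
      \<le> (1 - \<epsilon>) ^ card (D - S) * (\<epsilon> ^ card S * measure_pmf.prob \<mu> {\<omega>. S \<subseteq> \<omega>})"
    using \<epsilon> by (intro mult_right_mono) auto
  also have "\<dots> = measure_pmf.prob \<mu> {\<omega>. S \<subseteq> \<omega>} * measure_pmf.prob ?B {\<omega>. \<omega> = S}"
    using \<epsilon> by (simp add: measure_pmf_single pmf_Ber[OF D S])
  also have "\<dots> = measure_pmf.prob (pair_pmf \<mu> ?B) {z. S \<subseteq> fst z \<and> snd z = S}"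
    by (rule prob_pair_pmf_conj[symmetric]) (use \<mu> finite_set_pmf_Ber[OF D] in auto)
  also have "\<dots> \<le> measure_pmf.prob (pair_pmf \<mu> ?B) ((\<lambda>(\<omega>, \<omega>'). \<omega> \<inter> \<omega>') -` {S})"
    by (rule measure_pmf.finite_measure_mono) auto
  also have "\<dots> = pmf (inter_pmf \<mu> ?B) S"
    by (simp add: inter_pmf_def pmf_map)
  finally show ?thesis .
qed

lemma prob_eq_sum_pmf:
  assumes "finite D" "A \<subseteq> Pow D"
  shows "measure_pmf.prob \<rho> A = (\<Sum>S\<in>A. pmf \<rho> S)"
  using assms by (intro measure_measure_pmf_finite) (meson finite_Pow_iff finite_subset)

lemma increasing_event_empty:
  assumes "increasing_event D A" "{} \<in> A"
  shows "A = Pow D"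
  using assms by (auto simp: increasing_event_def)

lemma prob_Pow:
  assumes "set_pmf \<rho> \<subseteq> Pow D"
  shows "measure_pmf.prob \<rho> (Pow D) = 1"
  using assms by (simp add: measure_pmf.prob_eq_1 AE_measure_pmf_iff subset_iff)

text \<open>
  In \<open>P(A) P(B) = \<Sum> P(S) P(T)\<close> call \<open>(S, T)\<close> good if \<open>S\<close> and \<open>T\<close> are disjoint and \<open>S \<union> T\<close> is
  minimal in \<open>A \<inter> B\<close>.  A good pair is determined by \<open>S \<union> T\<close>, while a bad pair is smaller by a
  factor \<open>\<epsilon>\<close> than the weight of some element of \<open>A \<inter> B\<close>.
\<close>
lemma FKG_of_pmf_bounds:
  fixes Z :: "'e set \<Rightarrow> real"
  assumes D: "finite D" and \<rho>: "set_pmf \<rho> \<subseteq> Pow D" and \<epsilon>: "0 < \<epsilon>" "\<epsilon> \<le> 1"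
    and m: "0 < m" "\<And>S. S \<subseteq> D \<Longrightarrow> m \<le> Z S" and Z1: "\<And>S. S \<subseteq> D \<Longrightarrow> Z S \<le> 1"
    and q: "0 \<le> q" "\<And>S T. S \<subseteq> D \<Longrightarrow> T \<subseteq> D \<Longrightarrow> S \<noteq> {} \<Longrightarrow> T \<noteq> {} \<Longrightarrow> S \<inter> T = {} \<Longrightarrow> Z S * Z T \<le> q * Z (S \<union> T)"
    and c: "0 < c" "q + 4 ^ card D * \<epsilon> / m \<le> c"
    and upper: "\<And>S. S \<subseteq> D \<Longrightarrow> pmf \<rho> S \<le> \<epsilon> ^ card S * Z S"
    and lower: "\<And>S. S \<subseteq> D \<Longrightarrow> c * (\<epsilon> ^ card S * Z S) \<le> pmf \<rho> S"
  shows "FKG D \<rho>"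
proof (rule FKG_eventI[OF D \<rho>])
  fix A B assume A: "increasing_event D A" and B: "increasing_event D B"
  note sum = prob_eq_sum_pmf[OF D]
  have subs: "A \<subseteq> Pow D" "B \<subseteq> Pow D"
    using A B by (auto simp: increasing_event_def)
  have up: "S \<in> A \<Longrightarrow> S \<subseteq> S' \<Longrightarrow> S' \<subseteq> D \<Longrightarrow> S' \<in> A" "S \<in> B \<Longrightarrow> S \<subseteq> S' \<Longrightarrow> S' \<subseteq> D \<Longrightarrow> S' \<in> B" for S S'
    using A B by (auto simp: increasing_event_def)
  have fin: "finite A" "finite B" "finite S" if "S \<subseteq> D" for S
    using subs D that finite_subset[of _ "Pow D"] finite_subset[of S D] by auto
  consider "{} \<in> A" | "{} \<in> B" | "{} \<notin> A" "{} \<notin> B" by blast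
  then show "measure_pmf.prob \<rho> A * measure_pmf.prob \<rho> B \<le> measure_pmf.prob \<rho> (A \<inter> B)"
  proof cases
    case 1
    then show ?thesis
      using increasing_event_empty[OF A] subs prob_Pow[OF \<rho>] by (simp add: Int_absorb1)
  next
    case 2
    then show ?thesis
      using increasing_event_empty[OF B] subs prob_Pow[OF \<rho>] by (simp add: Int_absorb2)
  next
    case 3
    define good where "good = {(S, T) \<in> A \<times> B. S \<inter> T = {} \<and> (\<forall>U\<in>A \<inter> B. U \<subseteq> S \<union> T \<longrightarrow> U = S \<union> T)}"
    let ?p = "\<lambda>(S, T). pmf \<rho> S * pmf \<rho> T" and ?P = "measure_pmf.prob \<rho> (A \<inter> B)"
    have good_sub: "good \<subseteq> A \<times> B" by (auto simp: good_def)
    have Un: "S \<union> T \<in> A \<inter> B" if "S \<in> A" "T \<in> B" for S T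
    proof -
      have "S \<union> T \<subseteq> D" using that subs by auto
      then show ?thesis
        using up(1)[OF that(1), of "S \<union> T"] up(2)[OF that(2), of "S \<union> T"] by auto
    qed
    \<comment> \<open>\<open>S' \<union> T\<close> lies in \<open>A \<inter> B\<close> and below
      \<open>S \<union> T\<close>, so minimality makes the two equal; disjointness of
      \<open>S\<close> and \<open>T\<close> then forces \<open>S \<subseteq> S'\<close>.\<close>
    have subset: "S \<subseteq> S'" if "(S, T) \<in> good" "(S', T') \<in> good" "S \<union> T = S' \<union> T'" for S T S' T'
    proof -
      have "S' \<union> T \<in> A \<inter> B" "S' \<union> T \<subseteq> S \<union> T"
        using that Un by (auto simp: good_def)
      then have "S' \<union> T = S \<union> T"
        using that(1) by (auto simp: good_def)
      then show ?thesis
        using that(1) by (auto simp: good_def)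
    qed
    have inj: "inj_on (\<lambda>(S, T). S \<union> T) good"
    proof (rule inj_onI, clarify)
      fix S T S' T' assume st: "(S, T) \<in> good" "(S', T') \<in> good" "S \<union> T = S' \<union> T'"
      then have "S = S'"
        using subset[OF st] subset[OF st(2,1)] by simp
      then show "S = S' \<and> T = T'"
        using st by (auto simp: good_def)
    qed
    have "sum ?p good \<le> (\<Sum>(S, T)\<in>good. q / c * pmf \<rho> (S \<union> T))"
    proof (rule sum_mono, clarify)
      fix S T assume st: "(S, T) \<in> good"
      then have *: "S \<subseteq> D" "T \<subseteq> D" "S \<noteq> {}" "T \<noteq> {}" "S \<inter> T = {}"
        using 3 subs by (auto simp: good_def)
      have nn: "0 \<le> Z S" "0 \<le> Z T"
        using m(1) m(2)[OF *(1)] m(2)[OF *(2)] by auto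
      have "pmf \<rho> S * pmf \<rho> T \<le> (\<epsilon> ^ card S * Z S) * (\<epsilon> ^ card T * Z T)"
        using * \<epsilon> nn by (intro mult_mono upper) auto
      also have "\<dots> = \<epsilon> ^ card (S \<union> T) * (Z S * Z T)"
        using * fin(3) by (simp add: card_Un_disjoint power_add)
      also have "\<dots> \<le> \<epsilon> ^ card (S \<union> T) * (q * Z (S \<union> T))"
        using * \<epsilon> by (intro mult_left_mono q(2)) auto
      also have "\<dots> = q / c * (c * (\<epsilon> ^ card (S \<union> T) * Z (S \<union> T)))"
        using c by simp
      also have "\<dots> \<le> q / c * pmf \<rho> (S \<union> T)"
        using * q c by (intro mult_left_mono lower) auto
      finally show "pmf \<rho> S * pmf \<rho> T \<le> q / c * pmf \<rho> (S \<union> T)" .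
    qed
    also have "\<dots> = q / c * (\<Sum>U\<in>(\<lambda>(S, T). S \<union> T) ` good. pmf \<rho> U)"
      by (subst sum.reindex[OF inj]) (simp add: sum_distrib_left case_prod_unfold)
    also have "(\<Sum>U\<in>(\<lambda>(S, T). S \<union> T) ` good. pmf \<rho> U) \<le> (\<Sum>U\<in>A \<inter> B. pmf \<rho> U)"
    proof (rule sum_mono2)
      show "(\<lambda>(S, T). S \<union> T) ` good \<subseteq> A \<inter> B"
        using Un good_sub by auto
    qed (use fin in auto)
    also have "(\<Sum>U\<in>A \<inter> B. pmf \<rho> U) = ?P"
      using subs by (intro sum[symmetric]) auto
    finally have good_le: "sum ?p good \<le> q / c * ?P"
      using divide_nonneg_pos[OF q(1) c(1)] by (simp only: mult_left_mono)
    have "sum ?p (A \<times> B - good) \<le> (\<Sum>_\<in>A \<times> B - good. \<epsilon> / (m * c) * ?P)"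
    proof (rule sum_mono, clarify)
      fix S T assume st: "S \<in> A" "T \<in> B" "(S, T) \<notin> good"
      then have SD: "S \<subseteq> D" "T \<subseteq> D" using subs by auto
      \<comment> \<open>A bad pair fails minimality, and a smaller set serves as \<open>U\<close>,
        or it fails disjointness, and \<open>S \<union> T\<close> itself has fewer than
        \<open>card S + card T\<close> elements. The strict inequality yields the extra factor
        \<epsilon>.\<close>
      obtain U where U: "U \<in> A \<inter> B" "card U < card S + card T"
      proof (cases "S \<inter> T = {}")
        case True
        then obtain U where "U \<in> A \<inter> B" "U \<subset> S \<union> T"
          using st by (auto simp: good_def)
        then show ?thesis
          using that[of U] SD fin(3) psubset_card_mono[of "S \<union> T" U] True
          by (auto simp: card_Un_disjoint)
      next
        case False
        then have "card (S \<inter> T) > 0"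
          using SD fin(3) by (simp add: card_gt_0_iff)
        then have "card (S \<union> T) < card S + card T"
          using card_Un_Int[of S T] SD fin(3) by simp
        then show ?thesis
          using that Un st by blast
      qed
      then have UD: "U \<subseteq> D" using subs by auto
      have "pmf \<rho> S * pmf \<rho> T \<le> \<epsilon> ^ card S * \<epsilon> ^ card T"
        using upper[OF SD(1)] upper[OF SD(2)] Z1[OF SD(1)] Z1[OF SD(2)] \<epsilon>
        by (intro mult_mono) (auto intro: order_trans mult_left_le)
      also have "\<dots> = \<epsilon> ^ (card S + card T)"
        by (simp add: power_add)
      also have "\<dots> \<le> \<epsilon> ^ Suc (card U)"
        using \<epsilon> U by (intro power_decreasing) auto
      also have "\<dots> = \<epsilon> / (m * c) * (c * (\<epsilon> ^ card U * m))"
        using m c by simp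
      also have "\<dots> \<le> \<epsilon> / (m * c) * (c * (\<epsilon> ^ card U * Z U))"
        using m c \<epsilon> m(2)[OF UD] by (intro mult_left_mono) auto
      also have "\<dots> \<le> \<epsilon> / (m * c) * pmf \<rho> U"
        using m c \<epsilon> by (intro mult_left_mono lower UD) auto
      also have "pmf \<rho> U \<le> ?P"
        unfolding measure_pmf_single[symmetric]
        using U by (intro measure_pmf.finite_measure_mono) auto
      finally show "pmf \<rho> S * pmf \<rho> T \<le> \<epsilon> / (m * c) * ?P"
        using divide_nonneg_pos[OF less_imp_le[OF \<epsilon>(1)] mult_pos_pos[OF m(1) c(1)]]
        by (simp only: mult_left_mono)
    qed
    also have "\<dots> = real (card (A \<times> B - good)) * (\<epsilon> / (m * c) * ?P)"
      by simp
    also have "\<dots> \<le> 4 ^ card D * (\<epsilon> / (m * c) * ?P)"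
    proof (rule mult_right_mono)
      have "card (A \<times> B - good) \<le> card (Pow D \<times> Pow D)"
        using D subs by (intro card_mono) auto
      also have "\<dots> = 4 ^ card D"
        by (simp add: card_cartesian_product card_Pow D flip: power_mult_distrib)
      finally show "real (card (A \<times> B - good)) \<le> 4 ^ card D"
        by (metis of_nat_le_iff of_nat_numeral of_nat_power)
    qed (use m c \<epsilon> in auto)
    finally have bad_le: "sum ?p (A \<times> B - good) \<le> 4 ^ card D * (\<epsilon> / (m * c) * ?P)" .
    have "measure_pmf.prob \<rho> A * measure_pmf.prob \<rho> B = sum ?p (A \<times> B)"
      using subs by (simp add: sum sum_product sum.cartesian_product)
    also have "\<dots> = sum ?p good + sum ?p (A \<times> B - good)"
      using sum.subset_diff[OF good_sub, of ?p] fin(1,2)[of "{}"] by simp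
    also have "\<dots> \<le> q / c * ?P + 4 ^ card D * (\<epsilon> / (m * c) * ?P)"
      using good_le bad_le by simp
    also have "\<dots> = (q + 4 ^ card D * \<epsilon> / m) / c * ?P"
      using m c by (simp add: field_simps)
    also have "\<dots> \<le> ?P"
      using c q(1) \<epsilon>(1) m(1) by (intro mult_left_le_one_le) simp_all
    finally show ?thesis .
  qed
qed

text \<open>Finiteness turns the strict inequalities into a uniform gap \<open>q < 1\<close>, the
  room into which the errors of order \<epsilon> have to fit.\<close>

lemma ex_strict_factor:
  fixes f g :: "'a \<Rightarrow> real"
  assumes "finite I" "\<And>i. i \<in> I \<Longrightarrow> 0 \<le> f i \<and> f i < g i"
  shows "\<exists>q. 0 \<le> q \<and> q < 1 \<and> (\<forall>i\<in>I. f i \<le> q * g i)"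
  using assms
proof (induction I rule: finite_induct)
  case empty
  show ?case by (intro exI[of _ 0]) auto
next
  case (insert i I)
  then obtain q where q: "0 \<le> q" "q < 1" "\<forall>i\<in>I. f i \<le> q * g i" by auto
  have g: "0 < g j" if "j \<in> insert i I" for j
    using insert.prems[OF that] by linarith
  let ?q = "max q (f i / g i)"
  have "f j \<le> ?q * g j" if "j \<in> insert i I" for j
  proof (cases "j = i")
    case True
    have "f i / g i * g i \<le> ?q * g i"
      using g[of i] by (intro mult_right_mono) auto
    then show ?thesis
      using True g[of i] by simp
  next
    case False
    then have "f j \<le> q * g j" using q(3) that by auto
    also have "\<dots> \<le> ?q * g j" using g[OF that] by (intro mult_right_mono) auto
    finally show ?thesis .
  qed
  then show ?case
    using q insert.prems[of i] g[of i] by (intro exI[of _ ?q]) auto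
qed

lemma ex_small_parameter:
  fixes F :: "real \<Rightarrow> real"
  assumes "isCont F 0" "0 < F 0"
  shows "\<exists>\<epsilon>. 0 < \<epsilon> \<and> \<epsilon> < 1 \<and> 0 < F \<epsilon>"
proof -
  have "(F \<longlongrightarrow> F 0) (at_right 0)"
    using assms(1) by (simp add: isCont_def filterlim_at_split)
  then have "\<forall>\<^sub>F \<epsilon> in at_right 0. 0 < F \<epsilon>"
    using assms(2) by (rule order_tendstoD)
  moreover have "\<forall>\<^sub>F \<epsilon> in at_right 0. \<epsilon> \<in> {0<..<1::real}"
    by (rule eventually_at_right_real) simp
  ultimately have "\<forall>\<^sub>F \<epsilon> in at_right 0. 0 < \<epsilon> \<and> \<epsilon> < 1 \<and> 0 < F \<epsilon>"
    by eventually_elim auto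
  then show ?thesis
    using eventually_happens'[OF trivial_limit_at_right_real] by blast
qed

lemma FKG_small_thinning:
  assumes D: "finite D" and \<mu>: "finite (set_pmf \<mu>)"
    and pos: "\<And>S. S \<subseteq> D \<Longrightarrow> 0 < measure_pmf.prob \<mu> {\<omega>. S \<subseteq> \<omega>}"
    and strict: "\<And>S T. S \<subseteq> D \<Longrightarrow> T \<subseteq> D \<Longrightarrow> S \<noteq> {} \<Longrightarrow> T \<noteq> {} \<Longrightarrow> S \<inter> T = {} \<Longrightarrow>
      measure_pmf.prob \<mu> {\<omega>. S \<subseteq> \<omega>} * measure_pmf.prob \<mu> {\<omega>. T \<subseteq> \<omega>} < measure_pmf.prob \<mu> {\<omega>. S \<union> T \<subseteq> \<omega>}"
  shows "\<exists>\<epsilon>. 0 < \<epsilon> \<and> \<epsilon> \<le> 1 \<and> FKG D (inter_pmf \<mu> (Ber D (\<lambda>_. \<epsilon>)))"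
proof -
  define Z where "Z S = measure_pmf.prob \<mu> {\<omega>. S \<subseteq> \<omega>}" for S
  define m where "m = Min (Z ` Pow D)"
  have m: "0 < m" "\<And>S. S \<subseteq> D \<Longrightarrow> m \<le> Z S"
  proof -
    have "m \<in> Z ` Pow D"
      unfolding m_def using D by (intro Min_in) auto
    then show "0 < m" using pos by (auto simp: Z_def)
  qed (use D in \<open>auto simp: m_def\<close>)
  let ?I = "{(S, T) \<in> Pow D \<times> Pow D. S \<noteq> {} \<and> T \<noteq> {} \<and> S \<inter> T = {}}"
  have "finite ?I"
    by (rule finite_subset[of _ "Pow D \<times> Pow D"]) (use D in auto)
  then obtain q where q: "0 \<le> q" "q < 1" "\<forall>i\<in>?I. (case i of (S, T) \<Rightarrow> Z S * Z T) \<le> q * (case i of (S, T) \<Rightarrow> Z (S \<union> T))"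
    using ex_strict_factor[of ?I "\<lambda>(S, T). Z S * Z T" "\<lambda>(S, T). Z (S \<union> T)"] strict
    by (auto simp: Z_def)
  \<comment> \<open>At \<epsilon> = 0 the expression equals \<open>1 - q\<close>, so it stays
    positive for small \<epsilon> by continuity.\<close>
  obtain \<epsilon> :: real where \<epsilon>: "0 < \<epsilon>" "\<epsilon> < 1" "0 < (1 - \<epsilon>) ^ card D - (q + 4 ^ card D * \<epsilon> / m)"
    using ex_small_parameter[of "\<lambda>\<epsilon>. (1 - \<epsilon>) ^ card D - (q + 4 ^ card D * \<epsilon> / m)"] q m(1)
    by (auto intro!: continuous_intros)
  have "FKG D (inter_pmf \<mu> (Ber D (\<lambda>_. \<epsilon>)))"
  proof (rule FKG_of_pmf_bounds[where Z = Z and m = m and q = q and \<epsilon> = \<epsilon> and c = "(1 - \<epsilon>) ^ card D"])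
    show "Z S * Z T \<le> q * Z (S \<union> T)"
      if "S \<subseteq> D" "T \<subseteq> D" "S \<noteq> {}" "T \<noteq> {}" "S \<inter> T = {}" for S T
      using bspec[OF q(3), of "(S, T)"] that by simp
  qed (use D \<mu> m q \<epsilon> in \<open>auto simp: Z_def set_pmf_inter intro!: pmf_inter_Ber_upper pmf_inter_Ber_lower\<close>)
  then show ?thesis
    using \<epsilon> by (intro exI[of _ \<epsilon>]) simp
qed

text \<open>For small \<epsilon> the masses of all nonempty sets are already ordered one by one, and
  an increasing event that contains the empty set is the whole space.\<close>

lemma stoch_dom_small_thinning:
  assumes D: "finite D" and \<mu>: "finite (set_pmf \<mu>)" and \<nu>: "finite (set_pmf \<nu>)"
    and strict: "\<And>S. S \<subseteq> D \<Longrightarrow> S \<noteq> {} \<Longrightarrow>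
      measure_pmf.prob \<mu> {\<omega>. S \<subseteq> \<omega>} < measure_pmf.prob \<nu> {\<omega>. S \<subseteq> \<omega>}"
  shows "\<exists>\<epsilon>. 0 < \<epsilon> \<and> \<epsilon> \<le> 1 \<and> stoch_dom D (inter_pmf \<mu> (Ber D (\<lambda>_. \<epsilon>))) (inter_pmf \<nu> (Ber D (\<lambda>_. \<epsilon>)))"
proof -
  let ?Z = "\<lambda>\<mu> S. measure_pmf.prob \<mu> {\<omega>. S \<subseteq> \<omega>}"
  obtain q where q: "0 \<le> q" "q < 1" "\<forall>S\<in>Pow D - {{}}. ?Z \<mu> S \<le> q * ?Z \<nu> S"
    using ex_strict_factor[of "Pow D - {{}}" "?Z \<mu>" "?Z \<nu>"] strict D by auto
  obtain \<epsilon> :: real where \<epsilon>: "0 < \<epsilon>" "\<epsilon> < 1" "0 < (1 - \<epsilon>) ^ card D - q"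
    using ex_small_parameter[of "\<lambda>\<epsilon>. (1 - \<epsilon>) ^ card D - q"] q
    by (auto intro!: continuous_intros)
  let ?\<mu> = "inter_pmf \<mu> (Ber D (\<lambda>_. \<epsilon>))" and ?\<nu> = "inter_pmf \<nu> (Ber D (\<lambda>_. \<epsilon>))"
  have "stoch_dom D ?\<mu> ?\<nu>"
    unfolding stoch_dom_def
  proof (intro allI impI)
    fix A assume A: "increasing_event D A"
    then have sub: "A \<subseteq> Pow D" by (simp add: increasing_event_def)
    show "measure_pmf.prob ?\<mu> A \<le> measure_pmf.prob ?\<nu> A"
    proof (cases "{} \<in> A")
      case True
      then show ?thesis
        using increasing_event_empty[OF A True] by (simp add: prob_Pow set_pmf_inter D)
    next
      case False
      show ?thesis
        unfolding prob_eq_sum_pmf[OF D sub]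
      proof (rule sum_mono)
        fix S assume "S \<in> A"
        then have S: "S \<subseteq> D" "S \<noteq> {}" using sub False by auto
        have "pmf ?\<mu> S \<le> \<epsilon> ^ card S * ?Z \<mu> S"
          using \<epsilon> S by (intro pmf_inter_Ber_upper D \<mu>) auto
        also have "\<dots> \<le> \<epsilon> ^ card S * (q * ?Z \<nu> S)"
          using \<epsilon> q(3) S by (intro mult_left_mono) auto
        also have "\<dots> = q * (\<epsilon> ^ card S * ?Z \<nu> S)"
          by simp
        also have "\<dots> \<le> (1 - \<epsilon>) ^ card D * (\<epsilon> ^ card S * ?Z \<nu> S)"
          using \<epsilon> by (intro mult_right_mono) auto
        also have "\<dots> \<le> pmf ?\<nu> S"
          using \<epsilon> S by (intro pmf_inter_Ber_lower D \<nu>) auto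
        finally show "pmf ?\<mu> S \<le> pmf ?\<nu> S" .
      qed
    qed
  qed
  then show ?thesis
    using \<epsilon> by (intro exI[of _ \<epsilon>]) simp
qed

section \<open>Independent classes\<close>

text \<open>Superset events suffice, since they determine the joint law of the traces of the random
  set on \<open>C\<close> and \<open>D\<close>.\<close>

definition independent_of :: "'e set pmf \<Rightarrow> 'e set \<Rightarrow> 'e set \<Rightarrow> bool" where
  "independent_of \<mu> C D \<longleftrightarrow> (\<forall>S T. S \<subseteq> C \<longrightarrow> T \<subseteq> D \<longrightarrow> measure_pmf.prob \<mu> {\<omega>. S \<union> T \<subseteq> \<omega>}
     = measure_pmf.prob \<mu> {\<omega>. S \<subseteq> \<omega>} * measure_pmf.prob \<mu> {\<omega>. T \<subseteq> \<omega>})"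

lemma independent_of_mono:
  "independent_of \<mu> C D \<Longrightarrow> D' \<subseteq> D \<Longrightarrow> independent_of \<mu> C D'"
  unfolding independent_of_def by blast

lemma inter_pmf_Ber_partition:
  assumes C: "finite C" "finite D" "C \<inter> D = {}" and a: "a \<in> C \<rightarrow> {0<..1}" and b: "b \<in> D \<rightarrow> {0<..1}"
    and \<mu>: "finite (set_pmf \<mu>)" "independent_of \<mu> C D"
  shows "inter_pmf \<mu> (Ber (C \<union> D) (\<lambda>e. if e \<in> C then a e else b e))
    = union_pmf (inter_pmf \<mu> (Ber C a)) (inter_pmf \<mu> (Ber D b))"
proof -
  let ?c = "\<lambda>e. if e \<in> C then a e else b e"
  have "inter_pmf \<mu> (Ber (C \<union> D) ?c) = union_pmf (inter_pmf \<mu> (Ber C ?c)) (inter_pmf \<mu> (Ber D ?c))"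
  proof (rule inter_pmf_Ber_Un)
    show "?c \<in> C \<union> D \<rightarrow> {0..1}"
      using a b by (auto simp: Pi_iff less_imp_le)
  qed (use C \<mu> in \<open>simp_all only: independent_of_def\<close>)
  also have "Ber C ?c = Ber C a"
    by (rule Ber_cong) simp
  also have "Ber D ?c = Ber D b"
    by (rule Ber_cong) (use C in auto)
  finally show ?thesis .
qed

text \<open>Each class brings its own density. Independence makes the thinned set a union of
  independent thinned classes, and association survives independent unions.\<close>

lemma FKG_thinning_classes:
  assumes P: "finite P" "\<And>C. C \<in> P \<Longrightarrow> finite C" "disjoint P" and \<mu>: "finite (set_pmf \<mu>)"
    and indep: "\<And>C. C \<in> P \<Longrightarrow> independent_of \<mu> C (\<Union>P - C)"
    and FKG: "\<And>C. C \<in> P \<Longrightarrow> \<exists>a\<in>C \<rightarrow> {0<..1}. FKG C (inter_pmf \<mu> (Ber C a))"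
  shows "\<exists>a\<in>\<Union>P \<rightarrow> {0<..1}. FKG (\<Union>P) (inter_pmf \<mu> (Ber (\<Union>P) a))"
proof -
  have "\<exists>a\<in>\<Union>Q \<rightarrow> {0<..1}. FKG (\<Union>Q) (inter_pmf \<mu> (Ber (\<Union>Q) a))" if "Q \<subseteq> P" for Q
    using finite_subset[OF that P(1)] that
  proof (induction Q rule: finite_induct)
    case empty
    have "FKG {} (inter_pmf \<mu> (Ber {} a))" for a
    proof (rule FKG_eventI)
      show "set_pmf (inter_pmf \<mu> (Ber {} a)) \<subseteq> Pow {}"
        by (rule set_pmf_inter) simp
      fix A B :: "'a set set"
      assume "increasing_event {} A" "increasing_event {} B"
      then have "A = {} \<or> A = {{}}" "B = {} \<or> B = {{}}"
        unfolding increasing_event_def by (simp_all add: subset_singleton_iff)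
      then show "measure_pmf.prob (inter_pmf \<mu> (Ber {} a)) A * measure_pmf.prob (inter_pmf \<mu> (Ber {} a)) B
          \<le> measure_pmf.prob (inter_pmf \<mu> (Ber {} a)) (A \<inter> B)"
        by (auto simp: mult_left_le)
    qed simp
    then show ?case
      by simp
  next
    case (insert C Q)
    let ?D = "\<Union>Q"
    have disj: "C \<inter> ?D = {}"
    proof -
      have "C \<inter> X = {}" if "X \<in> Q" for X
        using P(3) insert.hyps insert.prems that unfolding pairwise_def disjnt_def
        by (metis insert_subset subsetD)
      then show ?thesis by blast
    qed
    have fin: "finite C" "finite ?D"
      using insert.prems insert.hyps(1) P(2) by (auto intro!: finite_Union)
    from insert obtain b where b: "b \<in> ?D \<rightarrow> {0<..1}" "FKG ?D (inter_pmf \<mu> (Ber ?D b))" by auto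
    from insert FKG obtain a where a: "a \<in> C \<rightarrow> {0<..1}" "FKG C (inter_pmf \<mu> (Ber C a))" by blast
    let ?c = "\<lambda>e. if e \<in> C then a e else b e"
    have "?D \<subseteq> \<Union>P - C"
      using insert.prems disj by auto
    then have "independent_of \<mu> C ?D"
      using indep[of C] insert.prems by (blast intro: independent_of_mono)
    then have eq: "inter_pmf \<mu> (Ber (C \<union> ?D) ?c)
        = union_pmf (inter_pmf \<mu> (Ber C a)) (inter_pmf \<mu> (Ber ?D b))"
      by (intro inter_pmf_Ber_partition fin disj a b \<mu>)
    have "set_pmf (inter_pmf \<mu> (Ber C a)) \<subseteq> Pow (C \<union> ?D)"
      "set_pmf (inter_pmf \<mu> (Ber ?D b)) \<subseteq> Pow (C \<union> ?D)"
      using set_pmf_inter[OF fin(1), of \<mu> a] set_pmf_inter[OF fin(2), of \<mu> b] by blast+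
    then have "FKG (C \<union> ?D) (inter_pmf \<mu> (Ber (C \<union> ?D) ?c))"
      unfolding eq using fin FKG_subset[OF a(2), of "C \<union> ?D"] FKG_subset[OF b(2), of "C \<union> ?D"]
      by (intro FKG_union) auto
    moreover have "?c \<in> C \<union> ?D \<rightarrow> {0<..1}"
      using a(1) b(1) by (auto simp: Pi_iff)
    ultimately show ?case
      by (simp only: Union_insert) blast
  qed
  then show ?thesis by blast
qed

lemma stoch_dom_thinning_classes:
  assumes P: "finite P" "\<And>C. C \<in> P \<Longrightarrow> finite C" "disjoint P"
    and \<mu>: "finite (set_pmf \<mu>)" and \<nu>: "finite (set_pmf \<nu>)"
    and indep: "\<And>C. C \<in> P \<Longrightarrow> independent_of \<mu> C (\<Union>P - C)" "\<And>C. C \<in> P \<Longrightarrow> independent_of \<nu> C (\<Union>P - C)"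
    and dom: "\<And>C. C \<in> P \<Longrightarrow> \<exists>a\<in>C \<rightarrow> {0<..1}. stoch_dom C (inter_pmf \<mu> (Ber C a)) (inter_pmf \<nu> (Ber C a))"
  shows "\<exists>a\<in>\<Union>P \<rightarrow> {0<..1}. stoch_dom (\<Union>P) (inter_pmf \<mu> (Ber (\<Union>P) a)) (inter_pmf \<nu> (Ber (\<Union>P) a))"
proof -
  have "\<exists>a\<in>\<Union>Q \<rightarrow> {0<..1}. stoch_dom (\<Union>Q) (inter_pmf \<mu> (Ber (\<Union>Q) a)) (inter_pmf \<nu> (Ber (\<Union>Q) a))"
    if "Q \<subseteq> P" for Q
    using finite_subset[OF that P(1)] that
  proof (induction Q rule: finite_induct)
    case empty
    have "set_pmf (inter_pmf \<rho> (Ber {} a)) \<subseteq> {{}}" for \<rho> and a :: "'a \<Rightarrow> real"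
      using set_pmf_inter[of "{}" \<rho> a] by simp
    then have "inter_pmf \<mu> (Ber {} a) = inter_pmf \<nu> (Ber {} a)" for a
      by (metis set_pmf_subset_singleton)
    then show ?case
      by (simp add: stoch_dom_refl)
  next
    case (insert C Q)
    let ?D = "\<Union>Q"
    have disj: "C \<inter> ?D = {}"
    proof -
      have "C \<inter> X = {}" if "X \<in> Q" for X
        using P(3) insert.hyps insert.prems that unfolding pairwise_def disjnt_def
        by (metis insert_subset subsetD)
      then show ?thesis by blast
    qed
    have fin: "finite C" "finite ?D"
      using insert.prems insert.hyps(1) P(2) by (auto intro!: finite_Union)
    from insert obtain b where b: "b \<in> ?D \<rightarrow> {0<..1}"
      "stoch_dom ?D (inter_pmf \<mu> (Ber ?D b)) (inter_pmf \<nu> (Ber ?D b))" by auto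
    from insert dom obtain a where a: "a \<in> C \<rightarrow> {0<..1}"
      "stoch_dom C (inter_pmf \<mu> (Ber C a)) (inter_pmf \<nu> (Ber C a))" by blast
    let ?c = "\<lambda>e. if e \<in> C then a e else b e"
    have "?D \<subseteq> \<Union>P - C"
      using insert.prems disj by auto
    then have "independent_of \<mu> C ?D" "independent_of \<nu> C ?D"
      using indep[of C] insert.prems by (blast intro: independent_of_mono)+
    then have eq: "inter_pmf \<rho> (Ber (C \<union> ?D) ?c)
        = union_pmf (inter_pmf \<rho> (Ber C a)) (inter_pmf \<rho> (Ber ?D b))" if "\<rho> \<in> {\<mu>, \<nu>}" for \<rho>
      using that by (intro inter_pmf_Ber_partition fin disj a b) (auto simp: \<mu> \<nu>)
    have supp: "set_pmf (inter_pmf \<rho> (Ber C a)) \<subseteq> Pow (C \<union> ?D)"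
      "set_pmf (inter_pmf \<rho> (Ber ?D b)) \<subseteq> Pow (C \<union> ?D)" for \<rho>
      using set_pmf_inter[OF fin(1), of \<rho> a] set_pmf_inter[OF fin(2), of \<rho> b] by blast+
    have "stoch_dom (C \<union> ?D) (inter_pmf \<mu> (Ber (C \<union> ?D) ?c)) (inter_pmf \<nu> (Ber (C \<union> ?D) ?c))"
      using fin by (simp only: eq insert_iff simp_thms)
       (intro stoch_dom_union supp stoch_dom_subset[OF a(2)] stoch_dom_subset[OF b(2)] set_pmf_inter, auto)
    moreover have "?c \<in> C \<union> ?D \<rightarrow> {0<..1}"
      using a(1) b(1) by (auto simp: Pi_iff)
    ultimately show ?case
      by (simp only: Union_insert) blast
  qed
  then show ?thesis by blast
qed

section \<open>Circuits of a binary matroid\<close>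

text \<open>In the application \<open>\<S>\<close> consists of the cuts of the graph, and its
  circuits are the minimal cuts.\<close>

definition circuit :: "'e set set \<Rightarrow> 'e set \<Rightarrow> bool" where
  "circuit \<S> C \<longleftrightarrow> C \<in> \<S> \<and> C \<noteq> {} \<and> (\<forall>D\<in>\<S>. D \<subseteq> C \<longrightarrow> D = {} \<or> D = C)"

definition symdiff_closed :: "'e set set \<Rightarrow> bool" where
  "symdiff_closed \<S> \<longleftrightarrow> (\<forall>A\<in>\<S>. \<forall>B\<in>\<S>. (A - B) \<union> (B - A) \<in> \<S>)"

lemma symdiff_closedD: "symdiff_closed \<S> \<Longrightarrow> A \<in> \<S> \<Longrightarrow> B \<in> \<S> \<Longrightarrow> (A - B) \<union> (B - A) \<in> \<S>"
  by (simp add: symdiff_closed_def)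

lemma symdiff_closed_Diff:
  assumes "symdiff_closed \<S>" "A \<in> \<S>" "B \<in> \<S>" "B \<subseteq> A"
  shows "A - B \<in> \<S>"
  using symdiff_closedD[OF assms(1-3)] assms(4) by (simp add: Diff_eq_empty_iff[THEN iffD2])

text \<open>If \<open>F\<close> is not minimal, it splits into two smaller members \<open>D\<close>
  and \<open>F - D\<close>, and one of them contains \<open>e\<close>.\<close>

lemma circuit_exists:
  assumes \<S>: "symdiff_closed \<S>" and F: "finite F" "F \<in> \<S>" "e \<in> F"
  shows "\<exists>C. circuit \<S> C \<and> e \<in> C \<and> C \<subseteq> F"
  using F
proof (induction "card F" arbitrary: F rule: less_induct)
  case less
  show ?case
  proof (cases "circuit \<S> F")
    case True
    then show ?thesis using less.prems by blast
  next
    case False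
    then obtain D where D: "D \<in> \<S>" "D \<subset> F" "D \<noteq> {}"
      using less.prems by (auto simp: circuit_def)
    then have D': "F - D \<in> \<S>" "F - D \<subset> F"
      using symdiff_closed_Diff[OF \<S> less.prems(2), of D] by auto
    obtain D0 where D0: "D0 \<in> \<S>" "D0 \<subset> F" "e \<in> D0"
      using D D' less.prems(3) by blast
    then have "card D0 < card F" "finite D0"
      using less.prems by (auto intro: psubset_card_mono finite_subset)
    then show ?thesis
      using less.hyps[of D0] D0 by blast
  qed
qed

text \<open>Induction on the size of \<open>C1 \<union> C2\<close>. The symmetric difference
  contains a circuit \<open>C3\<close> through \<open>e\<close>, and minimality of \<open>C1\<close>
  forces it to meet \<open>C2\<close>. If \<open>C3\<close> does not shrink the union, it contains
  \<open>C1 - C2\<close>; it must then contain \<open>g\<close>, as otherwise the rest of the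
  symmetric difference would be a proper nonempty member inside \<open>C2\<close>.\<close>

lemma circuit_trans:
  assumes \<S>: "symdiff_closed \<S>" and fin: "\<And>A. A \<in> \<S> \<Longrightarrow> finite A"
    and "circuit \<S> C1" "e \<in> C1" "circuit \<S> C2" "g \<in> C2" "C1 \<inter> C2 \<noteq> {}"
  shows "\<exists>C. circuit \<S> C \<and> e \<in> C \<and> g \<in> C"
  using assms(3-)
proof (induction "card (C1 \<union> C2)" arbitrary: C1 rule: less_induct)
  case less
  show ?case
  proof (cases "g \<in> C1 \<or> e \<in> C2")
    case True
    then show ?thesis using less.prems by blast
  next
    case False
    let ?D = "(C1 - C2) \<union> (C2 - C1)"
    have C12: "C1 \<in> \<S>" "C2 \<in> \<S>"
      using less.prems by (auto simp: circuit_def)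
    then have D: "?D \<in> \<S>"
      by (rule symdiff_closedD[OF \<S>])
    obtain C3 where C3: "circuit \<S> C3" "e \<in> C3" "C3 \<subseteq> ?D"
      using circuit_exists[OF \<S> fin[OF D] D, of e] less.prems False by blast
    have C3_in: "C3 \<in> \<S>"
      using C3 by (simp add: circuit_def)
    have meet: "C3 \<inter> C2 \<noteq> {}"
    proof
      assume "C3 \<inter> C2 = {}"
      then have "C3 \<subseteq> C1" "C3 \<noteq> C1"
        using C3(3) less.prems(5) by blast+
      then show False
        using less.prems(1) C3 by (auto simp: circuit_def)
    qed
    have sub: "C3 \<union> C2 \<subseteq> C1 \<union> C2"
      using C3(3) by blast
    show ?thesis
    proof (cases "C3 \<union> C2 = C1 \<union> C2")
      case False
      then have "card (C3 \<union> C2) < card (C1 \<union> C2)"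
        using sub fin C12 by (intro psubset_card_mono) auto
      then show ?thesis
        using less.hyps[of C3] C3 less.prems(3,4) meet by blast
    next
      case True
      show ?thesis
      proof (cases "g \<in> C3")
        case True
        then show ?thesis using C3 by blast
      next
        case gC3: False
        have D3: "?D - C3 \<in> \<S>"
          using symdiff_closed_Diff[OF \<S> D C3_in C3(3)] .
        have "g \<in> ?D - C3"
          using gC3 False less.prems(4) by blast
        then have ne: "?D - C3 \<noteq> {}" by blast
        have "?D - C3 \<subseteq> C2 - C1"
          using True by blast
        then have "?D - C3 \<subseteq> C2" "?D - C3 \<noteq> C2"
          using less.prems(5) by blast+
        then show ?thesis
          using less.prems(3) D3 ne unfolding circuit_def by blast
      qed
    qed
  qed
qed

text \<open>The connected component of \<open>e\<close> in the matroid; for the cuts of a graph, the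
  block that contains the edge \<open>e\<close>.\<close>

definition circuit_class :: "'e set set \<Rightarrow> 'e \<Rightarrow> 'e set" where
  "circuit_class \<S> e = {f. \<exists>C. circuit \<S> C \<and> e \<in> C \<and> f \<in> C}"

lemma circuit_class_sym: "f \<in> circuit_class \<S> e \<longleftrightarrow> e \<in> circuit_class \<S> f"
  by (auto simp: circuit_class_def)

lemma circuit_class_eq:
  assumes "symdiff_closed \<S>" "\<And>A. A \<in> \<S> \<Longrightarrow> finite A" "f \<in> circuit_class \<S> e"
  shows "circuit_class \<S> f = circuit_class \<S> e"
proof -
  have "circuit_class \<S> x \<subseteq> circuit_class \<S> y" if "y \<in> circuit_class \<S> x" for x y
  proof
    fix z assume "z \<in> circuit_class \<S> x"
    with that obtain C1 C2 where "circuit \<S> C1" "x \<in> C1" "y \<in> C1" "circuit \<S> C2" "x \<in> C2" "z \<in> C2"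
      by (auto simp: circuit_class_def)
    then show "z \<in> circuit_class \<S> y"
      using circuit_trans[OF assms(1,2), of C1 y C2 z] by (auto simp: circuit_class_def)
  qed
  then show ?thesis
    using assms(3) circuit_class_sym by (metis subset_antisym)
qed

text \<open>A member is a disjoint union of circuits, each inside a single class; the circuits of
  one class are kept. For cuts this says that the spins can be changed on one block alone, the
  source of independence between blocks.\<close>

lemma circuit_class_separates:
  assumes \<S>: "symdiff_closed \<S>" and fin: "\<And>A. A \<in> \<S> \<Longrightarrow> finite A" and F: "F \<in> \<S>"
  shows "F \<inter> circuit_class \<S> e \<in> \<S>"
  using F
proof (induction "card F" arbitrary: F rule: less_induct)
  case less
  show ?case
  proof (cases "F \<inter> circuit_class \<S> e = {}")
    case True
    then show ?thesis
      using symdiff_closedD[OF \<S> less.prems less.prems] by simp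
  next
    case False
    then obtain f where f: "f \<in> F" "f \<in> circuit_class \<S> e" by blast
    obtain C where C: "circuit \<S> C" "f \<in> C" "C \<subseteq> F"
      using circuit_exists[OF \<S> fin[OF less.prems] less.prems f(1)] by blast
    have CS: "C \<in> \<S>"
      using C by (simp add: circuit_def)
    have sub: "C \<subseteq> circuit_class \<S> e"
    proof -
      have "C \<subseteq> circuit_class \<S> f"
        using C by (auto simp: circuit_class_def)
      then show ?thesis
        using circuit_class_eq[OF \<S> fin f(2)] by simp
    qed
    have FC: "F - C \<in> \<S>"
      using symdiff_closed_Diff[OF \<S> less.prems CS C(3)] .
    have "card (F - C) < card F"
      using fin[OF less.prems] C by (intro psubset_card_mono) auto
    then have "(F - C) \<inter> circuit_class \<S> e \<in> \<S>"
      using less.hyps FC by blast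
    from symdiff_closedD[OF \<S> this CS]
    have "((F - C) \<inter> circuit_class \<S> e - C) \<union> (C - (F - C) \<inter> circuit_class \<S> e) \<in> \<S>" .
    also have "((F - C) \<inter> circuit_class \<S> e - C) \<union> (C - (F - C) \<inter> circuit_class \<S> e)
        = F \<inter> circuit_class \<S> e"
      using sub C(3) by blast
    finally show ?thesis .
  qed
qed

section \<open>Correlation inequalities\<close>

text \<open>
  Spin configurations enter only through the signs \<open>s \<sigma> e\<close> of the edges, which are multiplicative
  in \<open>\<sigma>\<close>.
\<close>
locale sign_system =
  fixes X :: "'x set" and E :: "'e set" and s :: "'x \<Rightarrow> 'e \<Rightarrow> real" and mul :: "'x \<Rightarrow> 'x \<Rightarrow> 'x"
  assumes finite_X: "finite X" and X_nonempty: "X \<noteq> {}" and finite_E: "finite E"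
    and sign: "\<sigma> \<in> X \<Longrightarrow> e \<in> E \<Longrightarrow> s \<sigma> e = 1 \<or> s \<sigma> e = -1"
    and mul_bij: "\<sigma> \<in> X \<Longrightarrow> bij_betw (mul \<sigma>) X X"
    and s_mul: "\<sigma> \<in> X \<Longrightarrow> \<tau> \<in> X \<Longrightarrow> e \<in> E \<Longrightarrow> s (mul \<sigma> \<tau>) e = s \<sigma> e * s \<tau> e"
    and s_nontrivial: "e \<in> E \<Longrightarrow> \<exists>\<sigma>\<in>X. s \<sigma> e = -1"
begin

lemma mul_closed: "\<sigma> \<in> X \<Longrightarrow> \<tau> \<in> X \<Longrightarrow> mul \<sigma> \<tau> \<in> X"
  using mul_bij bij_betwE by blast

lemma sum_mul: "\<sigma> \<in> X \<Longrightarrow> (\<Sum>\<tau>\<in>X. f (mul \<sigma> \<tau>)) = (\<Sum>\<tau>\<in>X. f \<tau> :: real)"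
  by (rule sum.reindex_bij_betw[OF mul_bij])

lemma unit_exists: "\<exists>\<iota>\<in>X. \<forall>e\<in>E. s \<iota> e = 1"
proof -
  obtain \<sigma> where \<sigma>: "\<sigma> \<in> X" using X_nonempty by auto
  have "s (mul \<sigma> \<sigma>) e = 1" if "e \<in> E" for e
    using sign[OF \<sigma> that] by (auto simp: s_mul[OF \<sigma> \<sigma> that])
  then show ?thesis using mul_closed[OF \<sigma> \<sigma>] by blast
qed

definition neg :: "'x \<Rightarrow> 'e set" where
  "neg \<sigma> = {e \<in> E. s \<sigma> e = -1}"

lemma finite_neg: "A \<in> neg ` X \<Longrightarrow> finite A"
  using finite_E by (auto simp: neg_def)

lemma neg_mul:
  assumes "\<sigma> \<in> X" "\<tau> \<in> X"
  shows "neg (mul \<sigma> \<tau>) = (neg \<sigma> - neg \<tau>) \<union> (neg \<tau> - neg \<sigma>)"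
  unfolding neg_def using sign[OF assms(1)] sign[OF assms(2)] s_mul[OF assms] by fastforce

lemma symdiff_closed_neg: "symdiff_closed (neg ` X)"
  unfolding symdiff_closed_def using neg_mul mul_closed by (auto simp: image_iff) metis

section \<open>Characters and the cone they span\<close>

definition character :: "('x \<Rightarrow> real) \<Rightarrow> bool" where
  "character \<phi> \<longleftrightarrow> (\<forall>\<sigma>\<in>X. \<phi> \<sigma> = 1 \<or> \<phi> \<sigma> = -1) \<and> (\<forall>\<sigma>\<in>X. \<forall>\<tau>\<in>X. \<phi> (mul \<sigma> \<tau>) = \<phi> \<sigma> * \<phi> \<tau>)"

lemma character_1: "character (\<lambda>_. 1)"
  by (simp add: character_def)

lemma character_s: "e \<in> E \<Longrightarrow> character (\<lambda>\<sigma>. s \<sigma> e)"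
  using sign s_mul by (auto simp: character_def)

lemma character_mult: "character \<phi> \<Longrightarrow> character \<psi> \<Longrightarrow> character (\<lambda>\<sigma>. \<phi> \<sigma> * \<psi> \<sigma>)"
  by (fastforce simp: character_def)

text \<open>Multiplication by a configuration with \<open>\<phi> \<tau> = -1\<close> changes the
  sign of the sum, so a nontrivial character sums to 0.\<close>

lemma sum_character_nonneg:
  assumes "character \<phi>" shows "0 \<le> (\<Sum>\<sigma>\<in>X. \<phi> \<sigma>)"
proof (cases "\<exists>\<tau>\<in>X. \<phi> \<tau> = -1")
  case True
  then obtain \<tau> where \<tau>: "\<tau> \<in> X" "\<phi> \<tau> = -1" by blast
  have "(\<Sum>\<sigma>\<in>X. \<phi> \<sigma>) = (\<Sum>\<sigma>\<in>X. \<phi> (mul \<tau> \<sigma>))"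
    by (rule sum_mul[OF \<tau>(1), symmetric])
  also have "\<dots> = - (\<Sum>\<sigma>\<in>X. \<phi> \<sigma>)"
    using assms \<tau> by (simp add: character_def sum_negf)
  finally show ?thesis by simp
next
  case False
  then show ?thesis
    using assms by (intro sum_nonneg) (auto simp: character_def)
qed

text \<open>The functions with nonnegative Fourier coefficients. Products of characters are
  characters, so the cone is closed under multiplication, and its members have nonnegative sums:
  this is Griffiths' first inequality.\<close>

inductive pcone :: "('x \<Rightarrow> real) \<Rightarrow> bool" where
  pcone_0: "pcone (\<lambda>_. 0)"
| pcone_step: "character \<phi> \<Longrightarrow> 0 \<le> c \<Longrightarrow> pcone f \<Longrightarrow> pcone (\<lambda>\<sigma>. c * \<phi> \<sigma> + f \<sigma>)"

lemma pcone_sum_nonneg: "pcone f \<Longrightarrow> 0 \<le> (\<Sum>\<sigma>\<in>X. f \<sigma>)"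
  by (induction rule: pcone.induct)
    (auto simp: sum.distrib sum_character_nonneg simp flip: sum_distrib_left)

lemma pcone_character: "character \<phi> \<Longrightarrow> 0 \<le> c \<Longrightarrow> pcone (\<lambda>\<sigma>. c * \<phi> \<sigma>)"
  using pcone_step[OF _ _ pcone_0] by simp

lemma pcone_const: "0 \<le> c \<Longrightarrow> pcone (\<lambda>_. c)"
  using pcone_character[OF character_1] by simp

lemma pcone_sign: "e \<in> E \<Longrightarrow> 0 \<le> c \<Longrightarrow> pcone (\<lambda>\<sigma>. c * s \<sigma> e)"
  by (rule pcone_character[OF character_s])

lemma pcone_add: "pcone f \<Longrightarrow> pcone g \<Longrightarrow> pcone (\<lambda>\<sigma>. f \<sigma> + g \<sigma>)"
proof (induction rule: pcone.induct)
  case (pcone_step \<phi> c f)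
  then show ?case
    using pcone.pcone_step[of \<phi> c "\<lambda>\<sigma>. f \<sigma> + g \<sigma>"] by (simp add: add.assoc)
qed simp

lemma pcone_character_mult:
  assumes "pcone f" "character \<phi>" "0 \<le> c" shows "pcone (\<lambda>\<sigma>. c * \<phi> \<sigma> * f \<sigma>)"
  using assms(1)
proof (induction rule: pcone.induct)
  case pcone_0
  show ?case using pcone.pcone_0 by simp
next
  case (pcone_step \<psi> d f)
  have "pcone (\<lambda>\<sigma>. (c * d) * (\<phi> \<sigma> * \<psi> \<sigma>) + c * \<phi> \<sigma> * f \<sigma>)"
    by (rule pcone.pcone_step) (use pcone_step assms character_mult in auto)
  then show ?case by (simp add: algebra_simps)
qed

lemma pcone_mult: "pcone f \<Longrightarrow> pcone g \<Longrightarrow> pcone (\<lambda>\<sigma>. f \<sigma> * g \<sigma>)"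
proof (induction rule: pcone.induct)
  case pcone_0
  show ?case using pcone.pcone_0 by simp
next
  case (pcone_step \<phi> c f)
  then show ?case
    using pcone_add[OF pcone_character_mult[of g \<phi> c], of "\<lambda>\<sigma>. f \<sigma> * g \<sigma>"]
    by (simp add: algebra_simps)
qed

lemma pcone_affine: "e \<in> E \<Longrightarrow> 0 \<le> u \<Longrightarrow> 0 \<le> v \<Longrightarrow> pcone (\<lambda>\<sigma>. u + v * s \<sigma> e)"
  by (intro pcone_add pcone_const pcone_sign)

lemma pcone_prod: "finite A \<Longrightarrow> (\<And>e. e \<in> A \<Longrightarrow> pcone (f e)) \<Longrightarrow> pcone (\<lambda>\<sigma>. \<Prod>e\<in>A. f e \<sigma>)"
  by (induction rule: finite_induct) (auto intro: pcone_const pcone_mult)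

text \<open>\<open>f\<close> dominates \<open>g\<close> coefficientwise in the character expansion.\<close>
definition pcone_ge :: "('x \<Rightarrow> real) \<Rightarrow> ('x \<Rightarrow> real) \<Rightarrow> bool" where
  "pcone_ge f g \<longleftrightarrow> pcone g \<and> pcone (\<lambda>\<sigma>. f \<sigma> - g \<sigma>)"

lemma pcone_geD:
  assumes "pcone_ge f g" shows "pcone f" "(\<Sum>\<sigma>\<in>X. g \<sigma>) \<le> (\<Sum>\<sigma>\<in>X. f \<sigma>)"
  using pcone_add[of g "\<lambda>\<sigma>. f \<sigma> - g \<sigma>"] pcone_sum_nonneg[of "\<lambda>\<sigma>. f \<sigma> - g \<sigma>"] assms
  by (simp_all add: pcone_ge_def sum_subtractf)

lemma pcone_ge_mult:
  assumes "pcone_ge f f'" "pcone_ge g g'" shows "pcone_ge (\<lambda>\<sigma>. f \<sigma> * g \<sigma>) (\<lambda>\<sigma>. f' \<sigma> * g' \<sigma>)"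
proof -
  have "pcone (\<lambda>\<sigma>. (f \<sigma> - f' \<sigma>) * g \<sigma> + f' \<sigma> * (g \<sigma> - g' \<sigma>))"
    using assms pcone_geD(1)[OF assms(2)] by (intro pcone_add pcone_mult) (auto simp: pcone_ge_def)
  then show ?thesis
    using assms by (auto simp: pcone_ge_def pcone_mult algebra_simps)
qed

lemma pcone_ge_prod_affine:
  assumes "finite A" "A \<subseteq> E" "\<And>e. e \<in> A \<Longrightarrow> 0 \<le> u' e \<and> u' e \<le> u e \<and> 0 \<le> v' e \<and> v' e \<le> v e"
  shows "pcone_ge (\<lambda>\<sigma>. \<Prod>e\<in>A. u e + v e * s \<sigma> e) (\<lambda>\<sigma>. \<Prod>e\<in>A. u' e + v' e * s \<sigma> e)"
  using assms
proof (induction rule: finite_induct)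
  case empty
  show ?case using pcone_const[of 1] pcone_0 by (simp add: pcone_ge_def)
next
  case (insert e A)
  have "pcone_ge (\<lambda>\<sigma>. u e + v e * s \<sigma> e) (\<lambda>\<sigma>. u' e + v' e * s \<sigma> e)"
    using pcone_affine[of e "u' e" "v' e"] pcone_affine[of e "u e - u' e" "v e - v' e"] insert.prems
    by (auto simp: pcone_ge_def algebra_simps)
  then show ?case
    using insert by (simp add: pcone_ge_mult)
qed

text \<open>The odd and the even part have to be treated together, since adding an edge expresses
  each through the other.\<close>

lemma pcone_odd_even:
  assumes "finite M" "M \<subseteq> E" "\<And>e. e \<in> M \<Longrightarrow> 0 \<le> a e"
  shows "pcone (\<lambda>\<sigma>. (\<Prod>e\<in>M. 1 + a e * s \<sigma> e) - (\<Prod>e\<in>M. 1 - a e * s \<sigma> e))"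
    and "pcone (\<lambda>\<sigma>. (\<Prod>e\<in>M. 1 + a e * s \<sigma> e) + (\<Prod>e\<in>M. 1 - a e * s \<sigma> e))"
  using assms
proof (induction rule: finite_induct)
  case empty
  { case 1 show ?case using pcone_0 by simp
  next case 2 show ?case using pcone_const[of 2] by simp }
next
  case (insert e M)
  let ?P = "\<lambda>\<sigma>. \<Prod>e\<in>M. 1 + a e * s \<sigma> e" and ?Q = "\<lambda>\<sigma>. \<Prod>e\<in>M. 1 - a e * s \<sigma> e"
  { case 1
    then have "pcone (\<lambda>\<sigma>. ?P \<sigma> - ?Q \<sigma>)" "pcone (\<lambda>\<sigma>. ?P \<sigma> + ?Q \<sigma>)" "pcone (\<lambda>\<sigma>. a e * s \<sigma> e)"
      using insert.IH pcone_sign by auto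
    then have "pcone (\<lambda>\<sigma>. (?P \<sigma> - ?Q \<sigma>) + a e * s \<sigma> e * (?P \<sigma> + ?Q \<sigma>))"
      by (simp only: pcone_add pcone_mult)
    then show ?case using insert.hyps by (simp add: algebra_simps)
  next
    case 2
    then have "pcone (\<lambda>\<sigma>. ?P \<sigma> + ?Q \<sigma>)" "pcone (\<lambda>\<sigma>. ?P \<sigma> - ?Q \<sigma>)" "pcone (\<lambda>\<sigma>. a e * s \<sigma> e)"
      using insert.IH pcone_sign by auto
    then have "pcone (\<lambda>\<sigma>. (?P \<sigma> + ?Q \<sigma>) + a e * s \<sigma> e * (?P \<sigma> - ?Q \<sigma>))"
      by (simp only: pcone_add pcone_mult)
    then show ?case using insert.hyps by (simp add: algebra_simps) }
qed

lemma pcone_ge_odd: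
  assumes "finite M" "M \<subseteq> E" "\<And>e. e \<in> M \<Longrightarrow> 0 \<le> a e" "f \<in> M"
  shows "pcone_ge (\<lambda>\<sigma>. (\<Prod>e\<in>M. 1 + a e * s \<sigma> e) - (\<Prod>e\<in>M. 1 - a e * s \<sigma> e)) (\<lambda>\<sigma>. 2 * a f * s \<sigma> f)"
proof -
  let ?M = "M - {f}"
  let ?P = "\<lambda>\<sigma>. \<Prod>e\<in>?M. 1 + a e * s \<sigma> e" and ?Q = "\<lambda>\<sigma>. \<Prod>e\<in>?M. 1 - a e * s \<sigma> e"
  have M: "prod h M = h f * prod h ?M" for h :: "'e \<Rightarrow> real"
    by (rule prod.remove[OF assms(1,4)])
  have fin: "finite ?M" "?M \<subseteq> E" using assms by auto
  \<comment> \<open>The even part has constant term 2. Multiplied by the sign of \<open>f\<close>,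
    this constant produces the linear term that is to be split off.\<close>
  have even: "pcone (\<lambda>\<sigma>. ?P \<sigma> + ?Q \<sigma> - 2)"
  proof -
    have "pcone (\<lambda>\<sigma>. (\<Prod>e\<in>A. 1 + a e * s \<sigma> e) + (\<Prod>e\<in>A. 1 - a e * s \<sigma> e) - 2)" if "finite A" "A \<subseteq> ?M" for A
      using that
    proof (induction rule: finite_induct)
      case empty
      show ?case using pcone_0 by simp
    next
      case (insert e A)
      have "pcone (\<lambda>\<sigma>. (\<Prod>e\<in>A. 1 + a e * s \<sigma> e) + (\<Prod>e\<in>A. 1 - a e * s \<sigma> e) - 2)"
        using insert by auto
      moreover have "pcone (\<lambda>\<sigma>. (\<Prod>e\<in>A. 1 + a e * s \<sigma> e) - (\<Prod>e\<in>A. 1 - a e * s \<sigma> e))"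
        by (rule pcone_odd_even) (use insert assms in auto)
      moreover have "pcone (\<lambda>\<sigma>. a e * s \<sigma> e)"
        using insert assms by (intro pcone_sign) auto
      ultimately have "pcone (\<lambda>\<sigma>. ((\<Prod>e\<in>A. 1 + a e * s \<sigma> e) + (\<Prod>e\<in>A. 1 - a e * s \<sigma> e) - 2)
          + a e * s \<sigma> e * ((\<Prod>e\<in>A. 1 + a e * s \<sigma> e) - (\<Prod>e\<in>A. 1 - a e * s \<sigma> e)))"
        by (simp only: pcone_add pcone_mult)
      then show ?case using insert.hyps by (simp add: algebra_simps)
    qed
    then show ?thesis using fin by blast
  qed
  have "pcone (\<lambda>\<sigma>. ?P \<sigma> - ?Q \<sigma>)"
    by (rule pcone_odd_even) (use fin assms in auto)
  moreover have "pcone (\<lambda>\<sigma>. a f * s \<sigma> f)"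
    using assms by (intro pcone_sign) auto
  ultimately have "pcone (\<lambda>\<sigma>. (?P \<sigma> - ?Q \<sigma>) + a f * s \<sigma> f * (?P \<sigma> + ?Q \<sigma> - 2))"
    using even by (simp only: pcone_add pcone_mult)
  moreover have "(\<Prod>e\<in>M. 1 + a e * s \<sigma> e) - (\<Prod>e\<in>M. 1 - a e * s \<sigma> e) - 2 * a f * s \<sigma> f
      = (?P \<sigma> - ?Q \<sigma>) + a f * s \<sigma> f * (?P \<sigma> + ?Q \<sigma> - 2)" for \<sigma>
    unfolding M by (simp add: algebra_simps)
  ultimately show ?thesis
    using pcone_sign[of f "2 * a f"] assms by (auto simp: pcone_ge_def)
qed

section \<open>Ginibre's inequality and its strict form\<close>

definition gibbs :: "('e \<Rightarrow> real) \<Rightarrow> 'x \<Rightarrow> real" where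
  "gibbs J \<sigma> = exp (\<Sum>e\<in>E. J e * s \<sigma> e)"

definition observable :: "('e \<Rightarrow> real) \<Rightarrow> 'x \<Rightarrow> real" where
  "observable a \<sigma> = (\<Prod>e\<in>E. 1 + a e * s \<sigma> e)"

text \<open>
  Ginibre's duplication: with \<open>\<tau> = \<sigma> t\<close>, on the edges where \<open>t\<close> is positive both copies agree and
  the couplings double, while on the others the Gibbs weights cancel and only the odd parts of the
  two observables survive.  For fixed \<open>t\<close> everything is then a product of affine functions of the
  signs with nonnegative coefficients.
\<close>
lemma gibbs_observable_duplicate:
  fixes J a b :: "'e \<Rightarrow> real"
  assumes \<alpha>: "\<alpha> = 1 \<or> \<alpha> = -1" and \<beta>: "\<beta> = 1 \<or> \<beta> = -1" and t: "t \<in> X" and \<sigma>: "\<sigma> \<in> X"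
  defines "\<Phi> \<equiv> \<lambda>e x. exp (2 * J e * x) * (1 + a e * x) * (1 + b e * x)"
  shows "gibbs J \<sigma> * gibbs J (mul \<sigma> t) * (\<alpha> * (observable a \<sigma> - observable a (mul \<sigma> t)))
      * (\<beta> * (observable b \<sigma> - observable b (mul \<sigma> t)))
    = (\<Prod>e\<in>E - neg t. (\<Phi> e 1 + \<Phi> e (-1)) / 2 + (\<Phi> e 1 - \<Phi> e (-1)) / 2 * s \<sigma> e)
      * ((\<Prod>e\<in>neg t. 1 + \<alpha> * a e * s \<sigma> e) - (\<Prod>e\<in>neg t. 1 - \<alpha> * a e * s \<sigma> e))
      * ((\<Prod>e\<in>neg t. 1 + \<beta> * b e * s \<sigma> e) - (\<Prod>e\<in>neg t. 1 - \<beta> * b e * s \<sigma> e))"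
proof -
  let ?M = "neg t" and ?P = "E - neg t"
  have M: "?M \<subseteq> E" by (auto simp: neg_def)
  have fin: "finite ?M" "finite ?P" using finite_E M finite_subset by auto
  have sM: "s (mul \<sigma> t) e = - s \<sigma> e" if "e \<in> ?M" for e
    using that s_mul[OF \<sigma> t] by (auto simp: neg_def)
  have sP: "s (mul \<sigma> t) e = s \<sigma> e" if "e \<in> E" "e \<notin> ?M" for e
    using that s_mul[OF \<sigma> t] sign[OF t] by (auto simp: neg_def)
  have split: "prod f E = prod f ?P * prod f ?M" for f :: "'e \<Rightarrow> real"
    using prod.subset_diff[OF M finite_E, of f] .
  have "gibbs J \<sigma> * gibbs J (mul \<sigma> t) = exp (\<Sum>e\<in>E. J e * s \<sigma> e + J e * s (mul \<sigma> t) e)"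
    by (simp add: gibbs_def sum.distrib exp_add)
  also have "(\<Sum>e\<in>E. J e * s \<sigma> e + J e * s (mul \<sigma> t) e)
      = (\<Sum>e\<in>?P. J e * s \<sigma> e + J e * s (mul \<sigma> t) e) + (\<Sum>e\<in>?M. J e * s \<sigma> e + J e * s (mul \<sigma> t) e)"
    by (rule sum.subset_diff[OF M finite_E])
  also have "\<dots> = (\<Sum>e\<in>?P. 2 * J e * s \<sigma> e)"
  proof -
    have "(\<Sum>e\<in>?P. J e * s \<sigma> e + J e * s (mul \<sigma> t) e) = (\<Sum>e\<in>?P. 2 * J e * s \<sigma> e)"
      by (rule sum.cong[OF refl]) (simp add: sP)
    moreover have "(\<Sum>e\<in>?M. J e * s \<sigma> e + J e * s (mul \<sigma> t) e) = 0"
      by (rule sum.neutral) (simp add: sM)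
    ultimately show ?thesis by simp
  qed
  also have "exp \<dots> = (\<Prod>e\<in>?P. exp (2 * J e * s \<sigma> e))"
    by (simp add: exp_sum fin)
  finally have G: "gibbs J \<sigma> * gibbs J (mul \<sigma> t) = (\<Prod>e\<in>?P. exp (2 * J e * s \<sigma> e))" .
  have A: "\<gamma> * (observable c \<sigma> - observable c (mul \<sigma> t)) = (\<Prod>e\<in>?P. 1 + c e * s \<sigma> e)
      * ((\<Prod>e\<in>?M. 1 + \<gamma> * c e * s \<sigma> e) - (\<Prod>e\<in>?M. 1 - \<gamma> * c e * s \<sigma> e))"
    if "\<gamma> = 1 \<or> \<gamma> = -1" for \<gamma> c
  proof -
    have P: "(\<Prod>e\<in>?P. 1 + c e * s (mul \<sigma> t) e) = (\<Prod>e\<in>?P. 1 + c e * s \<sigma> e)"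
      by (rule prod.cong[OF refl]) (simp add: sP)
    have M: "(\<Prod>e\<in>?M. 1 + c e * s (mul \<sigma> t) e) = (\<Prod>e\<in>?M. 1 - c e * s \<sigma> e)"
      by (rule prod.cong[OF refl]) (simp add: sM)
    show ?thesis
      using that unfolding observable_def split P M by (auto simp: algebra_simps)
  qed
  \<comment> \<open>Every function of a sign is affine, determined by its values at 1 and
    -1.\<close>
  have "(\<Phi> e 1 + \<Phi> e (-1)) / 2 + (\<Phi> e 1 - \<Phi> e (-1)) / 2 * s \<sigma> e
      = exp (2 * J e * s \<sigma> e) * (1 + a e * s \<sigma> e) * (1 + b e * s \<sigma> e)" if "e \<in> ?P" for e
    using that sign[OF \<sigma>, of e] by (auto simp: \<Phi>_def field_simps)
  then show ?thesis
  proof -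
    assume *: "\<And>e. e \<in> ?P \<Longrightarrow> (\<Phi> e 1 + \<Phi> e (-1)) / 2 + (\<Phi> e 1 - \<Phi> e (-1)) / 2 * s \<sigma> e
      = exp (2 * J e * s \<sigma> e) * (1 + a e * s \<sigma> e) * (1 + b e * s \<sigma> e)"
    have "(\<Prod>e\<in>?P. (\<Phi> e 1 + \<Phi> e (-1)) / 2 + (\<Phi> e 1 - \<Phi> e (-1)) / 2 * s \<sigma> e)
      = (\<Prod>e\<in>?P. exp (2 * J e * s \<sigma> e)) * (\<Prod>e\<in>?P. 1 + a e * s \<sigma> e) * (\<Prod>e\<in>?P. 1 + b e * s \<sigma> e)"
      unfolding prod.distrib[symmetric] by (rule prod.cong[OF refl *])
    then show ?thesis
      unfolding G A[OF \<alpha>] A[OF \<beta>] by (simp only: mult_ac)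
  qed
qed

text \<open>For fixed \<open>\<sigma>\<close> the product \<open>\<tau> = mul \<sigma> t\<close>
  runs over all configurations, so this is the usual formula for a covariance through two
  independent copies, up to normalization.\<close>

lemma sum_duplicate:
  fixes h f g :: "'x \<Rightarrow> real"
  shows "(\<Sum>t\<in>X. \<Sum>\<sigma>\<in>X. h \<sigma> * h (mul \<sigma> t) * (\<alpha> * (f \<sigma> - f (mul \<sigma> t))) * (\<beta> * (g \<sigma> - g (mul \<sigma> t))))
    = 2 * (\<alpha> * \<beta>) * ((\<Sum>\<sigma>\<in>X. h \<sigma> * f \<sigma> * g \<sigma>) * (\<Sum>\<sigma>\<in>X. h \<sigma>)
        - (\<Sum>\<sigma>\<in>X. h \<sigma> * f \<sigma>) * (\<Sum>\<sigma>\<in>X. h \<sigma> * g \<sigma>))"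
proof -
  have "(\<Sum>t\<in>X. \<Sum>\<sigma>\<in>X. h \<sigma> * h (mul \<sigma> t) * (\<alpha> * (f \<sigma> - f (mul \<sigma> t))) * (\<beta> * (g \<sigma> - g (mul \<sigma> t))))
    = (\<Sum>\<sigma>\<in>X. \<Sum>t\<in>X. h \<sigma> * h (mul \<sigma> t) * (\<alpha> * (f \<sigma> - f (mul \<sigma> t))) * (\<beta> * (g \<sigma> - g (mul \<sigma> t))))"
    by (rule sum.swap)
  also have "\<dots> = (\<Sum>\<sigma>\<in>X. \<Sum>\<tau>\<in>X. h \<sigma> * h \<tau> * (\<alpha> * (f \<sigma> - f \<tau>)) * (\<beta> * (g \<sigma> - g \<tau>)))"
    by (rule sum.cong[OF refl],
        rule sum_mul[of _ "\<lambda>\<tau>. h _ * h \<tau> * (\<alpha> * (f _ - f \<tau>)) * (\<beta> * (g _ - g \<tau>))"])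
  also have "\<dots> = (\<Sum>\<sigma>\<in>X. \<Sum>\<tau>\<in>X. \<alpha> * \<beta> * ((h \<sigma> * f \<sigma> * g \<sigma>) * h \<tau> - (h \<sigma> * f \<sigma>) * (h \<tau> * g \<tau>)
      - (h \<sigma> * g \<sigma>) * (h \<tau> * f \<tau>) + h \<sigma> * (h \<tau> * f \<tau> * g \<tau>)))"
    by (intro sum.cong refl) (simp add: algebra_simps)
  also have "\<dots> = \<alpha> * \<beta> * ((\<Sum>\<sigma>\<in>X. h \<sigma> * f \<sigma> * g \<sigma>) * (\<Sum>\<sigma>\<in>X. h \<sigma>)
      - (\<Sum>\<sigma>\<in>X. h \<sigma> * f \<sigma>) * (\<Sum>\<sigma>\<in>X. h \<sigma> * g \<sigma>) - (\<Sum>\<sigma>\<in>X. h \<sigma> * g \<sigma>) * (\<Sum>\<sigma>\<in>X. h \<sigma> * f \<sigma>)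
      + (\<Sum>\<sigma>\<in>X. h \<sigma>) * (\<Sum>\<sigma>\<in>X. h \<sigma> * f \<sigma> * g \<sigma>))"
    by (simp only: sum_distrib_left[symmetric] sum.distrib sum_subtractf sum_product)
  finally show ?thesis by (simp add: algebra_simps)
qed

text \<open>Every \<open>t\<close> contributes nonnegatively because each factor of the duplicated
  summand lies in the cone. For strictness a single \<open>t\<close> with \<open>neg t = M\<close>
  suffices: then \<open>e\<close> and \<open>f\<close> both lie where the two copies differ, and the
  odd parts contain the linear terms in \<open>s \<sigma> e\<close> and
  \<open>s \<sigma> f\<close>.\<close>

lemma ginibre_strict:
  assumes \<alpha>: "\<alpha> = 1 \<or> \<alpha> = -1" and \<beta>: "\<beta> = 1 \<or> \<beta> = -1"
    and a: "\<And>e. e \<in> E \<Longrightarrow> 0 \<le> \<alpha> * a e" and b: "\<And>e. e \<in> E \<Longrightarrow> 0 \<le> \<beta> * b e"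
    and coupling: "\<And>e. e \<in> E \<Longrightarrow> 0 \<le> exp (-2 * J e) * (1 - a e) * (1 - b e) \<and>
      exp (-2 * J e) * (1 - a e) * (1 - b e) < exp (2 * J e) * (1 + a e) * (1 + b e)"
    and circ: "circuit (neg ` X) M" and ef: "e \<in> M" "a e \<noteq> 0" "f \<in> M" "b f \<noteq> 0"
  shows "0 < (\<alpha> * \<beta>) * ((\<Sum>\<sigma>\<in>X. gibbs J \<sigma> * observable a \<sigma> * observable b \<sigma>) * (\<Sum>\<sigma>\<in>X. gibbs J \<sigma>)
        - (\<Sum>\<sigma>\<in>X. gibbs J \<sigma> * observable a \<sigma>) * (\<Sum>\<sigma>\<in>X. gibbs J \<sigma> * observable b \<sigma>))"
proof -
  define \<Phi> where "\<Phi> e x = exp (2 * J e * x) * (1 + a e * x) * (1 + b e * x)" for e x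
  define u v where "u e = (\<Phi> e 1 + \<Phi> e (-1)) / 2" and "v e = (\<Phi> e 1 - \<Phi> e (-1)) / 2" for e
  have uv: "0 < u e" "0 < v e" if "e \<in> E" for e
    using coupling[OF that] by (auto simp: u_def v_def \<Phi>_def)
  define P where "P t \<sigma> = (\<Prod>e\<in>E - neg t. u e + v e * s \<sigma> e)" for t \<sigma>
  define Od where "Od t c \<sigma> = (\<Prod>e\<in>neg t. 1 + c e * s \<sigma> e) - (\<Prod>e\<in>neg t. 1 - c e * s \<sigma> e)" for t c \<sigma>
  let ?a = "\<lambda>e. \<alpha> * a e" and ?b = "\<lambda>e. \<beta> * b e"
  let ?T = "\<lambda>t \<sigma>. gibbs J \<sigma> * gibbs J (mul \<sigma> t) * (\<alpha> * (observable a \<sigma> - observable a (mul \<sigma> t)))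
      * (\<beta> * (observable b \<sigma> - observable b (mul \<sigma> t)))"
  have T: "?T t \<sigma> = P t \<sigma> * Od t ?a \<sigma> * Od t ?b \<sigma>" if "t \<in> X" "\<sigma> \<in> X" for t \<sigma>
    unfolding gibbs_observable_duplicate[OF \<alpha> \<beta> that] P_def Od_def u_def v_def \<Phi>_def ..
  have negE: "neg t \<subseteq> E" "finite (neg t)" for t
    using finite_E by (auto simp: neg_def)
  have nonneg: "0 \<le> (\<Sum>\<sigma>\<in>X. ?T t \<sigma>)" if "t \<in> X" for t
  proof -
    have "pcone (P t)"
      unfolding P_def using finite_E by (intro pcone_prod pcone_affine) (auto simp: less_imp_le uv)
    moreover have "pcone (Od t ?a)"
      unfolding Od_def by (rule pcone_odd_even) (use negE[of t] a in auto)
    moreover have "pcone (Od t ?b)"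
      unfolding Od_def by (rule pcone_odd_even) (use negE[of t] b in auto)
    ultimately have "pcone (\<lambda>\<sigma>. P t \<sigma> * Od t ?a \<sigma> * Od t ?b \<sigma>)"
      by (simp only: pcone_mult)
    then show ?thesis
      using pcone_sum_nonneg T[OF that] by (simp cong: sum.cong)
  qed
  obtain t where t: "t \<in> X" "M = neg t"
    using circ by (auto simp: circuit_def)
  \<comment> \<open>Lowering both coefficients to their minimum makes each factor a multiple of
    \<open>1 + s \<sigma> e\<close>, which vanishes on negative edges and so acts as a
    filter.\<close>
  define w where "w e = min (u e) (v e)" for e
  define m where "m = (\<Prod>e\<in>E - M. w e) * (2 * ?a e) * (2 * ?b f)"
  have m: "0 < m"
    unfolding m_def
  proof -
    have "e \<in> E" "f \<in> E" using ef t negE by auto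
    then have "0 < ?a e" "0 < ?b f"
      using a[of e] b[of f] ef \<alpha> \<beta> by (auto simp: less_le)
    moreover have "0 < (\<Prod>e\<in>E - M. w e)"
      using uv by (intro prod_pos) (auto simp: w_def)
    ultimately show "0 < (\<Prod>e\<in>E - M. w e) * (2 * ?a e) * (2 * ?b f)"
      by (metis mult_pos_pos zero_less_numeral)
  qed
  have ge: "pcone_ge (\<lambda>\<sigma>. P t \<sigma> * Od t ?a \<sigma> * Od t ?b \<sigma>)
      (\<lambda>\<sigma>. (\<Prod>e\<in>E - M. w e + w e * s \<sigma> e) * (2 * ?a e * s \<sigma> e) * (2 * ?b f * s \<sigma> f))"
  proof (intro pcone_ge_mult)
    show "pcone_ge (P t) (\<lambda>\<sigma>. \<Prod>e\<in>E - M. w e + w e * s \<sigma> e)"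
      unfolding P_def t(2) using finite_E uv
      by (intro pcone_ge_prod_affine) (auto simp: w_def less_imp_le)
    show "pcone_ge (Od t ?a) (\<lambda>\<sigma>. 2 * ?a e * s \<sigma> e)"
      unfolding Od_def by (rule pcone_ge_odd) (use negE[of t] a ef t(2) in auto)
    show "pcone_ge (Od t ?b) (\<lambda>\<sigma>. 2 * ?b f * s \<sigma> f)"
      unfolding Od_def by (rule pcone_ge_odd) (use negE[of t] b ef t(2) in auto)
  qed
  have eq: "(\<Prod>e\<in>E - M. w e + w e * s \<sigma> e) * (2 * ?a e * s \<sigma> e) * (2 * ?b f * s \<sigma> f)
      = m * ((\<Prod>e\<in>E - M. 1 + s \<sigma> e) * (s \<sigma> e * s \<sigma> f))" for \<sigma>
  proof -
    have "(\<Prod>e\<in>E - M. w e + w e * s \<sigma> e) = (\<Prod>e\<in>E - M. w e) * (\<Prod>e\<in>E - M. 1 + s \<sigma> e)"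
      by (simp add: prod.distrib[symmetric] algebra_simps)
    then show ?thesis by (simp add: m_def)
  qed
  \<comment> \<open>Once all edges outside \<open>M\<close> are positive, minimality of
    \<open>M\<close> leaves only sign patterns that are constant on \<open>M\<close>, and the signs
    of \<open>e\<close> and \<open>f\<close> agree.\<close>
  have pos: "0 \<le> (\<Prod>e\<in>E - M. 1 + s \<sigma> e) * (s \<sigma> e * s \<sigma> f)" if \<sigma>: "\<sigma> \<in> X" for \<sigma>
  proof (cases "\<exists>e\<in>E - M. s \<sigma> e = -1")
    case True
    then have "(\<Prod>e\<in>E - M. 1 + s \<sigma> e) = 0"
      using finite_E by (intro prod_zero) force+
    then show ?thesis by simp
  next
    case False
    then have "neg \<sigma> \<subseteq> M" by (auto simp: neg_def)
    then have "neg \<sigma> = {} \<or> neg \<sigma> = M"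
      using circ \<sigma> by (auto simp: circuit_def)
    moreover have "e \<in> E" "f \<in> E" using ef t negE by auto
    ultimately have "s \<sigma> e * s \<sigma> f = 1"
      using sign[OF \<sigma>, of e] sign[OF \<sigma>, of f] ef by (auto simp: neg_def)
    moreover have "0 \<le> (\<Prod>e\<in>E - M. 1 + s \<sigma> e)"
      using sign[OF \<sigma>] by (intro prod_nonneg) force
    ultimately show ?thesis by simp
  qed
  have "0 < (\<Prod>e\<in>E - M. 1 + s t e) * (s t e * s t f)"
  proof -
    have "s t e = -1" "s t f = -1"
      using ef t by (auto simp: neg_def)
    moreover have "0 < (\<Prod>e\<in>E - M. 1 + s t e)"
      using sign[OF t(1)] t(2) by (intro prod_pos) (force simp: neg_def)
    ultimately show ?thesis by simp
  qed
  then have "0 < (\<Sum>\<sigma>\<in>X. (\<Prod>e\<in>E - M. 1 + s \<sigma> e) * (s \<sigma> e * s \<sigma> f))"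
    using t pos finite_X by (intro sum_pos2) auto
  then have "0 < (\<Sum>\<sigma>\<in>X. m * ((\<Prod>e\<in>E - M. 1 + s \<sigma> e) * (s \<sigma> e * s \<sigma> f)))"
    using m by (simp flip: sum_distrib_left)
  also have "\<dots> \<le> (\<Sum>\<sigma>\<in>X. P t \<sigma> * Od t ?a \<sigma> * Od t ?b \<sigma>)"
    using pcone_geD(2)[OF ge] by (simp only: eq)
  also have "\<dots> = (\<Sum>\<sigma>\<in>X. ?T t \<sigma>)"
    by (intro sum.cong refl T[OF t(1), symmetric])
  finally have "0 < (\<Sum>\<sigma>\<in>X. ?T t \<sigma>)" .
  then have "0 < (\<Sum>t\<in>X. \<Sum>\<sigma>\<in>X. ?T t \<sigma>)"
    using nonneg by (rule sum_pos2[OF finite_X t(1), where f = "\<lambda>t. \<Sum>\<sigma>\<in>X. ?T t \<sigma>"])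
  then show ?thesis
    unfolding sum_duplicate by (simp add: zero_less_mult_iff)
qed

section \<open>Factorization over circuit classes\<close>

text \<open>Some \<open>\<rho>\<close> has \<open>neg \<rho> = neg \<tau> \<inter> C\<close>;
  multiplication by it moves the argument of \<open>f\<close> by \<open>\<tau>\<close> and is
  invisible to \<open>g\<close>. Averaging over \<open>\<tau>\<close> decouples the two
  factors.\<close>

lemma sum_separated:
  fixes f g :: "'x \<Rightarrow> real"
  assumes sep: "\<And>\<tau>. \<tau> \<in> X \<Longrightarrow> neg \<tau> \<inter> C \<in> neg ` X"
    and f: "\<And>\<sigma> \<tau>. \<sigma> \<in> X \<Longrightarrow> \<tau> \<in> X \<Longrightarrow> (\<And>e. e \<in> E \<inter> C \<Longrightarrow> s \<sigma> e = s \<tau> e) \<Longrightarrow> f \<sigma> = f \<tau>"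
    and g: "\<And>\<sigma> \<tau>. \<sigma> \<in> X \<Longrightarrow> \<tau> \<in> X \<Longrightarrow> (\<And>e. e \<in> E - C \<Longrightarrow> s \<sigma> e = s \<tau> e) \<Longrightarrow> g \<sigma> = g \<tau>"
  shows "(\<Sum>\<sigma>\<in>X. f \<sigma> * g \<sigma>) * card X = (\<Sum>\<sigma>\<in>X. f \<sigma>) * (\<Sum>\<sigma>\<in>X. g \<sigma>)"
proof -
  have shift: "(\<Sum>\<sigma>\<in>X. f \<sigma> * g \<sigma>) = (\<Sum>\<sigma>\<in>X. f (mul \<sigma> \<tau>) * g \<sigma>)" if \<tau>: "\<tau> \<in> X" for \<tau>
  proof -
    obtain \<rho> where \<rho>: "\<rho> \<in> X" "neg \<rho> = neg \<tau> \<inter> C"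
      using sep[OF \<tau>] by (metis imageE)
    have \<rho>C: "s \<rho> e = s \<tau> e" if "e \<in> E \<inter> C" for e
    proof -
      have "e \<in> neg \<rho> \<longleftrightarrow> e \<in> neg \<tau>"
        using \<rho>(2) that by auto
      then show ?thesis
        using that sign[OF \<rho>(1), of e] sign[OF \<tau>, of e] by (auto simp: neg_def)
    qed
    have \<rho>E: "s \<rho> e = 1" if "e \<in> E - C" for e
    proof -
      have "e \<notin> neg \<rho>"
        using \<rho>(2) that by auto
      then show ?thesis
        using that sign[OF \<rho>(1), of e] by (auto simp: neg_def)
    qed
    have "(\<Sum>\<sigma>\<in>X. f \<sigma> * g \<sigma>) = (\<Sum>\<sigma>\<in>X. f (mul \<rho> \<sigma>) * g (mul \<rho> \<sigma>))"
      by (rule sum_mul[OF \<rho>(1), symmetric])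
    also have "\<dots> = (\<Sum>\<sigma>\<in>X. f (mul \<sigma> \<tau>) * g \<sigma>)"
    proof (intro sum.cong refl arg_cong2[where f = "(*)"])
      fix \<sigma> assume \<sigma>: "\<sigma> \<in> X"
      show "f (mul \<rho> \<sigma>) = f (mul \<sigma> \<tau>)"
        by (rule f) (use \<sigma> \<tau> \<rho> \<rho>C in \<open>auto simp: mul_closed s_mul\<close>)
      show "g (mul \<rho> \<sigma>) = g \<sigma>"
        by (rule g) (use \<sigma> \<tau> \<rho> \<rho>E in \<open>auto simp: mul_closed s_mul\<close>)
    qed
    finally show ?thesis .
  qed
  have "(\<Sum>\<sigma>\<in>X. f \<sigma> * g \<sigma>) * card X = (\<Sum>\<tau>\<in>X. \<Sum>\<sigma>\<in>X. f \<sigma> * g \<sigma>)"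
    by simp
  also have "\<dots> = (\<Sum>\<tau>\<in>X. \<Sum>\<sigma>\<in>X. f (mul \<sigma> \<tau>) * g \<sigma>)"
    by (intro sum.cong refl shift)
  also have "\<dots> = (\<Sum>\<sigma>\<in>X. \<Sum>\<tau>\<in>X. f (mul \<sigma> \<tau>) * g \<sigma>)"
    by (rule sum.swap)
  also have "\<dots> = (\<Sum>\<sigma>\<in>X. (\<Sum>\<tau>\<in>X. f \<tau>) * g \<sigma>)"
  proof (rule sum.cong[OF refl])
    fix \<sigma> assume "\<sigma> \<in> X"
    then show "(\<Sum>\<tau>\<in>X. f (mul \<sigma> \<tau>) * g \<sigma>) = (\<Sum>\<tau>\<in>X. f \<tau>) * g \<sigma>"
      using sum_mul[of \<sigma> f] by (simp add: sum_distrib_right[symmetric])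
  qed
  finally show ?thesis
    by (simp add: sum_distrib_left)
qed


definition on :: "'e set \<Rightarrow> ('e \<Rightarrow> real) \<Rightarrow> 'e \<Rightarrow> real" where
  "on S a e = (if e \<in> S then a e else 0)"

definition corr :: "('e \<Rightarrow> real) \<Rightarrow> ('e \<Rightarrow> real) \<Rightarrow> real" where
  "corr J a = (\<Sum>\<sigma>\<in>X. gibbs J \<sigma> * observable a \<sigma>)"

lemma observable_0: "observable (\<lambda>_. 0) \<sigma> = 1"
  by (simp add: observable_def)

lemma corr_0: "corr J (\<lambda>_. 0) = (\<Sum>\<sigma>\<in>X. gibbs J \<sigma>)"
  by (simp add: corr_def observable_0)

lemma corr_pos:
  assumes a: "\<And>e. e \<in> E \<Longrightarrow> -1 < a e \<and> a e \<le> 1" shows "0 < corr J a"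
proof -
  have nonneg: "0 \<le> gibbs J \<sigma> * observable a \<sigma>" if "\<sigma> \<in> X" for \<sigma>
    unfolding observable_def gibbs_def
  proof (intro mult_nonneg_nonneg prod_nonneg)
    fix e assume "e \<in> E"
    then show "0 \<le> 1 + a e * s \<sigma> e"
      using a[of e] sign[OF that, of e] by auto
  qed simp
  obtain \<iota> where \<iota>: "\<iota> \<in> X" "\<forall>e\<in>E. s \<iota> e = 1"
    using unit_exists by blast
  have "0 < gibbs J \<iota> * observable a \<iota>"
    unfolding observable_def gibbs_def
    by (intro mult_pos_pos prod_pos) (use \<iota>(2) a in fastforce)+
  then show ?thesis
    unfolding corr_def using \<iota>(1) nonneg finite_X by (intro sum_pos2[where i = \<iota>]) auto
qed

lemma corr_0_pos: "0 < corr J (\<lambda>_. 0)"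
  by (rule corr_pos) simp

lemma observable_add:
  assumes "\<And>e. e \<in> E \<Longrightarrow> a e = 0 \<or> b e = 0"
  shows "observable (\<lambda>e. a e + b e) \<sigma> = observable a \<sigma> * observable b \<sigma>"
  unfolding observable_def prod.distrib[symmetric]
  by (rule prod.cong[OF refl]) (use assms in force)

lemma gibbs_add: "gibbs (\<lambda>e. J e + K e) \<sigma> = gibbs J \<sigma> * gibbs K \<sigma>"
  by (simp add: gibbs_def exp_add sum.distrib distrib_right)

lemma gibbs_split: "gibbs J \<sigma> = gibbs (on C J) \<sigma> * gibbs (on (- C) J) \<sigma>"
proof -
  have "J = (\<lambda>e. on C J e + on (- C) J e)"
    by (auto simp: on_def)
  then show ?thesis
    using gibbs_add[of "on C J" "on (- C) J" \<sigma>] by simp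
qed

text \<open>The high-temperature expansion. It turns a change of coupling into an observable, so
  that monotonicity in the coupling becomes a correlation inequality.\<close>

lemma gibbs_tanh:
  assumes "\<sigma> \<in> X"
  shows "gibbs K \<sigma> = (\<Prod>e\<in>E. cosh (K e)) * observable (\<lambda>e. tanh (K e)) \<sigma>"
proof -
  have "exp (K e * s \<sigma> e) = cosh (K e) * (1 + tanh (K e) * s \<sigma> e)" if "e \<in> E" for e
  proof -
    have "cosh (K e) * (1 + tanh (K e) * s \<sigma> e) = cosh (K e) + sinh (K e) * s \<sigma> e"
      by (simp add: tanh_def field_simps)
    then show ?thesis
      using sign[OF assms that] by (auto simp: cosh_plus_sinh cosh_minus_sinh)
  qed
  then show ?thesis
    unfolding gibbs_def observable_def prod.distrib[symmetric]
    by (simp add: exp_sum finite_E cong: prod.cong)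
qed

lemma circuit_class_neg:
  "circuit_class (neg ` X) e \<subseteq> E"
  "e \<in> E \<Longrightarrow> e \<in> circuit_class (neg ` X) e"
  "f \<in> circuit_class (neg ` X) e \<Longrightarrow> circuit_class (neg ` X) f = circuit_class (neg ` X) e"
  "\<tau> \<in> X \<Longrightarrow> neg \<tau> \<inter> circuit_class (neg ` X) e \<in> neg ` X"
proof -
  show "circuit_class (neg ` X) e \<subseteq> E"
    by (auto simp: circuit_class_def circuit_def neg_def)
  show "f \<in> circuit_class (neg ` X) e \<Longrightarrow> circuit_class (neg ` X) f = circuit_class (neg ` X) e"
    by (rule circuit_class_eq[OF symdiff_closed_neg finite_neg])
  show "\<tau> \<in> X \<Longrightarrow> neg \<tau> \<inter> circuit_class (neg ` X) e \<in> neg ` X"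
    by (rule circuit_class_separates[OF symdiff_closed_neg finite_neg]) auto
  assume e: "e \<in> E"
  then obtain \<sigma> where \<sigma>: "\<sigma> \<in> X" "s \<sigma> e = -1"
    using s_nontrivial by blast
  then have "\<exists>C. circuit (neg ` X) C \<and> e \<in> C \<and> C \<subseteq> neg \<sigma>"
    using e by (intro circuit_exists[OF symdiff_closed_neg] finite_neg) (auto simp: neg_def)
  then show "e \<in> circuit_class (neg ` X) e"
    by (auto simp: circuit_class_def)
qed

lemma corr_separated:
  fixes J a b :: "'e \<Rightarrow> real" and x :: 'e
  defines "C \<equiv> circuit_class (neg ` X) x"
  assumes a: "\<And>e. e \<in> E - C \<Longrightarrow> a e = 0" and b: "\<And>e. e \<in> C \<Longrightarrow> b e = 0"
  shows "corr J (\<lambda>e. a e + b e) * card X = corr (on C J) a * corr (on (- C) J) b"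
proof -
  have CE: "C \<subseteq> E"
    unfolding C_def by (rule circuit_class_neg)
  have "corr J (\<lambda>e. a e + b e)
      = (\<Sum>\<sigma>\<in>X. (gibbs (on C J) \<sigma> * observable a \<sigma>) * (gibbs (on (- C) J) \<sigma> * observable b \<sigma>))"
    unfolding corr_def
  proof (rule sum.cong[OF refl])
    fix \<sigma>
    have "observable (\<lambda>e. a e + b e) \<sigma> = observable a \<sigma> * observable b \<sigma>"
      by (rule observable_add) (use a b in blast)
    then show "gibbs J \<sigma> * observable (\<lambda>e. a e + b e) \<sigma>
        = (gibbs (on C J) \<sigma> * observable a \<sigma>) * (gibbs (on (- C) J) \<sigma> * observable b \<sigma>)"
      using gibbs_split[of J \<sigma> C] by simp
  qed
  moreover have "(\<Sum>\<sigma>\<in>X. (gibbs (on C J) \<sigma> * observable a \<sigma>) * (gibbs (on (- C) J) \<sigma> * observable b \<sigma>)) * card X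
      = corr (on C J) a * corr (on (- C) J) b"
    unfolding corr_def
  proof (rule sum_separated[where C = C])
    show "\<tau> \<in> X \<Longrightarrow> neg \<tau> \<inter> C \<in> neg ` X" for \<tau>
      unfolding C_def by (rule circuit_class_neg)
    fix \<sigma> \<tau> assume "\<sigma> \<in> X" "\<tau> \<in> X"
    {
      assume eq: "\<And>e. e \<in> E \<inter> C \<Longrightarrow> s \<sigma> e = s \<tau> e"
      have "gibbs (on C J) \<sigma> = gibbs (on C J) \<tau>"
        unfolding gibbs_def by (intro arg_cong[where f = exp] sum.cong) (auto simp: on_def eq)
      moreover have "observable a \<sigma> = observable a \<tau>"
        unfolding observable_def by (rule prod.cong[OF refl]) (metis Diff_iff IntI a eq mult_zero_left)
      ultimately show "gibbs (on C J) \<sigma> * observable a \<sigma> = gibbs (on C J) \<tau> * observable a \<tau>"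
        by simp
    next
      assume eq: "\<And>e. e \<in> E - C \<Longrightarrow> s \<sigma> e = s \<tau> e"
      have "gibbs (on (- C) J) \<sigma> = gibbs (on (- C) J) \<tau>"
        unfolding gibbs_def by (intro arg_cong[where f = exp] sum.cong) (auto simp: on_def eq)
      moreover have "observable b \<sigma> = observable b \<tau>"
        unfolding observable_def by (rule prod.cong[OF refl]) (metis Diff_iff b eq mult_zero_left)
      ultimately show "gibbs (on (- C) J) \<sigma> * observable b \<sigma> = gibbs (on (- C) J) \<tau> * observable b \<tau>"
        by simp
    }
  qed
  ultimately show ?thesis by simp
qed

text \<open>The other classes contribute the same factor to numerator and denominator. This covers a
  class on which two couplings agree, where no strict inequality is available.\<close>

lemma corr_ratio_local:
  fixes J a :: "'e \<Rightarrow> real" and x :: 'e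
  defines "C \<equiv> circuit_class (neg ` X) x"
  assumes a: "\<And>e. e \<in> E - C \<Longrightarrow> a e = 0"
  shows "corr J a / corr J (\<lambda>_. 0) = corr (on C J) a / corr (on C J) (\<lambda>_. 0)"
proof -
  have card: "0 < real (card X)"
    using finite_X X_nonempty by (simp add: card_gt_0_iff)
  have "corr J a * card X = corr (on C J) a * corr (on (- C) J) (\<lambda>_. 0)"
    using corr_separated[of x a "\<lambda>_. 0" J] a by (simp add: C_def)
  moreover have "corr J (\<lambda>_. 0) * card X = corr (on C J) (\<lambda>_. 0) * corr (on (- C) J) (\<lambda>_. 0)"
    using corr_separated[of x "\<lambda>_. 0" "\<lambda>_. 0" J] by (simp add: C_def)
  ultimately have "(corr J a * card X) / (corr J (\<lambda>_. 0) * card X)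
      = (corr (on C J) a * corr (on (- C) J) (\<lambda>_. 0)) / (corr (on C J) (\<lambda>_. 0) * corr (on (- C) J) (\<lambda>_. 0))"
    by simp
  then show ?thesis
    using card corr_0_pos[of "on (- C) J"] by simp
qed

lemma corr_factor:
  fixes J a b :: "'e \<Rightarrow> real" and x :: 'e
  defines "C \<equiv> circuit_class (neg ` X) x"
  assumes a: "\<And>e. e \<in> E - C \<Longrightarrow> a e = 0" and b: "\<And>e. e \<in> C \<Longrightarrow> b e = 0"
  shows "corr J (\<lambda>e. a e + b e) * corr J (\<lambda>_. 0) = corr J a * corr J b"
proof -
  have card: "0 < real (card X)"
    using finite_X X_nonempty by (simp add: card_gt_0_iff)
  have "corr J (\<lambda>e. a e + b e) * card X = corr (on C J) a * corr (on (- C) J) b"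
    using corr_separated[of x a b J] a b by (simp add: C_def)
  moreover have "corr J (\<lambda>_. 0) * card X = corr (on C J) (\<lambda>_. 0) * corr (on (- C) J) (\<lambda>_. 0)"
    using corr_separated[of x "\<lambda>_. 0" "\<lambda>_. 0" J] by (simp add: C_def)
  moreover have "corr J a * card X = corr (on C J) a * corr (on (- C) J) (\<lambda>_. 0)"
    using corr_separated[of x a "\<lambda>_. 0" J] a by (simp add: C_def)
  moreover have "corr J b * card X = corr (on C J) (\<lambda>_. 0) * corr (on (- C) J) b"
    using corr_separated[of x "\<lambda>_. 0" b J] b by (simp add: C_def)
  ultimately have "(corr J (\<lambda>e. a e + b e) * card X) * (corr J (\<lambda>_. 0) * card X)
      = (corr J a * card X) * (corr J b * card X)"
    by simp
  then show ?thesis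
    using card by simp
qed

text \<open>
  The observable \<open>\<Prod>e\<in>S. \<alpha> e (1 + r e s e)\<close> covers both \<open>p \<xi>\<close> (with \<open>r = 1\<close>) and \<open>1 - p \<xi>\<close>
  (with \<open>r = -p / (2 - p)\<close>), that is, presence and absence of the edges of \<open>S\<close>.
\<close>
definition represents :: "'e set pmf \<Rightarrow> ('e \<Rightarrow> real) \<Rightarrow> ('e \<Rightarrow> real) \<Rightarrow> ('e \<Rightarrow> real) \<Rightarrow> bool" where
  "represents \<mu> J \<alpha> r \<longleftrightarrow> (\<forall>S\<subseteq>E. measure_pmf.prob \<mu> {\<omega>. S \<subseteq> \<omega>}
     = (\<Prod>e\<in>S. \<alpha> e) * (corr J (on S r) / corr J (\<lambda>_. 0)))"

lemma prod_observable:
  assumes "S \<subseteq> E"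
  shows "(\<Prod>e\<in>S. \<alpha> e) * observable (on S r) \<sigma> = (\<Prod>e\<in>S. \<alpha> e * (1 + r e * s \<sigma> e))"
proof -
  have "observable (on S r) \<sigma> = (\<Prod>e\<in>E. if e \<in> S then 1 + r e * s \<sigma> e else 1)"
    unfolding observable_def by (rule prod.cong) (auto simp: on_def)
  also have "\<dots> = (\<Prod>e\<in>S. 1 + r e * s \<sigma> e)"
    using finite_E assms by (simp add: prod.If_cases Int_absorb1)
  finally show ?thesis
    by (simp add: prod.distrib)
qed

lemma representsI:
  assumes "\<And>S. S \<subseteq> E \<Longrightarrow> measure_pmf.prob \<mu> {\<omega>. S \<subseteq> \<omega>}
    = (\<Sum>\<sigma>\<in>X. gibbs J \<sigma> / (\<Sum>\<tau>\<in>X. gibbs J \<tau>) * (\<Prod>e\<in>S. \<alpha> e * (1 + r e * s \<sigma> e)))"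
  shows "represents \<mu> J \<alpha> r"
  unfolding represents_def
proof (intro allI impI)
  fix S assume S: "S \<subseteq> E"
  show "measure_pmf.prob \<mu> {\<omega>. S \<subseteq> \<omega>} = (\<Prod>e\<in>S. \<alpha> e) * (corr J (on S r) / corr J (\<lambda>_. 0))"
    unfolding assms[OF S] prod_observable[OF S, symmetric] corr_0 corr_def[of J "on S r"]
      sum_distrib_left sum_divide_distrib
    by (rule sum.cong[OF refl]) simp
qed

text \<open>Edges with \<open>r e = 0\<close> are independent of everything else.\<close>
definition edge_class :: "('e \<Rightarrow> real) \<Rightarrow> 'e \<Rightarrow> 'e set" where
  "edge_class r e = (if r e = 0 then {e} else {f \<in> circuit_class (neg ` X) e. r f \<noteq> 0})"

lemma edge_class_self: "e \<in> E \<Longrightarrow> e \<in> edge_class r e"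
  using circuit_class_neg(2) by (simp add: edge_class_def)

lemma edge_class_subset: "e \<in> E \<Longrightarrow> edge_class r e \<subseteq> E"
  using circuit_class_neg(1) by (auto simp: edge_class_def)

lemma edge_class_eq: "f \<in> edge_class r e \<Longrightarrow> edge_class r f = edge_class r e"
  using circuit_class_neg(3)[of f e] by (auto simp: edge_class_def split: if_splits)

lemma Union_edge_class: "\<Union>(edge_class r ` E) = E"
  using edge_class_self edge_class_subset by blast

lemma disjoint_edge_class: "disjoint (edge_class r ` E)"
  unfolding pairwise_def disjnt_def using edge_class_eq by blast

lemma on_Un: "S \<inter> T = {} \<Longrightarrow> on (S \<union> T) r = (\<lambda>e. on S r e + on T r e)"
  by (auto simp: on_def fun_eq_iff)

lemma on_zero: "(\<And>e. e \<in> S \<Longrightarrow> r e = 0) \<Longrightarrow> on S r = (\<lambda>_. 0)"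
  by (auto simp: on_def fun_eq_iff)

lemma independent_edge_class:
  assumes rep: "represents \<mu> J \<alpha> r" and e: "e \<in> E"
  shows "independent_of \<mu> (edge_class r e) (E - edge_class r e)"
  unfolding independent_of_def
proof (intro allI impI)
  fix S T assume S: "S \<subseteq> edge_class r e" and T: "T \<subseteq> E - edge_class r e"
  have SE: "S \<subseteq> E" and TE: "T \<subseteq> E" and disj: "S \<inter> T = {}"
    using S T edge_class_subset[OF e] by auto
  have fin: "finite S" "finite T"
    using SE TE finite_E finite_subset by auto
  have key: "corr J (on (S \<union> T) r) * corr J (\<lambda>_. 0) = corr J (on S r) * corr J (on T r)"
  proof (cases "r e = 0")
    case True
    then have "on S r = (\<lambda>_. 0)"
      using S by (intro on_zero) (auto simp: edge_class_def)
    then show ?thesis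
      unfolding on_Un[OF disj] by simp
  next
    case False
    have "on S r f = 0" if "f \<in> E - circuit_class (neg ` X) e" for f
      using S that False by (auto simp: on_def edge_class_def)
    moreover have "on T r f = 0" if "f \<in> circuit_class (neg ` X) e" for f
      using T that False by (auto simp: on_def edge_class_def)
    ultimately show ?thesis
      unfolding on_Un[OF disj] by (rule corr_factor)
  qed
  have "corr J (on (S \<union> T) r) / corr J (\<lambda>_. 0)
      = (corr J (on S r) / corr J (\<lambda>_. 0)) * (corr J (on T r) / corr J (\<lambda>_. 0))"
    using key corr_0_pos[of J] by (simp add: field_simps)
  then show "measure_pmf.prob \<mu> {\<omega>. S \<union> T \<subseteq> \<omega>}
      = measure_pmf.prob \<mu> {\<omega>. S \<subseteq> \<omega>} * measure_pmf.prob \<mu> {\<omega>. T \<subseteq> \<omega>}"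
    using rep SE TE fin disj
    by (simp only: represents_def Un_least prod.union_disjoint) (simp add: mult_ac)
qed

section \<open>Thinning of laws given by edge signs\<close>

lemma common_circuit:
  assumes "f \<in> circuit_class (neg ` X) e" "g \<in> circuit_class (neg ` X) e"
  obtains M where "circuit (neg ` X) M" "f \<in> M" "g \<in> M"
  using assms circuit_class_neg(3)[OF assms(1)] by (auto simp: circuit_class_def)

lemma FKG_thinning:
  assumes \<mu>: "finite (set_pmf \<mu>)" and rep: "represents \<mu> J \<alpha> r" and \<gamma>: "\<gamma> = 1 \<or> \<gamma> = -1"
    and J: "\<And>e. e \<in> E \<Longrightarrow> 0 < J e"
    and r: "\<And>e. e \<in> E \<Longrightarrow> 0 \<le> \<gamma> * r e \<and> -1 < r e \<and> r e \<le> 1"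
    and \<alpha>: "\<And>e. e \<in> E \<Longrightarrow> r e \<noteq> 0 \<Longrightarrow> 0 < \<alpha> e"
    and coupling: "\<And>e. e \<in> E \<Longrightarrow> exp (-2 * J e) * (1 - r e) < exp (2 * J e) * (1 + r e)"
  shows "\<exists>a\<in>E \<rightarrow> {0<..1}. FKG E (inter_pmf \<mu> (Ber E a))"
proof -
  have "\<exists>a\<in>\<Union>(edge_class r ` E) \<rightarrow> {0<..1}. FKG (\<Union>(edge_class r ` E)) (inter_pmf \<mu> (Ber (\<Union>(edge_class r ` E)) a))"
  proof (rule FKG_thinning_classes)
    show "finite (edge_class r ` E)"
      using finite_E by simp
    show "C \<in> edge_class r ` E \<Longrightarrow> finite C" for C
      using edge_class_subset finite_E by (auto intro: finite_subset)
    show "C \<in> edge_class r ` E \<Longrightarrow> independent_of \<mu> C (\<Union>(edge_class r ` E) - C)" for C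
      unfolding Union_edge_class using independent_edge_class[OF rep] by blast
    fix C assume "C \<in> edge_class r ` E"
    then obtain e where e: "e \<in> E" and C: "C = edge_class r e" by blast
    show "\<exists>a\<in>C \<rightarrow> {0<..1}. FKG C (inter_pmf \<mu> (Ber C a))"
    proof (cases "r e = 0")
      case True
      then have "FKG C (inter_pmf \<mu> (Ber C (\<lambda>_. 1)))"
        unfolding C edge_class_def by (simp add: FKG_singleton set_pmf_inter)
      then show ?thesis
        by (intro bexI[of _ "\<lambda>_. 1"]) auto
    next
      case False
      then have C': "f \<in> circuit_class (neg ` X) e" "r f \<noteq> 0" "f \<in> E" if "f \<in> C" for f
        using that edge_class_subset[OF e, of r] unfolding C by (auto simp: edge_class_def)
      have prob: "measure_pmf.prob \<mu> {\<omega>. S \<subseteq> \<omega>} = (\<Prod>e\<in>S. \<alpha> e) * (corr J (on S r) / corr J (\<lambda>_. 0))"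
        if "S \<subseteq> C" for S
        using rep that C'(3) unfolding represents_def by blast
      have \<alpha>pos: "0 < (\<Prod>e\<in>S. \<alpha> e)" if "S \<subseteq> C" for S
        by (rule prod_pos) (use that C' \<alpha> in blast)
      have fin: "finite C"
        using C' finite_E by (meson finite_subset subsetI)
      have "\<exists>\<epsilon>. 0 < \<epsilon> \<and> \<epsilon> \<le> 1 \<and> FKG C (inter_pmf \<mu> (Ber C (\<lambda>_. \<epsilon>)))"
      proof (rule FKG_small_thinning[OF fin \<mu>])
        fix S assume S: "S \<subseteq> C"
        have "0 < corr J (on S r)"
          by (rule corr_pos) (use r in \<open>auto simp: on_def\<close>)
        then show "0 < measure_pmf.prob \<mu> {\<omega>. S \<subseteq> \<omega>}"
          unfolding prob[OF S] using \<alpha>pos[OF S] corr_0_pos[of J] by simp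
      next
        fix S T assume ST: "S \<subseteq> C" "T \<subseteq> C" "S \<noteq> {}" "T \<noteq> {}" "S \<inter> T = {}"
        then obtain f g where fg: "f \<in> S" "g \<in> T" by blast
        then obtain M where M: "circuit (neg ` X) M" "f \<in> M" "g \<in> M"
          using common_circuit C'(1) ST by (metis subsetD)
        have "0 < (\<gamma> * \<gamma>) * ((\<Sum>\<sigma>\<in>X. gibbs J \<sigma> * observable (on S r) \<sigma> * observable (on T r) \<sigma>) * (\<Sum>\<sigma>\<in>X. gibbs J \<sigma>)
            - (\<Sum>\<sigma>\<in>X. gibbs J \<sigma> * observable (on S r) \<sigma>) * (\<Sum>\<sigma>\<in>X. gibbs J \<sigma> * observable (on T r) \<sigma>))"
        proof (rule ginibre_strict[OF \<gamma> \<gamma> _ _ _ M(1,2) _ M(3)])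
          show "0 \<le> \<gamma> * on S r e" "0 \<le> \<gamma> * on T r e" if "e \<in> E" for e
            using r[OF that] by (auto simp: on_def)
          show "on S r f \<noteq> 0" "on T r g \<noteq> 0"
            using fg ST C' by (auto simp: on_def)
          fix e assume e: "e \<in> E"
          \<comment> \<open>As \<open>S\<close> and \<open>T\<close> are disjoint, at most one of
            the two observables involves \<open>e\<close>: the requirement is
            \<open>coupling\<close> on \<open>S \<union> T\<close> and this bare inequality
            elsewhere.\<close>
          have "exp (- 2 * J e) < exp (2 * J e)"
            using J[OF e] by simp
          then show "0 \<le> exp (-2 * J e) * (1 - on S r e) * (1 - on T r e) \<and>
              exp (-2 * J e) * (1 - on S r e) * (1 - on T r e)
              < exp (2 * J e) * (1 + on S r e) * (1 + on T r e)"
            using r[OF e] coupling[OF e] ST(5) by (auto simp: on_def)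
        qed
        moreover have "\<gamma> * \<gamma> = 1"
          using \<gamma> by auto
        moreover have "observable (on (S \<union> T) r) \<sigma> = observable (on S r) \<sigma> * observable (on T r) \<sigma>" for \<sigma>
          unfolding on_Un[OF ST(5)] by (rule observable_add) (use ST(5) in \<open>auto simp: on_def\<close>)
        ultimately have "corr J (on S r) * corr J (on T r) < corr J (on (S \<union> T) r) * corr J (\<lambda>_. 0)"
          by (simp add: corr_def observable_0 mult.assoc)
        then have "(corr J (on S r) / corr J (\<lambda>_. 0)) * (corr J (on T r) / corr J (\<lambda>_. 0))
            < corr J (on (S \<union> T) r) / corr J (\<lambda>_. 0)"
          using corr_0_pos[of J] by (simp add: field_simps)
        then have "((\<Prod>e\<in>S. \<alpha> e) * (\<Prod>e\<in>T. \<alpha> e)) * ((corr J (on S r) / corr J (\<lambda>_. 0)) * (corr J (on T r) / corr J (\<lambda>_. 0)))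
            < ((\<Prod>e\<in>S. \<alpha> e) * (\<Prod>e\<in>T. \<alpha> e)) * (corr J (on (S \<union> T) r) / corr J (\<lambda>_. 0))"
          using \<alpha>pos[OF ST(1)] \<alpha>pos[OF ST(2)] by (intro mult_strict_left_mono mult_pos_pos)
        moreover have "(\<Prod>e\<in>S \<union> T. \<alpha> e) = (\<Prod>e\<in>S. \<alpha> e) * (\<Prod>e\<in>T. \<alpha> e)"
          using ST fin by (intro prod.union_disjoint) (auto intro: finite_subset)
        ultimately show "measure_pmf.prob \<mu> {\<omega>. S \<subseteq> \<omega>} * measure_pmf.prob \<mu> {\<omega>. T \<subseteq> \<omega>}
            < measure_pmf.prob \<mu> {\<omega>. S \<union> T \<subseteq> \<omega>}"
          unfolding prob[OF ST(1)] prob[OF ST(2)] prob[OF Un_least[OF ST(1,2)]]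
          by (simp only: mult_ac)
      qed
      then obtain \<epsilon> where "0 < \<epsilon>" "\<epsilon> \<le> 1" "FKG C (inter_pmf \<mu> (Ber C (\<lambda>_. \<epsilon>)))" by blast
      then show ?thesis
        by (intro bexI[of _ "\<lambda>_. \<epsilon>"]) auto
    qed
  qed (use \<mu> disjoint_edge_class in auto)
  then show ?thesis
    unfolding Union_edge_class .
qed

text \<open>Raising the coupling multiplies the Gibbs weight by an observable with coefficients
  \<open>tanh (J' e - J e)\<close>, so the claim is a strict correlation between that observable and
  \<open>S\<close>, transmitted by a circuit through an edge of \<open>S\<close> and the changed
  edge \<open>g\<close>. Here \<open>\<gamma>\<close> occurs only once, which reverses the direction
  for closed edges.\<close>

lemma represented_strict:
  assumes rep: "represents \<mu> J \<alpha> r" "represents \<nu> J' \<alpha> r" and \<gamma>: "\<gamma> = 1 \<or> \<gamma> = -1"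
    and J: "\<And>e. e \<in> E \<Longrightarrow> 0 < J e \<and> J e \<le> J' e"
    and r: "\<And>e. e \<in> E \<Longrightarrow> 0 \<le> \<gamma> * r e \<and> -1 < r e \<and> r e \<le> 1"
    and \<alpha>: "\<And>e. e \<in> E \<Longrightarrow> r e \<noteq> 0 \<Longrightarrow> 0 < \<alpha> e"
    and coupling: "\<And>e. e \<in> E \<Longrightarrow> exp (-2 * J e) * (1 - r e) < exp (2 * J e) * (1 + r e)"
    and e: "e \<in> E" "r e \<noteq> 0" and g: "g \<in> circuit_class (neg ` X) e" "J g < J' g"
    and S: "S \<subseteq> edge_class r e" "S \<noteq> {}"
  shows "\<gamma> * measure_pmf.prob \<mu> {\<omega>. S \<subseteq> \<omega>} < \<gamma> * measure_pmf.prob \<nu> {\<omega>. S \<subseteq> \<omega>}"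
proof -
  obtain f where f: "f \<in> S" using S by blast
  have SC: "h \<in> circuit_class (neg ` X) e" "r h \<noteq> 0" "h \<in> E" if "h \<in> S" for h
    using that S edge_class_subset[OF e(1), of r] e(2) by (auto simp: edge_class_def)
  obtain M where M: "circuit (neg ` X) M" "f \<in> M" "g \<in> M"
    using common_circuit[OF SC(1)[OF f] g(1)] .
  define a b where "a = on S r" and "b = (\<lambda>e. tanh (J' e - J e))"
  define K where "K = (\<Prod>e\<in>E. cosh (J' e - J e))"
  have K: "0 < K"
    unfolding K_def by (rule prod_pos) simp
  have b: "0 \<le> b e" "b e < 1" if "e \<in> E" for e
    using J[OF that] tanh_real_lt_1 by (auto simp: b_def)
  have gibbs: "gibbs J' \<sigma> = K * (gibbs J \<sigma> * observable b \<sigma>)" if "\<sigma> \<in> X" for \<sigma>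
    using gibbs_add[of J "\<lambda>e. J' e - J e" \<sigma>] gibbs_tanh[OF that, of "\<lambda>e. J' e - J e"]
    by (simp add: K_def b_def)
  have corr: "corr J' c = K * (\<Sum>\<sigma>\<in>X. gibbs J \<sigma> * observable c \<sigma> * observable b \<sigma>)" for c
    unfolding corr_def sum_distrib_left by (rule sum.cong[OF refl]) (simp add: gibbs mult_ac)
  have "0 < (\<gamma> * 1) * ((\<Sum>\<sigma>\<in>X. gibbs J \<sigma> * observable a \<sigma> * observable b \<sigma>) * (\<Sum>\<sigma>\<in>X. gibbs J \<sigma>)
        - (\<Sum>\<sigma>\<in>X. gibbs J \<sigma> * observable a \<sigma>) * (\<Sum>\<sigma>\<in>X. gibbs J \<sigma> * observable b \<sigma>))"
  proof (rule ginibre_strict[OF \<gamma> _ _ _ _ M(1,2) _ M(3)])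
    show "0 \<le> \<gamma> * a e" "0 \<le> 1 * b e" if "e \<in> E" for e
      using r[OF that] b[OF that] by (auto simp: a_def on_def)
    show "a f \<noteq> 0" "b g \<noteq> 0"
      using f SC g by (auto simp: a_def b_def on_def)
    fix e assume e: "e \<in> E"
    have "exp (- 2 * J e) < exp (2 * J e)"
      using J[OF e] by simp
    then have lt: "exp (-2 * J e) * (1 - a e) < exp (2 * J e) * (1 + a e)"
      and nn: "0 \<le> exp (-2 * J e) * (1 - a e)"
      using r[OF e] coupling[OF e] by (auto simp: a_def on_def)
    have "exp (-2 * J e) * (1 - a e) * (1 - b e) \<le> exp (-2 * J e) * (1 - a e) * (1 + b e)"
      using nn b[OF e] by (intro mult_left_mono) auto
    also have "\<dots> < exp (2 * J e) * (1 + a e) * (1 + b e)"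
      using lt b[OF e] by (intro mult_strict_right_mono) auto
    finally show "0 \<le> exp (-2 * J e) * (1 - a e) * (1 - b e) \<and>
        exp (-2 * J e) * (1 - a e) * (1 - b e) < exp (2 * J e) * (1 + a e) * (1 + b e)"
      using nn b[OF e] by simp
  qed simp
  then have "\<gamma> * (corr J a * (K * (\<Sum>\<sigma>\<in>X. gibbs J \<sigma> * observable b \<sigma>)))
      < \<gamma> * (K * (\<Sum>\<sigma>\<in>X. gibbs J \<sigma> * observable a \<sigma> * observable b \<sigma>) * corr J (\<lambda>_. 0))"
  proof -
    assume "0 < (\<gamma> * 1) * ((\<Sum>\<sigma>\<in>X. gibbs J \<sigma> * observable a \<sigma> * observable b \<sigma>) * (\<Sum>\<sigma>\<in>X. gibbs J \<sigma>)
        - (\<Sum>\<sigma>\<in>X. gibbs J \<sigma> * observable a \<sigma>) * (\<Sum>\<sigma>\<in>X. gibbs J \<sigma> * observable b \<sigma>))"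
    from mult_pos_pos[OF K this] show ?thesis
      by (simp add: corr_0 corr_def algebra_simps)
  qed
  then have lt: "\<gamma> * (corr J a * corr J' (\<lambda>_. 0)) < \<gamma> * (corr J' a * corr J (\<lambda>_. 0))"
    by (simp add: corr observable_0)
  have "\<gamma> * (corr J a / corr J (\<lambda>_. 0)) < \<gamma> * (corr J' a / corr J' (\<lambda>_. 0))"
    using lt corr_0_pos[of J] corr_0_pos[of J'] by (simp add: field_simps)
  moreover have "0 < (\<Prod>e\<in>S. \<alpha> e)"
    by (rule prod_pos) (use SC \<alpha> in blast)
  ultimately have "(\<Prod>e\<in>S. \<alpha> e) * (\<gamma> * (corr J a / corr J (\<lambda>_. 0))) < (\<Prod>e\<in>S. \<alpha> e) * (\<gamma> * (corr J' a / corr J' (\<lambda>_. 0)))"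
    by (rule mult_strict_left_mono)
  moreover have "S \<subseteq> E"
    using SC by blast
  ultimately show ?thesis
    using rep by (simp only: represents_def a_def[symmetric] mult_ac)
qed

lemma stoch_dom_thinning:
  assumes \<mu>: "finite (set_pmf \<mu>)" and \<nu>: "finite (set_pmf \<nu>)"
    and rep: "represents \<mu> J \<alpha> r" "represents \<nu> J' \<alpha> r" and \<gamma>: "\<gamma> = 1 \<or> \<gamma> = -1"
    and J: "\<And>e. e \<in> E \<Longrightarrow> 0 < J e \<and> J e \<le> J' e"
    and r: "\<And>e. e \<in> E \<Longrightarrow> 0 \<le> \<gamma> * r e \<and> -1 < r e \<and> r e \<le> 1"
    and \<alpha>: "\<And>e. e \<in> E \<Longrightarrow> r e \<noteq> 0 \<Longrightarrow> 0 < \<alpha> e"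
    and coupling: "\<And>e. e \<in> E \<Longrightarrow> exp (-2 * J e) * (1 - r e) < exp (2 * J e) * (1 + r e)"
  defines "\<mu>' \<equiv> if \<gamma> = 1 then \<mu> else \<nu>" and "\<nu>' \<equiv> if \<gamma> = 1 then \<nu> else \<mu>"
  shows "\<exists>a\<in>E \<rightarrow> {0<..1}. stoch_dom E (inter_pmf \<mu>' (Ber E a)) (inter_pmf \<nu>' (Ber E a))"
proof -
  have fin: "finite (set_pmf \<mu>')" "finite (set_pmf \<nu>')"
    using \<mu> \<nu> by (auto simp: \<mu>'_def \<nu>'_def)
  have "\<exists>a\<in>\<Union>(edge_class r ` E) \<rightarrow> {0<..1}. stoch_dom (\<Union>(edge_class r ` E))
      (inter_pmf \<mu>' (Ber (\<Union>(edge_class r ` E)) a)) (inter_pmf \<nu>' (Ber (\<Union>(edge_class r ` E)) a))"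
  proof (rule stoch_dom_thinning_classes)
    show "finite (edge_class r ` E)"
      using finite_E by simp
    show "C \<in> edge_class r ` E \<Longrightarrow> finite C" for C
      using edge_class_subset finite_E by (auto intro: finite_subset)
    have "independent_of \<rho> C (\<Union>(edge_class r ` E) - C)" if "\<rho> = \<mu> \<or> \<rho> = \<nu>" "C \<in> edge_class r ` E" for C \<rho>
      unfolding Union_edge_class using independent_edge_class rep that by blast
    then show "C \<in> edge_class r ` E \<Longrightarrow> independent_of \<mu>' C (\<Union>(edge_class r ` E) - C)"
      "C \<in> edge_class r ` E \<Longrightarrow> independent_of \<nu>' C (\<Union>(edge_class r ` E) - C)" for C
      by (auto simp: \<mu>'_def \<nu>'_def)
    fix C assume "C \<in> edge_class r ` E"
    then obtain e where e: "e \<in> E" and C: "C = edge_class r e" by blast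
    have CE: "C \<subseteq> E"
      unfolding C by (rule edge_class_subset[OF e])
    have finC: "finite C"
      using CE finite_E finite_subset by blast
    show "\<exists>a\<in>C \<rightarrow> {0<..1}. stoch_dom C (inter_pmf \<mu>' (Ber C a)) (inter_pmf \<nu>' (Ber C a))"
    \<comment> \<open>The changed coupling is sought in the whole circuit class and not only in
      \<open>edge_class r e\<close>: an edge with \<open>r g = 0\<close> is absent from the
      observables, but its coupling still acts on the rest of its block. If nothing changes there,
      the two laws agree on \<open>C\<close>.\<close>
    proof (cases "r e = 0 \<or> (\<forall>g\<in>circuit_class (neg ` X) e. J g = J' g)")
      case True
      have eq: "measure_pmf.prob \<mu> {\<omega>. S \<subseteq> \<omega>} = measure_pmf.prob \<nu> {\<omega>. S \<subseteq> \<omega>}" if S: "S \<subseteq> C" for S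
      proof -
        have "corr J (on S r) / corr J (\<lambda>_. 0) = corr J' (on S r) / corr J' (\<lambda>_. 0)"
        proof (cases "r e = 0")
          case True
          then have "on S r = (\<lambda>_. 0)"
            using S unfolding C by (intro on_zero) (auto simp: edge_class_def)
          then show ?thesis
            using corr_0_pos[of J] corr_0_pos[of J'] by simp
        next
          case False
          let ?C = "circuit_class (neg ` X) e"
          have "on ?C J = on ?C J'"
            using True False by (auto simp: on_def fun_eq_iff)
          moreover have "on S r f = 0" if "f \<in> E - ?C" for f
            using S that False unfolding C by (auto simp: on_def edge_class_def)
          ultimately show ?thesis
            using corr_ratio_local[of e "on S r" J] corr_ratio_local[of e "on S r" J'] by simp
        qed
        moreover have "S \<subseteq> E" using S CE by blast
        ultimately show ?thesis
          using rep by (simp only: represents_def)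
      qed
      have "inter_pmf \<mu> (Ber C (\<lambda>_. 1)) = inter_pmf \<nu> (Ber C (\<lambda>_. 1))"
        by (rule pmf_eqI_prob_superset[OF finC])
           (auto simp: set_pmf_inter finC prob_inter_superset \<mu> \<nu> eq)
      then have "inter_pmf \<mu>' (Ber C (\<lambda>_. 1)) = inter_pmf \<nu>' (Ber C (\<lambda>_. 1))"
        by (simp add: \<mu>'_def \<nu>'_def)
      then show ?thesis
        by (intro bexI[of _ "\<lambda>_. 1"]) (auto simp: stoch_dom_refl)
    next
      case False
      then obtain g where g: "g \<in> circuit_class (neg ` X) e" "J g \<noteq> J' g" "r e \<noteq> 0" by blast
      then have "J g < J' g"
        using J[of g] circuit_class_neg(1)[of e] by force
      then have strict: "\<gamma> * measure_pmf.prob \<mu> {\<omega>. S \<subseteq> \<omega>} < \<gamma> * measure_pmf.prob \<nu> {\<omega>. S \<subseteq> \<omega>}"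
        if "S \<subseteq> C" "S \<noteq> {}" for S
        using represented_strict[OF rep \<gamma> J r \<alpha> coupling e g(3,1)] that unfolding C by blast
      have "\<exists>\<epsilon>. 0 < \<epsilon> \<and> \<epsilon> \<le> 1 \<and> stoch_dom C (inter_pmf \<mu>' (Ber C (\<lambda>_. \<epsilon>))) (inter_pmf \<nu>' (Ber C (\<lambda>_. \<epsilon>)))"
      proof (rule stoch_dom_small_thinning[OF finC fin])
        fix S assume "S \<subseteq> C" "S \<noteq> {}"
        then show "measure_pmf.prob \<mu>' {\<omega>. S \<subseteq> \<omega>} < measure_pmf.prob \<nu>' {\<omega>. S \<subseteq> \<omega>}"
          using strict[of S] \<gamma> by (auto simp: \<mu>'_def \<nu>'_def)
      qed
      then obtain \<epsilon> where "0 < \<epsilon>" "\<epsilon> \<le> 1"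
        "stoch_dom C (inter_pmf \<mu>' (Ber C (\<lambda>_. \<epsilon>))) (inter_pmf \<nu>' (Ber C (\<lambda>_. \<epsilon>)))" by blast
      then show ?thesis
        by (intro bexI[of _ "\<lambda>_. \<epsilon>"]) auto
    qed
  qed (use fin disjoint_edge_class in auto)
  then show ?thesis
    unfolding Union_edge_class .
qed

end

section \<open>The Ising energy field\<close>

text \<open>The witnesses of the two halves are unrelated. Complementation turns \<open>b\<close>
  into the density \<open>1 - b\<close>, and \<open>b < 1\<close> becomes positivity of the density,
  so both halves take the same form.\<close>

lemma weak_dagger_FKG_iff:
  assumes E: "finite E" and \<mu>: "set_pmf \<mu> \<subseteq> Pow E"
  shows "weak_dagger_FKG E \<mu> \<longleftrightarrow> (\<exists>a\<in>E \<rightarrow> {0<..1}. FKG E (inter_pmf \<mu> (Ber E a)))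
    \<and> (\<exists>a\<in>E \<rightarrow> {0<..1}. FKG E (inter_pmf (compl_pmf E \<mu>) (Ber E a)))"
proof -
  have "FKG E (union_pmf \<mu> (Ber E b)) \<longleftrightarrow> FKG E (inter_pmf (compl_pmf E \<mu>) (Ber E (\<lambda>e. 1 - b e)))"
    if "b \<in> E \<rightarrow> {0..1}" for b
  proof -
    have "set_pmf (union_pmf \<mu> (Ber E b)) \<subseteq> Pow E"
      using \<mu> E by (intro set_pmf_union set_pmf_Ber)
    then show ?thesis
      using FKG_compl compl_pmf_compl unfolding compl_pmf_union_Ber[OF E that, symmetric] by metis
  qed
  note union = this
  have "(\<exists>b\<in>E \<rightarrow> {0..<1}. FKG E (union_pmf \<mu> (Ber E b)))
    \<longleftrightarrow> (\<exists>a\<in>E \<rightarrow> {0<..1}. FKG E (inter_pmf (compl_pmf E \<mu>) (Ber E a)))"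
  proof
    assume "\<exists>b\<in>E \<rightarrow> {0..<1}. FKG E (union_pmf \<mu> (Ber E b))"
    then obtain b where b: "b \<in> E \<rightarrow> {0..<1}" "FKG E (union_pmf \<mu> (Ber E b))" by blast
    then have "b \<in> E \<rightarrow> {0..1}" by (auto simp: Pi_iff less_imp_le)
    then show "\<exists>a\<in>E \<rightarrow> {0<..1}. FKG E (inter_pmf (compl_pmf E \<mu>) (Ber E a))"
      using b union by (intro bexI[of _ "\<lambda>e. 1 - b e"]) auto
  next
    assume "\<exists>a\<in>E \<rightarrow> {0<..1}. FKG E (inter_pmf (compl_pmf E \<mu>) (Ber E a))"
    then obtain a where a: "a \<in> E \<rightarrow> {0<..1}" "FKG E (inter_pmf (compl_pmf E \<mu>) (Ber E a))" by blast
    then have "(\<lambda>e. 1 - a e) \<in> E \<rightarrow> {0..1}" by (auto simp: Pi_iff less_imp_le)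
    then show "\<exists>b\<in>E \<rightarrow> {0..<1}. FKG E (union_pmf \<mu> (Ber E b))"
      using a union[of "\<lambda>e. 1 - a e"] by (intro bexI[of _ "\<lambda>e. 1 - a e"]) auto
  qed
  then show ?thesis
    unfolding weak_dagger_FKG_def by blast
qed

lemma weak_dagger_dom_iff:
  assumes E: "finite E" and \<mu>: "set_pmf \<mu> \<subseteq> Pow E" and \<nu>: "set_pmf \<nu> \<subseteq> Pow E"
  shows "weak_dagger_dom E \<mu> \<nu> \<longleftrightarrow>
      (\<exists>a\<in>E \<rightarrow> {0<..1}. stoch_dom E (inter_pmf \<mu> (Ber E a)) (inter_pmf \<nu> (Ber E a)))
    \<and> (\<exists>a\<in>E \<rightarrow> {0<..1}. stoch_dom E (inter_pmf (compl_pmf E \<nu>) (Ber E a)) (inter_pmf (compl_pmf E \<mu>) (Ber E a)))"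
proof -
  have "stoch_dom E (union_pmf \<mu> (Ber E b)) (union_pmf \<nu> (Ber E b)) \<longleftrightarrow>
      stoch_dom E (inter_pmf (compl_pmf E \<nu>) (Ber E (\<lambda>e. 1 - b e))) (inter_pmf (compl_pmf E \<mu>) (Ber E (\<lambda>e. 1 - b e)))"
    if "b \<in> E \<rightarrow> {0..1}" for b
  proof -
    have supp: "set_pmf (union_pmf \<rho> (Ber E b)) \<subseteq> Pow E" if "\<rho> = \<mu> \<or> \<rho> = \<nu>" for \<rho>
      using that \<mu> \<nu> E by (intro set_pmf_union set_pmf_Ber) auto
    show ?thesis
      unfolding compl_pmf_union_Ber[OF E that, symmetric]
    proof
      assume "stoch_dom E (union_pmf \<mu> (Ber E b)) (union_pmf \<nu> (Ber E b))"
      then show "stoch_dom E (compl_pmf E (union_pmf \<nu> (Ber E b))) (compl_pmf E (union_pmf \<mu> (Ber E b)))"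
        by (intro stoch_dom_compl supp) auto
    next
      assume "stoch_dom E (compl_pmf E (union_pmf \<nu> (Ber E b))) (compl_pmf E (union_pmf \<mu> (Ber E b)))"
      from stoch_dom_compl[OF set_pmf_compl set_pmf_compl this]
      show "stoch_dom E (union_pmf \<mu> (Ber E b)) (union_pmf \<nu> (Ber E b))"
        by (simp add: compl_pmf_compl supp)
    qed
  qed
  note union = this
  have "(\<exists>b\<in>E \<rightarrow> {0..<1}. stoch_dom E (union_pmf \<mu> (Ber E b)) (union_pmf \<nu> (Ber E b)))
    \<longleftrightarrow> (\<exists>a\<in>E \<rightarrow> {0<..1}. stoch_dom E (inter_pmf (compl_pmf E \<nu>) (Ber E a)) (inter_pmf (compl_pmf E \<mu>) (Ber E a)))"
  proof
    assume "\<exists>b\<in>E \<rightarrow> {0..<1}. stoch_dom E (union_pmf \<mu> (Ber E b)) (union_pmf \<nu> (Ber E b))"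
    then obtain b where b: "b \<in> E \<rightarrow> {0..<1}" "stoch_dom E (union_pmf \<mu> (Ber E b)) (union_pmf \<nu> (Ber E b))"
      by blast
    then have "b \<in> E \<rightarrow> {0..1}" by (auto simp: Pi_iff less_imp_le)
    then show "\<exists>a\<in>E \<rightarrow> {0<..1}. stoch_dom E (inter_pmf (compl_pmf E \<nu>) (Ber E a)) (inter_pmf (compl_pmf E \<mu>) (Ber E a))"
      using b union by (intro bexI[of _ "\<lambda>e. 1 - b e"]) auto
  next
    assume "\<exists>a\<in>E \<rightarrow> {0<..1}. stoch_dom E (inter_pmf (compl_pmf E \<nu>) (Ber E a)) (inter_pmf (compl_pmf E \<mu>) (Ber E a))"
    then obtain a where a: "a \<in> E \<rightarrow> {0<..1}"
      "stoch_dom E (inter_pmf (compl_pmf E \<nu>) (Ber E a)) (inter_pmf (compl_pmf E \<mu>) (Ber E a))" by blast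
    then have "(\<lambda>e. 1 - a e) \<in> E \<rightarrow> {0..1}" by (auto simp: Pi_iff less_imp_le)
    then show "\<exists>b\<in>E \<rightarrow> {0..<1}. stoch_dom E (union_pmf \<mu> (Ber E b)) (union_pmf \<nu> (Ber E b))"
      using a union[of "\<lambda>e. 1 - a e"] by (intro bexI[of _ "\<lambda>e. 1 - a e"]) auto
  qed
  then show ?thesis
    unfolding weak_dagger_dom_def by blast
qed

section \<open>Spin configurations as a sign system\<close>

definition edge_sign :: "'v set set \<Rightarrow> ('v \<Rightarrow> int) \<Rightarrow> 'v set \<Rightarrow> real" where
  "edge_sign E \<sigma> e = (if e \<in> xi E \<sigma> then 1 else -1)"

definition spin_mul :: "'v set \<Rightarrow> ('v \<Rightarrow> int) \<Rightarrow> ('v \<Rightarrow> int) \<Rightarrow> 'v \<Rightarrow> int" where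
  "spin_mul V \<sigma> \<tau> = (\<lambda>x\<in>V. \<sigma> x * \<tau> x)"

lemma spins_cases: "\<sigma> \<in> spins V \<Longrightarrow> x \<in> V \<Longrightarrow> \<sigma> x = 1 \<or> \<sigma> x = -1"
  by (auto simp: spins_def PiE_iff)

lemma edge_sign_eq:
  assumes "\<sigma> \<in> spins V" "x \<in> V" "y \<in> V" "{x, y} \<in> E"
  shows "edge_sign E \<sigma> {x, y} = real_of_int (\<sigma> x * \<sigma> y)"
proof -
  have "{x, y} \<in> xi E \<sigma> \<longleftrightarrow> \<sigma> x = \<sigma> y"
    using assms(4) by (auto simp: xi_def)
  then show ?thesis
    using spins_cases[OF assms(1,2)] spins_cases[OF assms(1,3)] by (auto simp: edge_sign_def)
qed

text \<open>Spin configurations form a group under pointwise multiplication, and the negative edges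
  of a configuration form the cut between its two spin values.\<close>

lemma sign_system_ising:
  assumes G: "finite_graph V E"
  shows "sign_system (spins V) E (edge_sign E) (spin_mul V)"
proof
  have V: "finite V"
    using G by (simp add: finite_graph_def)
  show "finite (spins V)" "spins V \<noteq> {}" "finite E"
    using finite_spins[OF V] spins_nonempty finite_graph_finite_edges[OF G] by auto
  show "edge_sign E \<sigma> e = 1 \<or> edge_sign E \<sigma> e = -1" for \<sigma> e
    by (simp add: edge_sign_def)
  have closed: "spin_mul V \<sigma> \<tau> \<in> spins V" if "\<sigma> \<in> spins V" "\<tau> \<in> spins V" for \<sigma> \<tau>
  proof -
    have "\<sigma> x * \<tau> x \<in> {-1, 1}" if "x \<in> V" for x
      using spins_cases[OF \<open>\<sigma> \<in> spins V\<close> that] spins_cases[OF \<open>\<tau> \<in> spins V\<close> that] by auto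
    then show ?thesis
      unfolding spins_def spin_mul_def by (rule restrict_PiE_iff[THEN iffD2, rule_format])
  qed
  show "bij_betw (spin_mul V \<sigma>) (spins V) (spins V)" if \<sigma>: "\<sigma> \<in> spins V" for \<sigma>
  proof (rule bij_betwI)
    have "spin_mul V \<sigma> (spin_mul V \<sigma> \<tau>) = \<tau>" if \<tau>: "\<tau> \<in> spins V" for \<tau>
    proof
      fix x
      show "spin_mul V \<sigma> (spin_mul V \<sigma> \<tau>) x = \<tau> x"
      proof (cases "x \<in> V")
        case True
        then show ?thesis
          using spins_cases[OF \<sigma> True] by (auto simp: spin_mul_def)
      next
        case False
        then show ?thesis
          using PiE_arb[OF \<tau>[unfolded spins_def] False] by (simp add: spin_mul_def)
      qed
    qed
    then show "\<tau> \<in> spins V \<Longrightarrow> spin_mul V \<sigma> (spin_mul V \<sigma> \<tau>) = \<tau>"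
      "\<tau> \<in> spins V \<Longrightarrow> spin_mul V \<sigma> (spin_mul V \<sigma> \<tau>) = \<tau>" for \<tau>
      by blast+
  qed (use closed \<sigma> in blast)+
  show "edge_sign E (spin_mul V \<sigma> \<tau>) e = edge_sign E \<sigma> e * edge_sign E \<tau> e"
    if st: "\<sigma> \<in> spins V" "\<tau> \<in> spins V" "e \<in> E" for \<sigma> \<tau> e
  proof -
    obtain x y where xy: "x \<in> V" "y \<in> V" "e = {x, y}"
      using G st(3) by (auto simp: finite_graph_def)
    note eq = edge_sign_eq[OF _ xy(1,2), of _ E]
    show ?thesis
      unfolding xy(3) using st xy closed[OF st(1,2)]
      by (simp add: eq[of "spin_mul V \<sigma> \<tau>"] eq[of \<sigma>] eq[of \<tau>]) (simp add: spin_mul_def)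
  qed
  show "\<exists>\<sigma>\<in>spins V. edge_sign E \<sigma> e = -1" if e: "e \<in> E" for e
  proof -
    obtain x y where xy: "x \<in> V" "y \<in> V" "x \<noteq> y" "e = {x, y}"
      using G e by (auto simp: finite_graph_def)
    let ?\<sigma> = "\<lambda>z\<in>V. if z = x then -1 else 1 :: int"
    have "?\<sigma> \<in> spins V"
      by (auto simp: spins_def)
    moreover from this have "edge_sign E ?\<sigma> e = -1"
      using xy e by (simp add: edge_sign_eq)
    ultimately show ?thesis by blast
  qed
qed

lemma set_pmf_ising:
  assumes "finite V" shows "set_pmf (ising V E J) \<subseteq> spins V"
proof
  fix \<sigma> assume "\<sigma> \<in> set_pmf (ising V E J)"
  then show "\<sigma> \<in> spins V"
    using pmf_ising[OF assms, of E J \<sigma>] by (cases "\<sigma> \<in> spins V") (simp_all add: set_pmf_iff)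
qed

lemma set_pmf_energy_field_perc: "finite E \<Longrightarrow> set_pmf (energy_field_perc V E J p) \<subseteq> Pow E"
  unfolding energy_field_perc_def by (rule set_pmf_inter)

lemma prob_energy_field_perc:
  assumes G: "finite_graph V E"
  shows "measure_pmf.prob (energy_field_perc V E J p) A
    = (\<Sum>\<sigma>\<in>spins V. pmf (ising V E J) \<sigma> * measure_pmf.prob (Ber E p) {\<beta>. xi E \<sigma> \<inter> \<beta> \<in> A})"
proof -
  have V: "finite V" and E: "finite E"
    using G finite_graph_finite_edges by (auto simp: finite_graph_def)
  have fin: "finite (set_pmf (ising V E J))"
    using set_pmf_ising[OF V] finite_spins[OF V] by (rule finite_subset)
  have eq: "(\<lambda>(\<omega>, \<omega>'). \<omega> \<inter> \<omega>') -` A = {z. fst z \<inter> snd z \<in> A}"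
    by (simp add: vimage_def case_prod_unfold)
  have "measure_pmf.prob (energy_field_perc V E J p) A
      = measure_pmf.expectation (energy_field V E J) (\<lambda>\<omega>. measure_pmf.prob (Ber E p) {\<beta>. \<omega> \<inter> \<beta> \<in> A})"
    unfolding energy_field_perc_def inter_pmf_def measure_map_pmf eq
    by (rule prob_pair_pmf) (use fin finite_set_pmf_Ber[OF E] in \<open>simp_all add: energy_field_def\<close>)
  also have "\<dots> = measure_pmf.expectation (ising V E J) (\<lambda>\<sigma>. measure_pmf.prob (Ber E p) {\<beta>. xi E \<sigma> \<inter> \<beta> \<in> A})"
    by (simp add: energy_field_def)
  also have "\<dots> = (\<Sum>\<sigma>\<in>spins V. pmf (ising V E J) \<sigma> *\<^sub>R measure_pmf.prob (Ber E p) {\<beta>. xi E \<sigma> \<inter> \<beta> \<in> A})"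
    by (rule integral_measure_pmf[OF finite_spins[OF V]]) (use set_pmf_ising[OF V, of E J] in blast)
  finally show ?thesis by simp
qed

locale ising_graph =
  fixes V :: "'v set" and E :: "'v set set"
  assumes graph: "finite_graph V E"
begin

sublocale sign_system "spins V" E "edge_sign E" "spin_mul V"
  by (rule sign_system_ising[OF graph])

lemma pmf_ising_gibbs:
  assumes "\<sigma> \<in> spins V"
  shows "pmf (ising V E J) \<sigma> = gibbs J \<sigma> / (\<Sum>\<tau>\<in>spins V. gibbs J \<tau>)"
proof -
  have V: "finite V"
    using graph by (simp add: finite_graph_def)
  have w: "ising_weight E J \<tau> = exp (\<Sum>e\<in>E. J e) * gibbs J \<tau>" for \<tau>
  proof -
    \<comment> \<open>Twice the indicator of agreement is 1 plus the sign, so the Ising weight is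
      \<open>gibbs\<close> up to a constant, which normalization cancels.\<close>
    have "2 * (\<Sum>e\<in>E. J e * of_bool (e \<in> xi E \<tau>)) = (\<Sum>e\<in>E. J e) + (\<Sum>e\<in>E. J e * edge_sign E \<tau> e)"
      unfolding sum_distrib_left sum.distrib[symmetric]
      by (rule sum.cong) (auto simp: edge_sign_def)
    then show ?thesis
      by (simp add: ising_weight_def gibbs_def exp_add)
  qed
  show ?thesis
    using assms by (simp add: pmf_ising[OF V] w flip: sum_distrib_left)
qed

text \<open>For \<open>p e = 0\<close> the factor \<open>\<alpha> e\<close> vanishes and any
  \<open>r e\<close> would represent the law; the value 0 isolates the edge in a class of its own,
  where no positive probability is required.\<close>

lemma represents_perc:
  assumes p: "p \<in> E \<rightarrow> {0..1}"
  shows "represents (energy_field_perc V E J p) J (\<lambda>e. p e / 2) (\<lambda>e. of_bool (p e \<noteq> 0))"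
proof (rule representsI)
  fix S assume S: "S \<subseteq> E"
  have "measure_pmf.prob (Ber E p) {\<beta>. xi E \<sigma> \<inter> \<beta> \<in> {\<omega>. S \<subseteq> \<omega>}}
      = (\<Prod>e\<in>S. p e / 2 * (1 + of_bool (p e \<noteq> 0) * edge_sign E \<sigma> e))" for \<sigma>
  proof (cases "S \<subseteq> xi E \<sigma>")
    case True
    then have "{\<beta>. xi E \<sigma> \<inter> \<beta> \<in> {\<omega>. S \<subseteq> \<omega>}} = {\<beta>. S \<subseteq> \<beta>}" by auto
    moreover have "(\<Prod>e\<in>S. p e / 2 * (1 + of_bool (p e \<noteq> 0) * edge_sign E \<sigma> e)) = (\<Prod>e\<in>S. p e)"
      using True by (intro prod.cong) (auto simp: edge_sign_def)
    ultimately show ?thesis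
      by (simp add: prob_Ber_superset[OF finite_E S p])
  next
    case False
    then have empty: "{\<beta>. xi E \<sigma> \<inter> \<beta> \<in> {\<omega>. S \<subseteq> \<omega>}} = {}" by auto
    from False have "(\<Prod>e\<in>S. p e / 2 * (1 + of_bool (p e \<noteq> 0) * edge_sign E \<sigma> e)) = 0"
      using finite_subset[OF S finite_E] by (auto simp: edge_sign_def)
    then show ?thesis
      unfolding empty by simp
  qed
  then show "measure_pmf.prob (energy_field_perc V E J p) {\<omega>. S \<subseteq> \<omega>}
      = (\<Sum>\<sigma>\<in>spins V. gibbs J \<sigma> / (\<Sum>\<tau>\<in>spins V. gibbs J \<tau>)
          * (\<Prod>e\<in>S. p e / 2 * (1 + of_bool (p e \<noteq> 0) * edge_sign E \<sigma> e)))"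
    unfolding prob_energy_field_perc[OF graph] by (intro sum.cong refl) (simp only: pmf_ising_gibbs)
qed

lemma represents_compl_perc:
  assumes p: "p \<in> E \<rightarrow> {0..1}"
  shows "represents (compl_pmf E (energy_field_perc V E J p)) J (\<lambda>e. 1 - p e / 2) (\<lambda>e. - p e / (2 - p e))"
proof (rule representsI)
  fix S assume S: "S \<subseteq> E"
  have vim: "(\<lambda>\<omega>. E - \<omega>) -` {\<omega>. S \<subseteq> \<omega>} = {\<omega>. S \<inter> \<omega> = {}}"
    using S by auto
  have "measure_pmf.prob (Ber E p) {\<beta>. xi E \<sigma> \<inter> \<beta> \<in> {\<omega>. S \<inter> \<omega> = {}}}
      = (\<Prod>e\<in>S. (1 - p e / 2) * (1 + - p e / (2 - p e) * edge_sign E \<sigma> e))" for \<sigma>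
  proof -
    have "{\<beta>. xi E \<sigma> \<inter> \<beta> \<in> {\<omega>. S \<inter> \<omega> = {}}} = {\<beta>. (S \<inter> xi E \<sigma>) \<inter> \<beta> = {}}" by auto
    then have "measure_pmf.prob (Ber E p) {\<beta>. xi E \<sigma> \<inter> \<beta> \<in> {\<omega>. S \<inter> \<omega> = {}}}
        = (\<Prod>e\<in>S \<inter> xi E \<sigma>. 1 - p e)"
      using S by (simp add: prob_Ber_disjoint[OF finite_E _ p] le_infI1)
    also have "\<dots> = (\<Prod>e\<in>S. if e \<in> xi E \<sigma> then 1 - p e else 1)"
      using finite_subset[OF S finite_E] by (simp add: prod.If_cases)
    also have "\<dots> = (\<Prod>e\<in>S. (1 - p e / 2) * (1 + - p e / (2 - p e) * edge_sign E \<sigma> e))"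
    proof (rule prod.cong[OF refl])
      fix e assume "e \<in> S"
      then have "p e \<le> 1"
        using S p by (auto simp: Pi_iff)
      then show "(if e \<in> xi E \<sigma> then 1 - p e else 1)
          = (1 - p e / 2) * (1 + - p e / (2 - p e) * edge_sign E \<sigma> e)"
        by (auto simp: edge_sign_def field_simps)
    qed
    finally show ?thesis .
  qed
  then show "measure_pmf.prob (compl_pmf E (energy_field_perc V E J p)) {\<omega>. S \<subseteq> \<omega>}
      = (\<Sum>\<sigma>\<in>spins V. gibbs J \<sigma> / (\<Sum>\<tau>\<in>spins V. gibbs J \<tau>)
          * (\<Prod>e\<in>S. (1 - p e / 2) * (1 + - p e / (2 - p e) * edge_sign E \<sigma> e)))"
    unfolding compl_pmf_def measure_map_pmf vim prob_energy_field_perc[OF graph]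
    by (intro sum.cong refl) (simp only: pmf_ising_gibbs)
qed

text \<open>Since \<open>(1 + r) / (1 - r) = 1 - p e\<close>, the last inequality is
  \<open>p e < p_dagger J e\<close> in the form that the duplication asks for.\<close>

lemma subcritical_coupling:
  assumes "0 < J e" "0 \<le> p e" "p e < p_dagger J e"
  defines "r \<equiv> - p e / (2 - p e)"
  shows "-1 < r" "r \<le> 0" "exp (-2 * J e) * (1 - r) < exp (2 * J e) * (1 + r)"
proof -
  have "exp (- 4 * J e) > 0" by simp
  then have p1: "p e < 1"
    using assms(3) unfolding p_dagger_def by linarith
  show "-1 < r" "r \<le> 0"
    using p1 assms(2) by (auto simp: r_def field_simps)
  have "exp (-2 * J e) = exp (2 * J e) * exp (- 4 * J e)"
    by (simp flip: exp_add)
  also have "\<dots> < exp (2 * J e) * (1 - p e)"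
    using assms(3) by (simp add: p_dagger_def)
  finally have "exp (-2 * J e) * (2 / (2 - p e)) < exp (2 * J e) * (1 - p e) * (2 / (2 - p e))"
    using p1 by (intro mult_strict_right_mono) auto
  moreover have "1 - r = 2 / (2 - p e)" "1 + r = (1 - p e) * (2 / (2 - p e))"
    using p1 by (auto simp: r_def field_simps)
  ultimately show "exp (-2 * J e) * (1 - r) < exp (2 * J e) * (1 + r)"
    by (simp only: mult.assoc)
qed

lemma finite_set_pmf_perc:
  "finite (set_pmf (energy_field_perc V E J p))" "finite (set_pmf (compl_pmf E (energy_field_perc V E J p)))"
  by (rule finite_set_pmf_Pow[OF set_pmf_energy_field_perc[OF finite_E] finite_E],
      rule finite_set_pmf_Pow[OF set_pmf_compl finite_E])

lemma weak_dagger_FKG_subcritical: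
  assumes J: "\<forall>e\<in>E. 0 < J e" and p: "p \<in> E \<rightarrow> {0..1}" and sub: "\<forall>e\<in>E. p e < p_dagger J e"
  shows "weak_dagger_FKG E (energy_field_perc V E J p)"
  unfolding weak_dagger_FKG_iff[OF finite_E set_pmf_energy_field_perc[OF finite_E]]
proof
  have p0: "0 \<le> p e" if "e \<in> E" for e
    using p that by auto
  show "\<exists>a\<in>E \<rightarrow> {0<..1}. FKG E (inter_pmf (energy_field_perc V E J p) (Ber E a))"
    by (rule FKG_thinning[OF finite_set_pmf_perc(1) represents_perc[OF p], where \<gamma> = 1])
       (use J p0 in \<open>auto simp: less_le\<close>)
  show "\<exists>a\<in>E \<rightarrow> {0<..1}. FKG E (inter_pmf (compl_pmf E (energy_field_perc V E J p)) (Ber E a))"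
  proof (rule FKG_thinning[OF finite_set_pmf_perc(2) represents_compl_perc[OF p], where \<gamma> = "-1"])
    fix e assume e: "e \<in> E"
    note c = subcritical_coupling[of J e p]
    show "0 \<le> -1 * (- p e / (2 - p e)) \<and> -1 < - p e / (2 - p e) \<and> - p e / (2 - p e) \<le> 1"
      using c(1,2) e J p0 sub by force
    show "exp (-2 * J e) * (1 - - p e / (2 - p e)) < exp (2 * J e) * (1 + - p e / (2 - p e))"
      using c(3) e J p0 sub by blast
    show "0 < 1 - p e / 2"
      using p e by (auto simp: Pi_iff)
  qed (use J in auto)
qed

lemma weak_dagger_dom_subcritical:
  assumes J: "\<forall>e\<in>E. 0 < J e" and p: "p \<in> E \<rightarrow> {0..1}" and sub: "\<forall>e\<in>E. p e < p_dagger J e"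
    and le: "\<forall>e\<in>E. J e \<le> J' e"
  shows "weak_dagger_dom E (energy_field_perc V E J p) (energy_field_perc V E J' p)"
proof -
  let ?\<mu> = "energy_field_perc V E J p" and ?\<nu> = "energy_field_perc V E J' p"
  have p0: "0 \<le> p e" if "e \<in> E" for e
    using p that by auto
  have "\<exists>a\<in>E \<rightarrow> {0<..1}. stoch_dom E (inter_pmf (if 1 = (1::real) then ?\<mu> else ?\<nu>) (Ber E a))
      (inter_pmf (if 1 = (1::real) then ?\<nu> else ?\<mu>) (Ber E a))"
  proof (rule stoch_dom_thinning[OF finite_set_pmf_perc(1) finite_set_pmf_perc(1) represents_perc[OF p] represents_perc[OF p]])
    show "0 < p e / 2" if "e \<in> E" "of_bool (p e \<noteq> 0) \<noteq> (0::real)" for e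
      using p0[of e] that by simp
    show "exp (- 2 * J e) * (1 - of_bool (p e \<noteq> 0)) < exp (2 * J e) * (1 + of_bool (p e \<noteq> 0))" if "e \<in> E" for e
      using J that by simp
  qed (use J le in auto)
  then have 1: "\<exists>a\<in>E \<rightarrow> {0<..1}. stoch_dom E (inter_pmf ?\<mu> (Ber E a)) (inter_pmf ?\<nu> (Ber E a))"
    by simp
  have "\<exists>a\<in>E \<rightarrow> {0<..1}. stoch_dom E (inter_pmf (if - 1 = (1::real) then compl_pmf E ?\<mu> else compl_pmf E ?\<nu>) (Ber E a))
      (inter_pmf (if - 1 = (1::real) then compl_pmf E ?\<nu> else compl_pmf E ?\<mu>) (Ber E a))"
  proof (rule stoch_dom_thinning[OF finite_set_pmf_perc(2) finite_set_pmf_perc(2) represents_compl_perc[OF p] represents_compl_perc[OF p]])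
    fix e assume e: "e \<in> E"
    note c = subcritical_coupling[of J e p]
    show "0 \<le> -1 * (- p e / (2 - p e)) \<and> -1 < - p e / (2 - p e) \<and> - p e / (2 - p e) \<le> 1"
      using c(1,2) e J p0 sub by force
    show "exp (-2 * J e) * (1 - - p e / (2 - p e)) < exp (2 * J e) * (1 + - p e / (2 - p e))"
      using c(3) e J p0 sub by blast
    show "0 < 1 - p e / 2"
      using p e by (auto simp: Pi_iff)
  qed (use J le in auto)
  then have 2: "\<exists>a\<in>E \<rightarrow> {0<..1}. stoch_dom E (inter_pmf (compl_pmf E ?\<nu>) (Ber E a)) (inter_pmf (compl_pmf E ?\<mu>) (Ber E a))"
    by simp
  have supp: "set_pmf ?\<mu> \<subseteq> Pow E" "set_pmf ?\<nu> \<subseteq> Pow E"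
    by (rule set_pmf_energy_field_perc[OF finite_E])+
  show ?thesis
    using weak_dagger_dom_iff[OF finite_E supp] 1 2 by (rule iffD2[OF _ conjI])
qed

end

section \<open>The four-cycle\<close>

lemma sum_PiE_insert:
  fixes f :: "('a \<Rightarrow> 'b) \<Rightarrow> real"
  assumes "x \<notin> A"
  shows "(\<Sum>\<sigma>\<in>PiE (insert x A) B. f \<sigma>) = (\<Sum>y\<in>B x. \<Sum>g\<in>PiE A B. f (g(x := y)))"
  unfolding PiE_insert_eq
  by (subst sum.reindex[OF inj_combinator[OF assms]]) (simp add: sum.cartesian_product case_prod_unfold)

definition V4 :: "nat set" where
  "V4 = {0, 1, 2, 3}"

definition C4 :: "nat set set" where
  "C4 = {{0, 1}, {1, 2}, {2, 3}, {0, 3}}"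

lemma graph_C4: "finite_graph V4 C4"
  by (auto simp: finite_graph_def C4_def V4_def)

interpretation C4: ising_graph V4 C4
  by (rule ising_graph.intro[OF graph_C4])

lemma prod_C4: "(\<Prod>e\<in>C4. f e) = f {0, 1} * f {1, 2} * f {2, 3} * f {0, 3}"
  by (simp add: C4_def doubleton_eq_iff mult.assoc)

text \<open>Among the products of signs over sets of edges, only those over the empty set and the
  whole cycle survive the summation; every other set has a vertex of odd degree. The number 16
  counts the spin configurations.\<close>

lemma sum_spins_C4:
  fixes u v :: "nat set \<Rightarrow> real"
  shows "(\<Sum>\<sigma>\<in>spins V4. \<Prod>e\<in>C4. u e + v e * edge_sign C4 \<sigma> e)
    = 16 * ((\<Prod>e\<in>C4. u e) + (\<Prod>e\<in>C4. v e))"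
proof -
  have "(\<Sum>\<sigma>\<in>spins V4. \<Prod>e\<in>C4. u e + v e * edge_sign C4 \<sigma> e)
      = (\<Sum>\<sigma>\<in>spins V4. (u {0, 1} + v {0, 1} * real_of_int (\<sigma> 0 * \<sigma> 1)) * (u {1, 2} + v {1, 2} * real_of_int (\<sigma> 1 * \<sigma> 2))
        * (u {2, 3} + v {2, 3} * real_of_int (\<sigma> 2 * \<sigma> 3)) * (u {0, 3} + v {0, 3} * real_of_int (\<sigma> 0 * \<sigma> 3)))"
    by (rule sum.cong[OF refl]) (simp only: prod_C4, simp add: edge_sign_eq V4_def C4_def)
  also have "\<dots> = 16 * ((\<Prod>e\<in>C4. u e) + (\<Prod>e\<in>C4. v e))"
    unfolding spins_def V4_def prod_C4 by (simp add: sum_PiE_insert) (simp add: algebra_simps)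
  finally show ?thesis .
qed

lemma corr_C4:
  "C4.corr J a = 16 * (\<Prod>e\<in>C4. cosh (J e))
    * ((\<Prod>e\<in>C4. 1 + tanh (J e) * a e) + (\<Prod>e\<in>C4. tanh (J e) + a e))"
proof -
  have "C4.corr J a = (\<Sum>\<sigma>\<in>spins V4. (\<Prod>e\<in>C4. cosh (J e))
      * (\<Prod>e\<in>C4. (1 + tanh (J e) * a e) + (tanh (J e) + a e) * edge_sign C4 \<sigma> e))"
    unfolding C4.corr_def
  proof (rule sum.cong[OF refl])
    fix \<sigma> assume \<sigma>: "\<sigma> \<in> spins V4"
    have "(\<Prod>e\<in>C4. 1 + tanh (J e) * edge_sign C4 \<sigma> e) * (\<Prod>e\<in>C4. 1 + a e * edge_sign C4 \<sigma> e)
        = (\<Prod>e\<in>C4. (1 + tanh (J e) * a e) + (tanh (J e) + a e) * edge_sign C4 \<sigma> e)"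
      unfolding prod.distrib[symmetric]
      by (rule prod.cong[OF refl]) (simp add: edge_sign_def algebra_simps)
    then show "C4.gibbs J \<sigma> * C4.observable a \<sigma> = (\<Prod>e\<in>C4. cosh (J e))
        * (\<Prod>e\<in>C4. (1 + tanh (J e) * a e) + (tanh (J e) + a e) * edge_sign C4 \<sigma> e)"
      by (simp add: C4.gibbs_tanh[OF \<sigma>] C4.observable_def mult.assoc)
  qed
  then show ?thesis
    by (simp add: sum_distrib_left[symmetric] sum_spins_C4)
qed

text \<open>Restricting to \<open>S\<close> turns the high-temperature weight
  \<open>\<theta> = tanh (J e)\<close> of its edges into
  \<open>(\<theta> + r e) / (1 + \<theta> * r e)\<close>, as in the addition formula for tanh, and
  \<open>- x e\<close> is the ratio of the new weight to the old one. The two terms stem from the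
  empty set and the full cycle.\<close>

lemma prob_C4:
  assumes rep: "C4.represents \<mu> J \<alpha> r" and S: "S \<subseteq> C4"
    and nz: "\<And>e. e \<in> S \<Longrightarrow> tanh (J e) \<noteq> 0 \<and> 1 + tanh (J e) * r e \<noteq> 0"
  defines "x \<equiv> \<lambda>e. - (tanh (J e) + r e) / (tanh (J e) * (1 + tanh (J e) * r e))"
  shows "measure_pmf.prob \<mu> {\<omega>. S \<subseteq> \<omega>} = (\<Prod>e\<in>S. \<alpha> e * (1 + tanh (J e) * r e))
    * (1 + (\<Prod>e\<in>C4. tanh (J e)) * (\<Prod>e\<in>S. - x e)) / (1 + (\<Prod>e\<in>C4. tanh (J e)))"
proof -
  let ?\<theta> = "\<lambda>e. tanh (J e)"
  have fin: "finite S"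
    using S C4.finite_E finite_subset by blast
  have if_S: "(\<Prod>e\<in>S. f e) = (\<Prod>e\<in>C4. if e \<in> S then f e else 1)" for f :: "nat set \<Rightarrow> real"
    using S C4.finite_E by (simp add: prod.If_cases Int_absorb1)
  have "(\<Prod>e\<in>C4. 1 + ?\<theta> e * C4.on S r e) = (\<Prod>e\<in>S. 1 + ?\<theta> e * r e)"
    unfolding if_S by (rule prod.cong[OF refl]) (simp add: C4.on_def)
  moreover have "(\<Prod>e\<in>C4. ?\<theta> e + C4.on S r e)
      = (\<Prod>e\<in>S. 1 + ?\<theta> e * r e) * ((\<Prod>e\<in>C4. ?\<theta> e) * (\<Prod>e\<in>S. - x e))"
    unfolding if_S prod.distrib[symmetric]
  proof (rule prod.cong[OF refl])
    fix e assume "e \<in> C4"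
    have "B * (A * - (- C / (A * B))) = C" if "A \<noteq> 0" "B \<noteq> 0" for A B C :: real
      using that by simp
    then show "?\<theta> e + C4.on S r e
        = (if e \<in> S then 1 + ?\<theta> e * r e else 1) * (?\<theta> e * (if e \<in> S then - x e else 1))"
      using nz[of e] by (simp only: C4.on_def x_def split: if_split) simp
  qed
  ultimately have "C4.corr J (C4.on S r) = 16 * (\<Prod>e\<in>C4. cosh (J e)) * ((\<Prod>e\<in>S. 1 + ?\<theta> e * r e)
      * (1 + (\<Prod>e\<in>C4. ?\<theta> e) * (\<Prod>e\<in>S. - x e)))"
    unfolding corr_C4 by (simp add: algebra_simps)
  moreover have "C4.corr J (\<lambda>_. 0) = 16 * (\<Prod>e\<in>C4. cosh (J e)) * (1 + (\<Prod>e\<in>C4. ?\<theta> e))"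
    unfolding corr_C4 by simp
  moreover have "(\<Prod>e\<in>C4. cosh (J e)) \<noteq> 0"
    using C4.finite_E by simp
  ultimately have "C4.corr J (C4.on S r) / C4.corr J (\<lambda>_. 0)
      = (\<Prod>e\<in>S. 1 + ?\<theta> e * r e) * (1 + (\<Prod>e\<in>C4. ?\<theta> e) * (\<Prod>e\<in>S. - x e)) / (1 + (\<Prod>e\<in>C4. ?\<theta> e))"
    by simp
  moreover have "measure_pmf.prob \<mu> {\<omega>. S \<subseteq> \<omega>} = (\<Prod>e\<in>S. \<alpha> e) * (C4.corr J (C4.on S r) / C4.corr J (\<lambda>_. 0))"
    using rep S unfolding C4.represents_def by blast
  ultimately show ?thesis
    by (simp only: prod.distrib mult.assoc times_divide_eq_right)
qed

text \<open>For \<open>p < 1\<close> the hypothesis says that the coupling of a closed edge is at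
  most \<open>- J\<close>, so its tanh is at most \<open>- tanh J\<close> and the quotient is at
  least 1. The argument avoids the logarithm in order to include \<open>p = 1\<close>.\<close>

lemma supercritical_coupling:
  fixes J p :: real
  assumes J: "0 < J" and p: "1 - exp (- 4 * J) \<le> p" "p \<le> 1"
  defines "r \<equiv> - p / (2 - p)"
  shows "0 < tanh J" "0 < 1 + tanh J * r" "1 \<le> - (tanh J + r) / (tanh J * (1 + tanh J * r))"
proof -
  define w where "w = exp (-2 * J)"
  have w: "0 < w" "w < 1"
    using J by (auto simp: w_def)
  have w2: "exp (- 4 * J) = w\<^sup>2"
    by (simp add: w_def power2_eq_square flip: exp_add)
  have th: "tanh J = (1 - w) / (1 + w)"
    by (simp add: tanh_real_altdef w_def)
  show t0: "0 < tanh J"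
    using J by simp
  have "w\<^sup>2 < 1"
    using w by (simp add: power_less_one_iff abs_square_less_1)
  then have p0: "0 < p" using p w2 by simp
  have r1: "-1 \<le> r"
    using p by (simp add: r_def field_simps)
  have "tanh J * -1 \<le> tanh J * r"
    using r1 t0 by (intro mult_left_mono) auto
  moreover have "tanh J < 1"
    by (rule tanh_real_lt_1)
  ultimately show pos: "0 < 1 + tanh J * r"
    by simp
  have "(1 - w\<^sup>2) * (2 - p) \<le> p * (1 + w\<^sup>2)"
    using p w2 by (simp add: algebra_simps)
  then have "(1 - w\<^sup>2) / (1 + w\<^sup>2) \<le> p / (2 - p)"
    using p w by (simp add: divide_simps add_pos_pos mult.commute)
  \<comment> \<open>Both sides are \<open>tanh (2 * J)\<close>.\<close>
  moreover have "2 * tanh J / (1 + (tanh J)\<^sup>2) = (1 - w\<^sup>2) / (1 + w\<^sup>2)"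
  proof -
    have "1 + (tanh J)\<^sup>2 = 2 * (1 + w\<^sup>2) / (1 + w)\<^sup>2"
      using w unfolding th by (simp add: divide_simps) (simp add: algebra_simps power2_eq_square)
    moreover have "2 * tanh J = 2 * (1 - w\<^sup>2) / (1 + w)\<^sup>2"
      using w unfolding th by (simp add: divide_simps) (simp add: algebra_simps power2_eq_square)
    moreover have "2 * A / d / (2 * B / d) = A / B" if "d \<noteq> 0" for A B d :: real
      using that by simp
    moreover have "(1 + w)\<^sup>2 \<noteq> 0"
      using w by simp
    ultimately show ?thesis
      by (simp only:)
  qed
  ultimately have "2 * tanh J / (1 + (tanh J)\<^sup>2) \<le> - r"
    by (simp add: r_def)
  then have "2 * tanh J \<le> - r * (1 + (tanh J)\<^sup>2)"
    by (subst (asm) pos_divide_le_eq) (auto intro: add_pos_nonneg)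
  then have "tanh J * (1 + tanh J * r) \<le> - (tanh J + r)"
    by (simp add: algebra_simps power2_eq_square)
  then show "1 \<le> - (tanh J + r) / (tanh J * (1 + tanh J * r))"
    using t0 pos by (simp add: le_divide_eq)
qed

lemma prob_superset_or:
  "measure_pmf.prob \<rho> {\<omega>. S \<subseteq> \<omega> \<or> T \<subseteq> \<omega>}
    = measure_pmf.prob \<rho> {\<omega>. S \<subseteq> \<omega>} + measure_pmf.prob \<rho> {\<omega>. T \<subseteq> \<omega>} - measure_pmf.prob \<rho> {\<omega>. S \<union> T \<subseteq> \<omega>}"
proof -
  have "measure_pmf.prob \<rho> ({\<omega>. S \<subseteq> \<omega>} \<union> {\<omega>. T \<subseteq> \<omega>})
      = measure_pmf.prob \<rho> {\<omega>. S \<subseteq> \<omega>} + measure_pmf.prob \<rho> {\<omega>. T \<subseteq> \<omega>}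
        - measure_pmf.prob \<rho> ({\<omega>. S \<subseteq> \<omega>} \<inter> {\<omega>. T \<subseteq> \<omega>})"
    by (rule measure_Un3) (simp_all add: measure_pmf.fmeasurable_eq_sets)
  moreover have "{\<omega>. S \<subseteq> \<omega>} \<union> {\<omega>. T \<subseteq> \<omega>} = {\<omega>. S \<subseteq> \<omega> \<or> T \<subseteq> \<omega>}"
    "{\<omega>. S \<subseteq> \<omega>} \<inter> {\<omega>. T \<subseteq> \<omega>} = {\<omega>. S \<union> T \<subseteq> \<omega>}"
    by auto
  ultimately show ?thesis by simp
qed

text \<open>
  Critical and supercritical edges enter the four-cycle with a sign: absence of the edges of \<open>S\<close> has
  weight \<open>1 + q x\<^sub>S\<close> for even and \<open>1 - q x\<^sub>S\<close> for odd \<open>|S|\<close>, where \<open>x\<^sub>S \<ge> 1\<close>.  Hence \<open>S\<close> and the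
  fourth edge are nonpositively correlated for \<open>|S| = 2\<close> and strictly positively for \<open>|S| = 3\<close>, and
  inclusion-exclusion for the event \<open>e\<^sub>1 \<and> (e\<^sub>2 \<or> e\<^sub>3)\<close> makes all three contributions negative.
\<close>
lemma four_cycle_neg_correlated:
  fixes c1 c2 c3 c4 x1 x2 x3 x4 q :: real
  assumes c: "0 < c1" "0 < c2" "0 < c3" "0 < c4" and x: "1 \<le> x1" "1 \<le> x2" "1 \<le> x3" "1 \<le> x4" and q: "0 < q"
  shows "c1 * c2 * c4 * (1 - q * (x1 * x2 * x4)) / (1 + q) + c1 * c3 * c4 * (1 - q * (x1 * x3 * x4)) / (1 + q)
      - c1 * c2 * c3 * c4 * (1 + q * (x1 * x2 * x3 * x4)) / (1 + q)
    < (c1 * c2 * (1 + q * (x1 * x2)) / (1 + q) + c1 * c3 * (1 + q * (x1 * x3)) / (1 + q)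
        - c1 * c2 * c3 * (1 - q * (x1 * x2 * x3)) / (1 + q)) * (c4 * (1 - q * x4) / (1 + q))"
    (is "?l1 / _ + ?l2 / _ - ?l3 / _ < (?r1 / _ + ?r2 / _ - ?r3 / _) * (?r4 / _)")
proof -
  have xx: "1 \<le> x1 * x2" "1 \<le> x1 * x3"
    using x mult_mono[of 1 x1 1 x2] mult_mono[of 1 x1 1 x3] by auto
  have x123: "0 < x1 * x2 * x3"
    using x by (intro mult_pos_pos) auto
  have "0 < c1 * c2 * c3 * (1 + x1 * x2 * x3)"
    using c x123 by (intro mult_pos_pos) auto
  moreover have "0 \<le> c1 * c2 * (x1 * x2 - 1)" "0 \<le> c1 * c3 * (x1 * x3 - 1)"
    using c xx by auto
  ultimately have "0 < c4 * q * (1 + x4) * (c1 * c2 * (x1 * x2 - 1) + c1 * c3 * (x1 * x3 - 1) + c1 * c2 * c3 * (1 + x1 * x2 * x3))"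
    using c x q by (intro mult_pos_pos) auto
  also have "\<dots> = (?r1 + ?r2 - ?r3) * ?r4 - (?l1 + ?l2 - ?l3) * (1 + q)"
    by (simp add: algebra_simps)
  finally have lt: "(?l1 + ?l2 - ?l3) * (1 + q) < (?r1 + ?r2 - ?r3) * ?r4"
    by simp
  have "(?l1 + ?l2 - ?l3) * (1 + q) / ((1 + q) * (1 + q)) < (?r1 + ?r2 - ?r3) * ?r4 / ((1 + q) * (1 + q))"
    using q by (intro divide_strict_right_mono[OF lt]) simp
  then show ?thesis
    using q by (simp add: add_divide_distrib[symmetric] diff_divide_distrib[symmetric])
qed

text \<open>Over a common denominator the difference is \<open>q' - q\<close> times the sum that
  also settles the negative correlation: two nonnegative terms from pairs and a strictly positive
  one from the triple.\<close>

lemma four_cycle_increasing: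
  fixes c1 c2 c3 x1 x2 x3 q q' :: real
  assumes c: "0 < c1" "0 < c2" "0 < c3" and x: "1 \<le> x1" "1 \<le> x2" "1 \<le> x3" and q: "0 < q" "q < q'"
  shows "c1 * c2 * (1 + q * (x1 * x2)) / (1 + q) + c1 * c3 * (1 + q * (x1 * x3)) / (1 + q)
        - c1 * c2 * c3 * (1 - q * (x1 * x2 * x3)) / (1 + q)
    < c1 * c2 * (1 + q' * (x1 * x2)) / (1 + q') + c1 * c3 * (1 + q' * (x1 * x3)) / (1 + q')
        - c1 * c2 * c3 * (1 - q' * (x1 * x2 * x3)) / (1 + q')"
    (is "?l1 / _ + ?l2 / _ - ?l3 / _ < ?r1 / _ + ?r2 / _ - ?r3 / _")
proof -
  have xx: "1 \<le> x1 * x2" "1 \<le> x1 * x3"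
    using x mult_mono[of 1 x1 1 x2] mult_mono[of 1 x1 1 x3] by auto
  have x123: "0 < x1 * x2 * x3"
    using x by (intro mult_pos_pos) auto
  have "0 < c1 * c2 * c3 * (1 + x1 * x2 * x3)"
    using c x123 by (intro mult_pos_pos) auto
  moreover have "0 \<le> c1 * c2 * (x1 * x2 - 1)" "0 \<le> c1 * c3 * (x1 * x3 - 1)"
    using c xx by auto
  ultimately have "0 < (q' - q) * (c1 * c2 * (x1 * x2 - 1) + c1 * c3 * (x1 * x3 - 1) + c1 * c2 * c3 * (1 + x1 * x2 * x3))"
    using q by (intro mult_pos_pos) auto
  also have "\<dots> = (?r1 + ?r2 - ?r3) * (1 + q) - (?l1 + ?l2 - ?l3) * (1 + q')"
    by (simp add: algebra_simps)
  finally have "(?l1 + ?l2 - ?l3) / (1 + q) < (?r1 + ?r2 - ?r3) / (1 + q')"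
    using q by (simp add: divide_less_eq less_divide_eq)
  then show ?thesis
    by (simp add: add_divide_distrib diff_divide_distrib)
qed

context
  fixes J p a :: "nat set \<Rightarrow> real"
  assumes J: "\<forall>e\<in>C4. 0 < J e" and p: "p \<in> C4 \<rightarrow> {0..1}" and super: "\<forall>e\<in>C4. p_dagger J e \<le> p e"
    and a: "a \<in> C4 \<rightarrow> {0<..1}"
begin

private definition r :: "nat set \<Rightarrow> real" where
  "r e = - p e / (2 - p e)"

private definition x :: "nat set \<Rightarrow> real" where
  "x e = - (tanh (J e) + r e) / (tanh (J e) * (1 + tanh (J e) * r e))"

text \<open>The Bernoulli density enters only through this positive factor, and the inequalities for
  the four-cycle hold for arbitrary positive factors; this is why no density helps.\<close>

private definition c :: "nat set \<Rightarrow> real" where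
  "c e = (1 - p e / 2) * (1 + tanh (J e) * r e) * a e"

private lemma edge_facts:
  assumes "e \<in> C4"
  shows "0 < tanh (J e)" "0 < 1 + tanh (J e) * r e" "1 \<le> x e" "0 < c e"
proof -
  have *: "0 < J e" "1 - exp (- 4 * J e) \<le> p e" "p e \<le> 1" "0 < a e"
    using assms J p super a by (auto simp: p_dagger_def)
  show "0 < tanh (J e)" "0 < 1 + tanh (J e) * r e" "1 \<le> x e"
    using supercritical_coupling[OF *(1-3)] by (simp_all add: r_def x_def)
  then show "0 < c e"
    using * by (simp add: c_def)
qed

private definition W :: "real \<Rightarrow> nat set set \<Rightarrow> real" where
  "W q S = (\<Prod>e\<in>S. c e) * (1 + q * (\<Prod>e\<in>S. - x e)) / (1 + q)"

private lemma W_insert: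
  "W q {e} = c e * (1 - q * x e) / (1 + q)"
  "e \<noteq> f \<Longrightarrow> W q {e, f} = c e * c f * (1 + q * (x e * x f)) / (1 + q)"
  "e \<noteq> f \<Longrightarrow> e \<noteq> g \<Longrightarrow> f \<noteq> g \<Longrightarrow>
    W q {e, f, g} = c e * c f * c g * (1 - q * (x e * x f * x g)) / (1 + q)"
  "e \<noteq> f \<Longrightarrow> e \<noteq> g \<Longrightarrow> f \<noteq> g \<Longrightarrow> e \<noteq> h \<Longrightarrow> f \<noteq> h \<Longrightarrow> g \<noteq> h \<Longrightarrow>
    W q {e, f, g, h} = c e * c f * c g * c h * (1 + q * (x e * x f * x g * x h)) / (1 + q)"
  by (simp_all add: W_def mult.assoc)

text \<open>The couplings need to agree only on \<open>S\<close>, so that changing the coupling of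
  an edge outside \<open>S\<close> affects nothing but the parameter \<open>q\<close>.\<close>

private lemma prob_absent:
  assumes S: "S \<subseteq> C4" and J': "\<And>e. e \<in> S \<Longrightarrow> J' e = J e"
  shows "measure_pmf.prob (inter_pmf (compl_pmf C4 (energy_field_perc V4 C4 J' p)) (Ber C4 a)) {\<omega>. S \<subseteq> \<omega>}
    = W (\<Prod>e\<in>C4. tanh (J' e)) S"
proof -
  let ?\<mu> = "compl_pmf C4 (energy_field_perc V4 C4 J' p)"
  have nz: "tanh (J' e) \<noteq> 0 \<and> 1 + tanh (J' e) * (- p e / (2 - p e)) \<noteq> 0" if "e \<in> S" for e
  proof -
    have e: "e \<in> C4" using that S by auto
    show ?thesis
      unfolding J'[OF that] using edge_facts(1)[OF e] edge_facts(2)[OF e, unfolded r_def]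
      by (intro conjI less_imp_neq[THEN not_sym])
  qed
  have x: "(\<Prod>e\<in>S. - (- (tanh (J' e) + - p e / (2 - p e)) / (tanh (J' e) * (1 + tanh (J' e) * (- p e / (2 - p e))))))
      = (\<Prod>e\<in>S. - x e)"
    by (rule prod.cong[OF refl]) (simp add: x_def r_def J')
  have c: "(\<Prod>e\<in>S. c e) = (\<Prod>e\<in>S. (1 - p e / 2) * (1 + tanh (J' e) * (- p e / (2 - p e)))) * (\<Prod>e\<in>S. a e)"
    unfolding prod.distrib[symmetric] by (rule prod.cong[OF refl]) (simp add: c_def r_def J')
  have "a \<in> C4 \<rightarrow> {0..1}"
    using a by (auto simp: Pi_iff less_imp_le)
  then have "measure_pmf.prob (inter_pmf ?\<mu> (Ber C4 a)) {\<omega>. S \<subseteq> \<omega>} = measure_pmf.prob ?\<mu> {\<omega>. S \<subseteq> \<omega>} * (\<Prod>e\<in>S. a e)"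
    by (rule prob_inter_superset[OF C4.finite_E C4.finite_set_pmf_perc(2) _ S])
  also have "measure_pmf.prob ?\<mu> {\<omega>. S \<subseteq> \<omega>}
      = (\<Prod>e\<in>S. (1 - p e / 2) * (1 + tanh (J' e) * (- p e / (2 - p e))))
        * (1 + (\<Prod>e\<in>C4. tanh (J' e)) * (\<Prod>e\<in>S. - x e)) / (1 + (\<Prod>e\<in>C4. tanh (J' e)))"
    using prob_C4[OF C4.represents_compl_perc[OF p, of J'] S nz] unfolding x by simp
  finally show ?thesis
    unfolding W_def c by simp
qed

private lemma edges:
  "{0, 1} \<in> C4" "{1, 2} \<in> C4" "{2, 3} \<in> C4" "{0, 3} \<in> C4"
  "{0, 1} \<noteq> {1, 2 :: nat}" "{0, 1} \<noteq> {2, 3 :: nat}" "{0, 1} \<noteq> {0, 3 :: nat}"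
  "{1, 2} \<noteq> {2, 3 :: nat}" "{1, 2} \<noteq> {0, 3 :: nat}" "{2, 3} \<noteq> {0, 3 :: nat}"
  by (auto simp: C4_def doubleton_eq_iff)

lemma not_FKG_C4:
  "\<not> FKG C4 (inter_pmf (compl_pmf C4 (energy_field_perc V4 C4 J p)) (Ber C4 a))"
proof
  let ?\<rho> = "inter_pmf (compl_pmf C4 (energy_field_perc V4 C4 J p)) (Ber C4 a)"
  assume FKG: "FKG C4 ?\<rho>"
  define e1 e2 e3 e4 :: "nat set" where e: "e1 = {0, 1}" "e2 = {1, 2}" "e3 = {2, 3}" "e4 = {0, 3}"
  note edges' = edges[folded e]
  \<comment> \<open>A pair of edges alone would not do: for \<open>p e = p_dagger J e\<close> all
    \<open>x e\<close> equal 1 and a pair is uncorrelated with the fourth edge. The disjunction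
    brings in the triple, which is strictly correlated and enters with a negative sign.\<close>
  let ?A = "{\<omega>. {e1, e2} \<subseteq> \<omega> \<or> {e1, e3} \<subseteq> \<omega>}" and ?B = "{\<omega>. {e4} \<subseteq> \<omega>}"
  have "mono_on (Pow C4) (indicator ?A :: _ \<Rightarrow> real)" "mono_on (Pow C4) (indicator ?B :: _ \<Rightarrow> real)"
    by (auto intro!: mono_onI simp: indicator_def)
  from FKG[unfolded FKG_def, rule_format, OF this]
  have "measure_pmf.prob ?\<rho> ?A * measure_pmf.prob ?\<rho> ?B \<le> measure_pmf.prob ?\<rho> (?A \<inter> ?B)"
    by (simp add: indicator_inter_arith[symmetric])
  also have "?A \<inter> ?B = {\<omega>. {e1, e2, e4} \<subseteq> \<omega> \<or> {e1, e3, e4} \<subseteq> \<omega>}"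
    by auto
  finally have le: "measure_pmf.prob ?\<rho> ?A * measure_pmf.prob ?\<rho> ?B
      \<le> measure_pmf.prob ?\<rho> {\<omega>. {e1, e2, e4} \<subseteq> \<omega> \<or> {e1, e3, e4} \<subseteq> \<omega>}" .
  define q where "q = (\<Prod>e\<in>C4. tanh (J e))"
  have Un: "{e1, e2} \<union> {e1, e3} = {e1, e2, e3}" "{e1, e2, e4} \<union> {e1, e3, e4} = {e1, e2, e3, e4}"
    by auto
  have prob: "measure_pmf.prob ?\<rho> {\<omega>. S \<subseteq> \<omega>} = W q S" if "S \<subseteq> {e1, e2, e3, e4}" for S
    unfolding q_def by (rule prob_absent) (use that edges' in auto)
  have "(W q {e1, e2} + W q {e1, e3} - W q {e1, e2, e3}) * W q {e4}
      \<le> W q {e1, e2, e4} + W q {e1, e3, e4} - W q {e1, e2, e3, e4}"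
    using le unfolding prob_superset_or Un by (subst (asm) (1 2 3 4 5 6 7) prob) auto
  moreover have "0 < q"
    unfolding q_def by (rule prod_pos) (use edge_facts in auto)
  from four_cycle_neg_correlated[OF edges'(1-4)[THEN edge_facts(4)] edges'(1-4)[THEN edge_facts(3)] this]
  have "W q {e1, e2, e4} + W q {e1, e3, e4} - W q {e1, e2, e3, e4}
      < (W q {e1, e2} + W q {e1, e3} - W q {e1, e2, e3}) * W q {e4}"
    unfolding W_insert(1) W_insert(2)[OF edges'(5)] W_insert(2)[OF edges'(6)] W_insert(3)[OF edges'(5,6,8)]
      W_insert(3)[OF edges'(5,7,9)] W_insert(3)[OF edges'(6,7,10)] W_insert(4)[OF edges'(5,6,8,7,9,10)] .
  ultimately show False
    by simp
qed

text \<open>Only the coupling of \<open>{0, 3}\<close> is raised, an edge that the event does not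
  involve, so the raise acts through \<open>q\<close> alone. Any positive increment would
  serve.\<close>

lemma not_stoch_dom_C4:
  defines "J' \<equiv> J({0, 3} := J {0, 3} + 1)"
  shows "\<not> stoch_dom C4 (inter_pmf (compl_pmf C4 (energy_field_perc V4 C4 J' p)) (Ber C4 a))
    (inter_pmf (compl_pmf C4 (energy_field_perc V4 C4 J p)) (Ber C4 a))"
    (is "\<not> stoch_dom C4 ?\<rho>' ?\<rho>")
proof
  assume dom: "stoch_dom C4 ?\<rho>' ?\<rho>"
  define e1 e2 e3 e4 :: "nat set" where e: "e1 = {0, 1}" "e2 = {1, 2}" "e3 = {2, 3}" "e4 = {0, 3}"
  note edges' = edges[folded e]
  have J'_eq: "J' e1 = J e1" "J' e2 = J e2" "J' e3 = J e3" "J' e4 = J e4 + 1"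
    using edges' by (auto simp: J'_def e(4)[symmetric])
  let ?A = "{\<omega>. {e1, e2} \<subseteq> \<omega> \<or> {e1, e3} \<subseteq> \<omega>}"
  have "increasing_event C4 (?A \<inter> Pow C4)"
    by (auto simp: increasing_event_def)
  then have "measure_pmf.prob ?\<rho>' (?A \<inter> Pow C4) \<le> measure_pmf.prob ?\<rho> (?A \<inter> Pow C4)"
    using dom unfolding stoch_dom_def by blast
  moreover have "measure_pmf.prob \<rho> ?A = measure_pmf.prob \<rho> (?A \<inter> Pow C4)" if "\<rho> = ?\<rho> \<or> \<rho> = ?\<rho>'" for \<rho>
    by (rule prob_cong_support) (use that set_pmf_inter[OF C4.finite_E] in blast)
  ultimately have "measure_pmf.prob ?\<rho>' ?A \<le> measure_pmf.prob ?\<rho> ?A"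
    by simp
  moreover define q q' where "q = (\<Prod>e\<in>C4. tanh (J e))" and "q' = (\<Prod>e\<in>C4. tanh (J' e))"
  moreover have Un: "{e1, e2} \<union> {e1, e3} = {e1, e2, e3}"
    by auto
  have "measure_pmf.prob ?\<rho> {\<omega>. S \<subseteq> \<omega>} = W q S" "measure_pmf.prob ?\<rho>' {\<omega>. S \<subseteq> \<omega>} = W q' S"
    if "S \<subseteq> {e1, e2, e3}" for S
    unfolding q_def q'_def by (rule prob_absent, use that edges'(1-3) J'_eq(1-3) in blast, use that J'_eq(1-3) in blast)+
  note prob_sub = this
  have prob: "measure_pmf.prob ?\<rho> {\<omega>. S \<subseteq> \<omega>} = W q S" "measure_pmf.prob ?\<rho>' {\<omega>. S \<subseteq> \<omega>} = W q' S"
    if "S \<in> {{e1, e2}, {e1, e3}, {e1, e2, e3}}" for S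
  proof -
    have "S \<subseteq> {e1, e2, e3}"
      using that by blast
    then show "measure_pmf.prob ?\<rho> {\<omega>. S \<subseteq> \<omega>} = W q S" "measure_pmf.prob ?\<rho>' {\<omega>. S \<subseteq> \<omega>} = W q' S"
      by (rule prob_sub)+
  qed
  ultimately have le: "W q' {e1, e2} + W q' {e1, e3} - W q' {e1, e2, e3} \<le> W q {e1, e2} + W q {e1, e3} - W q {e1, e2, e3}"
    unfolding prob_superset_or Un by (simp only: prob insert_iff simp_thms)
  have "0 < q"
    unfolding q_def by (rule prod_pos) (use edge_facts in auto)
  moreover have "q < q'"
    unfolding q_def q'_def prod_C4 e[symmetric] J'_eq
    using edge_facts(1) edges' by (intro mult_strict_left_mono mult_pos_pos) auto
  ultimately have "W q {e1, e2} + W q {e1, e3} - W q {e1, e2, e3} < W q' {e1, e2} + W q' {e1, e3} - W q' {e1, e2, e3}"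
    unfolding W_insert(2)[OF edges'(5)] W_insert(2)[OF edges'(6)] W_insert(3)[OF edges'(5,6,8)]
    using four_cycle_increasing[OF edges'(1-3)[THEN edge_facts(4)] edges'(1-3)[THEN edge_facts(3)]] by blast
  then show False
    using le by simp
qed

end

theorem theorem4p5:
  shows "(\<forall>(V :: 'v set) (E :: 'v set set) (J :: 'v set \<Rightarrow> real).
            finite_graph V E \<longrightarrow> (\<forall>e\<in>E. 0 < J e) \<longrightarrow>
            (\<forall>p \<in> E \<rightarrow> {0..1}. (\<forall>e\<in>E. p e < p_dagger J e) \<longrightarrow>
               weak_dagger_FKG E (energy_field_perc V E J p) \<and>
               (\<forall>J1 J2. (\<forall>e\<in>E. J e \<le> J1 e \<and> J1 e \<le> J2 e) \<longrightarrow>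
                  weak_dagger_dom E (energy_field_perc V E J1 p) (energy_field_perc V E J2 p))))
         \<and>
         (\<exists>(V :: nat set) (E :: nat set set). finite_graph V E \<and>
            (\<forall>J :: nat set \<Rightarrow> real. (\<forall>e\<in>E. 0 < J e) \<longrightarrow>
              (\<forall>p \<in> E \<rightarrow> {0..1}. (\<forall>e\<in>E. p_dagger J e \<le> p e) \<longrightarrow>
                 \<not> weak_dagger_FKG E (energy_field_perc V E J p) \<and>
                 (\<exists>J'. (\<forall>e\<in>E. J e \<le> J' e) \<and>
                    \<not> weak_dagger_dom E (energy_field_perc V E J p) (energy_field_perc V E J' p)))))"
proof (intro conjI allI ballI impI)
  fix V :: "'v set" and E :: "'v set set" and J p
  assume G: "finite_graph V E" and J: "\<forall>e\<in>E. 0 < J e" and p: "p \<in> E \<rightarrow> {0..1}"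
    and sub: "\<forall>e\<in>E. p e < p_dagger J e"
  interpret ising_graph V E
    using G by unfold_locales
  show "weak_dagger_FKG E (energy_field_perc V E J p)"
    by (rule weak_dagger_FKG_subcritical[OF J p sub])
  fix J1 J2 assume le: "\<forall>e\<in>E. J e \<le> J1 e \<and> J1 e \<le> J2 e"
  show "weak_dagger_dom E (energy_field_perc V E J1 p) (energy_field_perc V E J2 p)"
  proof (rule weak_dagger_dom_subcritical[OF _ p])
    show "\<forall>e\<in>E. 0 < J1 e" "\<forall>e\<in>E. J1 e \<le> J2 e"
      using J le by force+
    \<comment> \<open>\<open>p_dagger\<close> increases with the coupling, so subcriticality passes
      from \<open>J\<close> to the larger \<open>J1\<close>.\<close>
    show "\<forall>e\<in>E. p e < p_dagger J1 e"
    proof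
      fix e assume "e \<in> E"
      then have "p e < p_dagger J e" "J e \<le> J1 e"
        using sub le by auto
      then show "p e < p_dagger J1 e"
        by (simp add: p_dagger_def less_le_trans)
    qed
  qed
next
  note supp = set_pmf_energy_field_perc[OF C4.finite_E]
  have "\<not> weak_dagger_FKG C4 (energy_field_perc V4 C4 J p) \<and>
      (\<exists>J'. (\<forall>e\<in>C4. J e \<le> J' e) \<and>
        \<not> weak_dagger_dom C4 (energy_field_perc V4 C4 J p) (energy_field_perc V4 C4 J' p))"
    if *: "\<forall>e\<in>C4. 0 < J e" "p \<in> C4 \<rightarrow> {0..1}" "\<forall>e\<in>C4. p_dagger J e \<le> p e" for J p
  proof (intro conjI exI)
    show "\<not> weak_dagger_FKG C4 (energy_field_perc V4 C4 J p)"
      unfolding weak_dagger_FKG_iff[OF C4.finite_E supp] using not_FKG_C4[OF *] by blast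
    let ?J = "J({0, 3} := J {0, 3} + 1)"
    show "\<forall>e\<in>C4. J e \<le> ?J e"
      by simp
    show "\<not> weak_dagger_dom C4 (energy_field_perc V4 C4 J p) (energy_field_perc V4 C4 ?J p)"
      unfolding weak_dagger_dom_iff[OF C4.finite_E supp supp] using not_stoch_dom_C4[OF *] by blast
  qed
  then show "\<exists>(V :: nat set) (E :: nat set set). finite_graph V E \<and>
      (\<forall>J :: nat set \<Rightarrow> real. (\<forall>e\<in>E. 0 < J e) \<longrightarrow>
        (\<forall>p \<in> E \<rightarrow> {0..1}. (\<forall>e\<in>E. p_dagger J e \<le> p e) \<longrightarrow>
           \<not> weak_dagger_FKG E (energy_field_perc V E J p) \<and>
           (\<exists>J'. (\<forall>e\<in>E. J e \<le> J' e) \<and>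
              \<not> weak_dagger_dom E (energy_field_perc V E J p) (energy_field_perc V E J' p))))"
    using graph_C4 by blast
qed

end
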